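(* Let $\alpha>\frac12$ and $p\ge1$ be fixed such that either $p\in\mathbb{N}$ or $p=\frac{m}{n}$ with $m$ and $n$ even and odd integers, respectively. Then there exist constants $a_0,b_0>0$ such that for any fixed $b\in(-b_0,b_0)$ the equation $-\Lambda^\alpha u-u+u^{p+1}=b$ on $\mathbb{R}$ admits a one-parameter family of even periodic solutions $\{u_{a,b}\}_{a\in(-a_0,a_0)}$ of the form $u_{a,b}(x)=P_{a,b}(k_{a,b}x)$, where $P_{a,b}$ is $2\pi$-periodic and smooth and $k_{a,b}>0$. Moreover: (i) The map $k:(-a_0,a_0)\times(-b_0,b_0)\to\mathbb{R}$ is analytic, even in $a$, and satisfies $k_{a,b}^\alpha=k^*(b)+\tilde k(a,b)$ where $k^*(b)=(p+1)Q_b^p-1$ and $\tilde k(a,b)=\sum_{n\ge1}\tilde k_{2n}(b)a^{2n}$ with $|\tilde k_{2n}(b)|\le K_0/\rho_0^{2n}$ for all $|(a,b)|$ small and some positive constants $K_0$ and $\rho_0>a_0$. (ii) The map $(a,b)\mapsto P_{a,b}\in H^\alpha(\mathbb{R}/2\pi\mathbb{Z})$ is analytic on $(-a_0,a_0)\times(-b_0,b_0)$ and can be expanded as $$P_{a,b}(z)=Q_b+a\cos z+\sum_{\substack{n,m\neq0,\ n+m\ge2\\ n-m\neq\pm1}}\tilde p_{n,m}(b)e^{i(n-m)z}a^{n+m},$$ with $n,m$ nonnegative integers, where $\tilde p_{n,m}(b)\in\mathbb{R}$, $\tilde p_{n,m}(b)=\tilde p_{m,n}(b)$, and $|\tilde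 p_{n,m}(b)|\le C_0/\rho_0^{n+m}$ for all $|b|$ small and some $C_0>0$. (iii) The Fourier coefficients $\hat p_n(a,b)$ in $P_{a,b}(z)=\sum_{n\in\mathbb{Z}}\hat p_n(a,b)e^{inz}$ are real and satisfy $\hat p_0(a,0)=1+\mathcal{O}(a^2)$ and $\hat p_n(a,0)=\mathcal{O}(|a|^{|n|})$ for $n\neq0$ as $a\to0$; moreover $a\mapsto\hat p_n(a,b)$ is even (resp. odd) for even (resp. odd) $n$.
   Context: $\Lambda=\sqrt{-\partial_x^2}$ is the Fourier multiplier with symbol $|k|$ (on the torus: $\Lambda^s f=\sum_{k\neq0}|k|^s\hat f(k)e^{ikx}$). For $|b|$ small, $Q_b$ denotes the unique constant solution of $-Q+Q^{p+1}=b$ continuing from $Q_0=1$. Equivalently to the $u$-equation, $P_{a,b}$ solves $-k_{a,b}^\alpha\Lambda^\alpha P-P+P^{p+1}=b$ on $\mathbb{R}/2\pi\mathbb{Z}$.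
   Formalization: The condition "n,m≠0" in the sum of (ii) is read as (n,m)≠(0,0), so terms with exactly one of n, m zero are included; excluding them would drop the a² cos 2z term, whose coefficient at b=0 is p(p+1)/(4p(2^α−1))≠0, and the expansion would be false. *)

theory Defs
  imports "HOL-Analysis.Analysis" "HOL-Library.Landau_Symbols"
begin

definition fcT :: "real \<Rightarrow> (real \<Rightarrow> real) \<Rightarrow> int \<Rightarrow> complex" where
  "fcT T f n = complex_of_real (1 / T) *
     integral {0..T} (\<lambda>x. complex_of_real (f x) * cis (- 2 * pi * of_int n * x / T))"

definition fc :: "(real \<Rightarrow> real) \<Rightarrow> int \<Rightarrow> complex" where
  "fc f n = fcT (2 * pi) f n"

definition lam_term :: "real \<Rightarrow> real \<Rightarrow> (real \<Rightarrow> real) \<Rightarrow> real \<Rightarrow> int \<Rightarrow> complex" where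
  "lam_term T s f x n = complex_of_real (\<bar>2 * pi * of_int n / T\<bar> powr s) * fcT T f n
      * cis (2 * pi * of_int n * x / T)"

definition frac_lap :: "real \<Rightarrow> real \<Rightarrow> (real \<Rightarrow> real) \<Rightarrow> real \<Rightarrow> complex" where
  "frac_lap T s f x = infsum (lam_term T s f x) UNIV"

text \<open>Real power x^p: x^p for natural p; for p = m/n (m even, n odd) this is |x|^p.\<close>
definition ppow :: "real \<Rightarrow> real \<Rightarrow> real" where
  "ppow p x = (if 0 \<le> x then x powr p
               else if p \<in> \<nat> then x ^ nat \<lfloor>p\<rfloor> else \<bar>x\<bar> powr p)"

text \<open>Q_b: constant solution of -Q + Q^(p+1) = b on the branch through Q_0 = 1
  (the branch on which q \<mapsto> q^(p+1) - q is strictly increasing).\<close>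
definition Qb :: "real \<Rightarrow> real \<Rightarrow> real" where
  "Qb p b = (THE q. (1 / (p + 1)) powr (1 / p) < q \<and> q powr (p + 1) - q = b)"

definition kstar :: "real \<Rightarrow> real \<Rightarrow> real" where
  "kstar p b = (p + 1) * Qb p b powr p - 1"

definition smooth_fun :: "(real \<Rightarrow> real) \<Rightarrow> bool" where
  "smooth_fun f \<longleftrightarrow> (\<forall>n x. ((deriv ^^ n) f) differentiable (at x))"

definition Hs_norm :: "real \<Rightarrow> (real \<Rightarrow> real) \<Rightarrow> real" where
  "Hs_norm s f = sqrt (infsum (\<lambda>n::int. (1 + (of_int n)\<^sup>2) powr s * (cmod (fc f n))\<^sup>2) UNIV)"

definition in_Hs :: "real \<Rightarrow> (real \<Rightarrow> real) \<Rightarrow> bool" where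
  "in_Hs s f \<longleftrightarrow> (\<forall>x. f (x + 2 * pi) = f x) \<and> f integrable_on {0..2*pi}
     \<and> (\<lambda>x. (f x)\<^sup>2) integrable_on {0..2*pi}
     \<and> (\<lambda>n::int. (1 + (of_int n)\<^sup>2) powr s * (cmod (fc f n))\<^sup>2) summable_on UNIV"

definition real_analytic2_on :: "(real \<times> real) set \<Rightarrow> (real \<Rightarrow> real \<Rightarrow> real) \<Rightarrow> bool" where
  "real_analytic2_on S f \<longleftrightarrow> (\<forall>(x0, y0) \<in> S. \<exists>r > 0. \<exists>c :: nat \<Rightarrow> nat \<Rightarrow> real.
     \<forall>x y. \<bar>x - x0\<bar> < r \<and> \<bar>y - y0\<bar> < r \<longrightarrow>
       ((\<lambda>(i, j). c i j * (x - x0) ^ i * (y - y0) ^ j) has_sum f x y) UNIV)"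

definition Hs_analytic2_on :: "real \<Rightarrow> (real \<times> real) set \<Rightarrow> (real \<Rightarrow> real \<Rightarrow> real \<Rightarrow> real) \<Rightarrow> bool" where
  "Hs_analytic2_on s S F \<longleftrightarrow> (\<forall>(a, b) \<in> S. in_Hs s (F a b)) \<and>
    (\<forall>(a0, b0) \<in> S. \<exists>r > 0. \<exists>C :: nat \<Rightarrow> nat \<Rightarrow> real \<Rightarrow> real.
     (\<forall>i j. in_Hs s (C i j)) \<and>
     (\<forall>a b. \<bar>a - a0\<bar> < r \<and> \<bar>b - b0\<bar> < r \<longrightarrow>
        (\<lambda>(i, j). Hs_norm s (C i j) * \<bar>a - a0\<bar> ^ i * \<bar>b - b0\<bar> ^ j) summable_on UNIV \<and>
        (\<lambda>N. Hs_norm s (\<lambda>z. F a b z -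
            (\<Sum>(i, j) \<in> {..N} \<times> {..N}. C i j z * (a - a0) ^ i * (b - b0) ^ j)))
          \<longlonglongrightarrow> 0))"

definition Iset :: "(nat \<times> nat) set" where
  "Iset = {(n, m). 2 \<le> n + m \<and> n \<noteq> m + 1 \<and> m \<noteq> n + 1}"

end

(* Write P = 1 + f and k^alpha = p + mu. The equation becomes
     p (1 - Lambda^alpha) f = b + mu Lambda^alpha f - N(f),   N(f) = (1 + f)^(p+1) - 1 - (p+1) f,
   where f is sought as a power series in x = a e^(iz), y = a e^(-iz) and b, and mu as a power series in
   x y and b. Lambda^alpha acts diagonally on monomials, and p (1 - Lambda^alpha) is invertible away from
   the frequencies 1 and -1, with Lambda^alpha times the inverse still bounded. Fixing the frequency +-1
   part of f to be (x + y) / 2, the equation at frequency 1 determines mu, and what remains is a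
   contraction, for small radius rho, in the Banach algebra of absolutely summable power series.
   Evaluating this single triple series yields all the assertions: the expansions and their geometric
   coefficient bounds, joint analyticity, parity in a, and the decay of the Fourier coefficients.
   The terms of order 0 and 1 in a identify Q_b and kstar(b). *)

theory Submission
  imports Defs "HOL-Complex_Analysis.Complex_Analysis" "HOL-Real_Asymp.Real_Asymp"
begin

subsection \<open>The convolution algebra of absolutely summable functions on a monoid\<close>

text \<open>The obstacle is loss of derivatives: \<Lambda>^\<alpha> is unbounded on an algebra of
  summable series. The unknown of the contraction is therefore not f but h, the right-hand side of
  the equation up to scaling, from which f and \<Lambda>^\<alpha> f are both recovered by bounded
  diagonal multipliers. Treating x and y as independent variables turns the frequency n - m and the
  order n + m into two gradings of the same monomials, so that one array of coefficients governs the
  order in a, the regularity in z and the dependence on b. Scaling all variables by \<rho> leaves a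
  factor \<rho> in front of every nonlinear term. Statements about functions are obtained from the
  algebra through characters: evaluation at a point is a bounded ring homomorphism, so it commutes
  with the binomial series, and at the points of interest it is real on elements invariant under the
  swap of x and y. Smallness also keeps 1 + f above the critical point of q^(p+1) - q, which is
  positive; there the powers are ordinary real powers and the constant solution is unique.\<close>

typedef 'i l1 = "{f :: 'i \<Rightarrow> real. (\<lambda>i. \<bar>f i\<bar>) summable_on UNIV}"
  morphisms coef Abs_l1
  by (rule exI[of _ "\<lambda>_. 0"]) simp

setup_lifting type_definition_l1

lemma coef_abs_summable: "(\<lambda>i. \<bar>coef f i\<bar>) summable_on UNIV"
  using coef[of f] by simp

lemma l1_eqI: "(\<And>i. coef f i = coef g i) \<Longrightarrow> f = g"
  by (auto simp: coef_inject[symmetric])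

lemma coef_Abs: "(\<lambda>i. \<bar>f i\<bar>) summable_on UNIV \<Longrightarrow> coef (Abs_l1 f) = f"
  by (rule Abs_l1_inverse) simp

lemma abs_summable_add:
  fixes f g :: "'a \<Rightarrow> real"
  assumes "(\<lambda>i. \<bar>f i\<bar>) summable_on A" "(\<lambda>i. \<bar>g i\<bar>) summable_on A"
  shows "(\<lambda>i. \<bar>f i + g i\<bar>) summable_on A" "(\<lambda>i. \<bar>f i - g i\<bar>) summable_on A"
  by (rule summable_on_comparison_test[OF summable_on_add[OF assms]]; auto intro: abs_triangle_ineq abs_triangle_ineq4)+

instantiation l1 :: (type) real_vector
begin

lift_definition zero_l1 :: "'a l1" is "\<lambda>_. 0" by simp

lift_definition plus_l1 :: "'a l1 \<Rightarrow> 'a l1 \<Rightarrow> 'a l1" is "\<lambda>f g i. f i + g i"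
  by (simp add: abs_summable_add)

lift_definition uminus_l1 :: "'a l1 \<Rightarrow> 'a l1" is "\<lambda>f i. - f i" by simp

lift_definition minus_l1 :: "'a l1 \<Rightarrow> 'a l1 \<Rightarrow> 'a l1" is "\<lambda>f g i. f i - g i"
  by (simp add: abs_summable_add)

lift_definition scaleR_l1 :: "real \<Rightarrow> 'a l1 \<Rightarrow> 'a l1" is "\<lambda>c f i. c * f i"
  by (auto simp: abs_mult intro: summable_on_cmult_right)

instance by standard (transfer; simp add: algebra_simps)+

end

instantiation l1 :: (type) real_normed_vector
begin

lift_definition norm_l1 :: "'a l1 \<Rightarrow> real" is "\<lambda>f. \<Sum>\<^sub>\<infinity>i. norm (f i)" .

definition dist_l1 :: "'a l1 \<Rightarrow> 'a l1 \<Rightarrow> real" where "dist_l1 f g = norm (f - g)"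
definition sgn_l1 :: "'a l1 \<Rightarrow> 'a l1" where "sgn_l1 f = f /\<^sub>R norm f"
definition uniformity_l1 :: "('a l1 \<times> 'a l1) filter"
  where "uniformity_l1 = (INF e\<in>{0 <..}. principal {(x, y). dist x y < e})"
definition open_l1 :: "'a l1 set \<Rightarrow> bool"
  where "open_l1 U = (\<forall>x\<in>U. \<forall>\<^sub>F (x', y) in uniformity. x' = x \<longrightarrow> y \<in> U)"

instance
proof
  fix f g :: "'a l1" and c :: real
  show "norm f = 0 \<longleftrightarrow> f = 0"
  proof
    assume "norm f = 0"
    hence "(\<Sum>\<^sub>\<infinity>i. \<bar>coef f i\<bar>) = 0" by (simp add: norm_l1.rep_eq)
    hence "\<bar>coef f i\<bar> = 0" for i
      using nonneg_infsum_le_0D[OF _ coef_abs_summable, of f i] by simp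
    thus "f = 0" by (intro l1_eqI) (simp add: zero_l1.rep_eq)
  qed (simp add: norm_l1.rep_eq zero_l1.rep_eq)
  show "norm (f + g) \<le> norm f + norm g"
    unfolding norm_l1.rep_eq plus_l1.rep_eq real_norm_def
    using coef_abs_summable[of f] coef_abs_summable[of g] coef_abs_summable[of "f + g"]
    by (subst infsum_add[symmetric])
       (auto simp: plus_l1.rep_eq intro!: infsum_mono summable_on_add)
  show "norm (c *\<^sub>R f) = \<bar>c\<bar> * norm f"
    unfolding norm_l1.rep_eq scaleR_l1.rep_eq by (simp add: abs_mult infsum_cmult_right')
qed (simp_all add: dist_l1_def sgn_l1_def uniformity_l1_def open_l1_def)

end

lemma norm_l1_eq: "norm f = (\<Sum>\<^sub>\<infinity>i. \<bar>coef f i\<bar>)"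
  by (simp add: norm_l1.rep_eq)

lemma coef_add [simp]: "coef (f + g) i = coef f i + coef g i"
  by (simp add: plus_l1.rep_eq)
lemma coef_diff [simp]: "coef (f - g) i = coef f i - coef g i"
  by (simp add: minus_l1.rep_eq)
lemma coef_zero [simp]: "coef 0 i = 0"
  by (simp add: zero_l1.rep_eq)
lemma coef_scaleR [simp]: "coef (c *\<^sub>R f) i = c * coef f i"
  by (simp add: scaleR_l1.rep_eq)

lemma abs_coef_le_norm: "\<bar>coef f i\<bar> \<le> norm f"
  using finite_sum_le_infsum[OF coef_abs_summable, of "{i}" f] by (simp add: norm_l1_eq)

lemma bounded_linear_coef: "bounded_linear (\<lambda>f. coef f i)"
  by (rule bounded_linear_intro[where K = 1]) (auto simp: abs_coef_le_norm)

lemma norm_l1_leI: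
  assumes "\<And>F. finite F \<Longrightarrow> (\<Sum>i\<in>F. \<bar>coef f i\<bar>) \<le> B"
  shows "norm f \<le> B"
  unfolding norm_l1_eq by (rule infsum_le_finite_sums[OF coef_abs_summable]) (use assms in auto)

text \<open>The limit is taken coefficientwise. Bounds on finite partial sums survive that limit,
  and since they are uniform in the finite set they give both summability of the limit and
  convergence in norm.\<close>

instance l1 :: (type) banach
proof
  fix X :: "nat \<Rightarrow> 'a l1" assume X: "Cauchy X"
  define g where "g i = lim (\<lambda>n. coef (X n) i)" for i
  have lim: "(\<lambda>n. coef (X n) i) \<longlonglongrightarrow> g i" for i
    unfolding g_def convergent_LIMSEQ_iff[symmetric]
    using bounded_linear.Cauchy[OF bounded_linear_coef X] Cauchy_convergent by blast
  have *: "\<exists>N. \<forall>n\<ge>N. \<forall>F. finite F \<longrightarrow> (\<Sum>i\<in>F. \<bar>coef (X n) i - g i\<bar>) \<le> e" if "e > 0" for e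
  proof -
    obtain N where N: "\<And>m n. m \<ge> N \<Longrightarrow> n \<ge> N \<Longrightarrow> norm (X n - X m) < e"
      using X \<open>e > 0\<close> by (meson Cauchy_iff)
    show ?thesis
    proof (intro exI[of _ N] allI impI)
      fix n F assume n: "n \<ge> N" and F: "finite (F :: 'a set)"
      have "(\<lambda>m. \<Sum>i\<in>F. \<bar>coef (X n) i - coef (X m) i\<bar>) \<longlonglongrightarrow> (\<Sum>i\<in>F. \<bar>coef (X n) i - g i\<bar>)"
        by (intro tendsto_intros lim)
      moreover have "(\<Sum>i\<in>F. \<bar>coef (X n) i - coef (X m) i\<bar>) \<le> e" if "m \<ge> N" for m
        using finite_sum_le_infsum[OF coef_abs_summable F, of "X n - X m"] N[OF that n]
        by (simp add: norm_l1_eq)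
      ultimately show "(\<Sum>i\<in>F. \<bar>coef (X n) i - g i\<bar>) \<le> e"
        by (meson LIMSEQ_le_const2)
    qed
  qed
  obtain N where N: "\<And>n F. n \<ge> N \<Longrightarrow> finite F \<Longrightarrow> (\<Sum>i\<in>F. \<bar>coef (X n) i - g i\<bar>) \<le> 1"
    using *[of 1] by auto
  have "(\<lambda>i. \<bar>coef (X N) i - g i\<bar>) summable_on UNIV"
    by (rule nonneg_bdd_above_summable_on) (use N[of N] in \<open>auto intro!: bdd_aboveI2[where M = 1]\<close>)
  from summable_on_add[OF this coef_abs_summable[of "X N"]]
  have "(\<lambda>i. \<bar>g i\<bar>) summable_on UNIV"
    by (rule summable_on_comparison_test) auto
  hence g: "coef (Abs_l1 g) = g" by (rule coef_Abs)
  have "X \<longlonglongrightarrow> Abs_l1 g"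
  proof (rule LIMSEQ_I)
    fix r :: real assume "r > 0"
    then obtain N where N: "\<And>n F. n \<ge> N \<Longrightarrow> finite F \<Longrightarrow> (\<Sum>i\<in>F. \<bar>coef (X n) i - g i\<bar>) \<le> r / 2"
      using *[of "r / 2"] by auto
    have "norm (X n - Abs_l1 g) \<le> r / 2" if "n \<ge> N" for n
      by (rule norm_l1_leI) (use N that g in auto)
    thus "\<exists>no. \<forall>n\<ge>no. norm (X n - Abs_l1 g) < r"
      using \<open>r > 0\<close> by (intro exI[of _ N]) (smt (verit) field_sum_of_halves)
  qed
  thus "convergent X" by (auto simp: convergent_def)
qed

section \<open>Double sums and convolution\<close>

lemma summable_on_times:
  fixes f :: "'a \<Rightarrow> real" and g :: "'b \<Rightarrow> real"
  assumes f: "(\<lambda>i. \<bar>f i\<bar>) summable_on A" and g: "(\<lambda>j. \<bar>g j\<bar>) summable_on B"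
  shows "(\<lambda>(i, j). \<bar>f i\<bar> * \<bar>g j\<bar>) summable_on A \<times> B"
proof (rule summable_on_SigmaI)
  show "(\<lambda>i. \<bar>f i\<bar> * (\<Sum>\<^sub>\<infinity>j\<in>B. \<bar>g j\<bar>)) summable_on A"
    using f by (rule summable_on_cmult_left)
  show "((\<lambda>j. case (i, j) of (i, j) \<Rightarrow> \<bar>f i\<bar> * \<bar>g j\<bar>) has_sum \<bar>f i\<bar> * (\<Sum>\<^sub>\<infinity>j\<in>B. \<bar>g j\<bar>)) B" for i
    using has_sum_cmult_right[OF has_sum_infsum[OF g], of "\<bar>f i\<bar>"] by simp
qed auto

lemma has_sum_times:
  fixes f :: "'a \<Rightarrow> 'c::{banach, real_normed_field}" and g :: "'b \<Rightarrow> 'c"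
  assumes f: "(f has_sum a) A" and g: "(g has_sum b) B"
    and abs: "(\<lambda>i. norm (f i)) summable_on A" "(\<lambda>j. norm (g j)) summable_on B"
  shows "((\<lambda>(i, j). f i * g j) has_sum (a * b)) (A \<times> B)"
proof (rule has_sum_SigmaI)
  show "((\<lambda>j. case (i, j) of (i, j) \<Rightarrow> f i * g j) has_sum (f i * b)) B" for i
    using has_sum_cmult_right[OF g, of "f i"] by simp
  show "((\<lambda>i. f i * b) has_sum (a * b)) A"
    by (rule has_sum_cmult_left[OF f])
  show "(\<lambda>(i, j). f i * g j) summable_on A \<times> B"
    by (rule Infinite_Sum.abs_summable_summable)
      (use summable_on_times[of "\<lambda>i. norm (f i)" A "\<lambda>j. norm (g j)" B] abs in \<open>simp add: norm_mult case_prod_unfold\<close>)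
qed

text \<open>The fibre over k may be infinite; an unconditional sum makes the definition independent
  of any finiteness of decompositions in the monoid.\<close>

definition conv :: "('i::comm_monoid_add \<Rightarrow> real) \<Rightarrow> ('i \<Rightarrow> real) \<Rightarrow> 'i \<Rightarrow> real" where
  "conv f g k = (\<Sum>\<^sub>\<infinity>(i, j)\<in>{(i, j). i + j = k}. f i * g j)"

text \<open>One exchange of summation serves three purposes according to the weight: the constant 1
  gives summability of the convolution, its signs give submultiplicativity of the norm, and a
  character gives multiplicativity of evaluation.\<close>

lemma conv_has_sum_weighted:
  fixes f g :: "'i::comm_monoid_add \<Rightarrow> real" and \<phi> :: "'i \<Rightarrow> 'b::{real_normed_field,banach}"
  assumes f: "(\<lambda>i. \<bar>f i\<bar>) summable_on UNIV" and g: "(\<lambda>i. \<bar>g i\<bar>) summable_on UNIV"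
    and \<phi>: "\<And>k. norm (\<phi> k) \<le> B"
  shows "(\<lambda>(i, j). norm (\<phi> (i + j) * of_real (f i * g j))) summable_on UNIV"
    and "((\<lambda>k. \<phi> k * of_real (conv f g k)) has_sum
           (\<Sum>\<^sub>\<infinity>(i, j). \<phi> (i + j) * of_real (f i * g j))) UNIV"
proof -
  have fg: "(\<lambda>(i, j). \<bar>f i * g j\<bar>) summable_on UNIV"
    using summable_on_times[OF f g] by (simp add: abs_mult)
  show abs: "(\<lambda>(i, j). norm (\<phi> (i + j) * of_real (f i * g j))) summable_on UNIV"
  proof (rule summable_on_comparison_test)
    show "(\<lambda>(i, j). B * \<bar>f i * g j\<bar>) summable_on UNIV"
      using summable_on_cmult_right[OF fg, of B] by (simp add: case_prod_unfold)
  qed (auto simp: norm_mult abs_mult intro!: mult_right_mono \<phi>)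
  define h where "h = (\<lambda>(k, (i, j)). \<phi> k * of_real (f i * g j) :: 'b)"
  have bij: "bij_betw (\<lambda>(i, j). (i + j, (i, j))) UNIV (SIGMA k:UNIV. {(i, j). i + j = k})"
    by (rule bij_betwI[of _ _ _ snd]) (auto simp: Pi_def)
  have "((\<lambda>(i, j). \<phi> (i + j) * of_real (f i * g j)) has_sum
           (\<Sum>\<^sub>\<infinity>(i, j). \<phi> (i + j) * of_real (f i * g j))) UNIV"
    by (rule has_sum_infsum, rule Infinite_Sum.abs_summable_summable)
       (use abs in \<open>simp add: case_prod_unfold\<close>)
  also have "?this \<longleftrightarrow> (h has_sum (\<Sum>\<^sub>\<infinity>(i, j). \<phi> (i + j) * of_real (f i * g j)))
      (SIGMA k:UNIV. {(i, j). i + j = k})"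
    unfolding h_def
    by (subst has_sum_reindex_bij_betw[OF bij, symmetric]) (simp add: case_prod_unfold)
  finally have hs: "(h has_sum (\<Sum>\<^sub>\<infinity>(i, j). \<phi> (i + j) * of_real (f i * g j)))
      (SIGMA k:UNIV. {(i, j). i + j = k})" .
  have fib: "((\<lambda>x. h (k, x)) has_sum (\<phi> k * of_real (conv f g k))) {(i, j). i + j = k}" for k
  proof -
    have "(\<lambda>(i, j). \<bar>f i * g j\<bar>) summable_on {(i, j). i + j = k}"
      by (rule summable_on_subset_banach[OF fg]) auto
    note s = this
    have "((\<lambda>(i, j). f i * g j) has_sum conv f g k) {(i, j). i + j = k}"
      unfolding conv_def by (rule has_sum_infsum, rule Infinite_Sum.abs_summable_summable)
        (use s in \<open>simp add: case_prod_unfold\<close>)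
    from has_sum_of_real[OF this]
    have "((\<lambda>x. of_real (case x of (i, j) \<Rightarrow> f i * g j)) has_sum (of_real (conv f g k) :: 'b)) {(i, j). i + j = k}"
      by (simp add: o_def)
    from has_sum_cmult_right[OF this, of "\<phi> k"]
    show ?thesis by (simp add: h_def case_prod_unfold)
  qed
  show "((\<lambda>k. \<phi> k * of_real (conv f g k)) has_sum
           (\<Sum>\<^sub>\<infinity>(i, j). \<phi> (i + j) * of_real (f i * g j))) UNIV"
    by (rule has_sum_SigmaD[OF hs fib])
qed

lemma conv_abs_summable:
  fixes f g :: "'i::comm_monoid_add \<Rightarrow> real"
  assumes f: "(\<lambda>i. \<bar>f i\<bar>) summable_on UNIV" and g: "(\<lambda>i. \<bar>g i\<bar>) summable_on UNIV"
  shows "(\<lambda>i. \<bar>conv f g i\<bar>) summable_on UNIV"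
proof -
  have "conv f g summable_on UNIV"
    using has_sum_imp_summable[OF conv_has_sum_weighted(2)[OF f g, of "\<lambda>_. 1 :: real" 1]] by simp
  thus ?thesis
    by (subst (asm) summable_on_iff_abs_summable_on_real) simp
qed


lemma conv_fibre_summable:
  fixes f g :: "'i::comm_monoid_add \<Rightarrow> real"
  assumes f: "(\<lambda>i. \<bar>f i\<bar>) summable_on UNIV" and g: "(\<lambda>i. \<bar>g i\<bar>) summable_on UNIV"
  shows "(\<lambda>(i, j). f i * g j) summable_on X"
proof -
  have "(\<lambda>(i, j). f i * g j) summable_on UNIV"
    by (rule Infinite_Sum.abs_summable_summable)
      (use summable_on_times[OF f g] in \<open>simp add: abs_mult case_prod_unfold\<close>)
  thus ?thesis by (rule summable_on_subset_banach) auto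
qed

lemma conv_commute: "conv f g k = conv g f (k :: 'i::comm_monoid_add)"
  unfolding conv_def
  by (rule infsum_reindex_bij_witness[of _ "\<lambda>(i, j). (j, i)" "\<lambda>(i, j). (j, i)"])
     (auto simp: add.commute mult.commute)

text \<open>The right-hand side treats the three factors alike, so associativity reduces to
  commutativity and a cyclic relabelling of the indices.\<close>

lemma conv_conv:
  fixes f g h :: "'i::comm_monoid_add \<Rightarrow> real"
  assumes f: "(\<lambda>i. \<bar>f i\<bar>) summable_on UNIV" and g: "(\<lambda>i. \<bar>g i\<bar>) summable_on UNIV"
    and h: "(\<lambda>i. \<bar>h i\<bar>) summable_on UNIV"
  shows "conv (conv f g) h k = (\<Sum>\<^sub>\<infinity>(i, j, l)\<in>{(i, j, l). i + j + l = k}. f i * g j * h l)"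
proof -
  let ?S = "SIGMA xl:{(x, l). x + l = k}. {(i, j). i + j = fst xl}"
  have "(\<lambda>(j, l). \<bar>g j * h l\<bar>) summable_on UNIV"
    using summable_on_times[OF g h] by (simp add: abs_mult)
  hence s: "(\<lambda>(i, j, l). \<bar>f i\<bar> * \<bar>g j * h l\<bar>) summable_on UNIV"
    using summable_on_times[OF f, of "\<lambda>(j, l). g j * h l" UNIV] by (simp add: case_prod_unfold)
  have "(\<lambda>(i, j, l). f i * g j * h l) summable_on UNIV"
    by (rule Infinite_Sum.abs_summable_summable)
       (use s in \<open>simp add: abs_mult case_prod_unfold mult.assoc\<close>)
  hence "(\<lambda>(i, j, l). f i * g j * h l) summable_on {(i, j, l). i + j + l = k}"
    by (rule summable_on_subset_banach) auto
  hence "((\<lambda>(i, j, l). f i * g j * h l) has_sum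
      (\<Sum>\<^sub>\<infinity>(i, j, l)\<in>{(i, j, l). i + j + l = k}. f i * g j * h l)) {(i, j, l). i + j + l = k}"
    by (rule has_sum_infsum)
  also have "?this \<longleftrightarrow> ((\<lambda>((x, l), (i, j)). f i * g j * h l) has_sum
      (\<Sum>\<^sub>\<infinity>(i, j, l)\<in>{(i, j, l). i + j + l = k}. f i * g j * h l)) ?S"
    by (rule has_sum_reindex_bij_witness[of _ "\<lambda>((x, l), (i, j)). (i, j, l)" "\<lambda>(i, j, l). ((i + j, l), (i, j))"])
       auto
  finally have "((\<lambda>xl. conv f g (fst xl) * h (snd xl)) has_sum
      (\<Sum>\<^sub>\<infinity>(i, j, l)\<in>{(i, j, l). i + j + l = k}. f i * g j * h l)) {(x, l). x + l = k}"
  proof (rule has_sum_SigmaD)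
    fix xl assume "xl \<in> {(x, l). x + l = k}"
    have "((\<lambda>(i, j). f i * g j) has_sum conv f g (fst xl)) {(i, j). i + j = fst xl}"
      unfolding conv_def by (intro has_sum_infsum conv_fibre_summable f g)
    from has_sum_cmult_left[OF this, of "h (snd xl)"]
    show "((\<lambda>y. (\<lambda>((x, l), (i, j)). f i * g j * h l) (xl, y)) has_sum
            conv f g (fst xl) * h (snd xl)) {(i, j). i + j = fst xl}"
      by (simp add: case_prod_unfold)
  qed
  thus ?thesis
    unfolding conv_def[of "conv f g" h] by (simp add: case_prod_unfold infsumI)
qed

lemma conv_assoc:
  fixes f g h :: "'i::comm_monoid_add \<Rightarrow> real"
  assumes f: "(\<lambda>i. \<bar>f i\<bar>) summable_on UNIV" and g: "(\<lambda>i. \<bar>g i\<bar>) summable_on UNIV"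
    and h: "(\<lambda>i. \<bar>h i\<bar>) summable_on UNIV"
  shows "conv (conv f g) h k = conv f (conv g h) k"
  unfolding conv_commute[of f] conv_conv[OF f g h] conv_conv[OF g h f]
  by (rule infsum_reindex_bij_witness[of _ "\<lambda>(j, l, i). (i, j, l)" "\<lambda>(i, j, l). (j, l, i)"])
     (auto simp: ac_simps)

definition delta :: "'i \<Rightarrow> 'i \<Rightarrow> real" where
  "delta i = (\<lambda>j. if j = i then 1 else 0)"

lemma delta_has_sum: "((\<lambda>j. \<bar>delta i j\<bar>) has_sum 1) UNIV"
  by (rule has_sum_finite_neutralI[of "{i}"]) (auto simp: delta_def)

text \<open>The monoid need not be cancellative, so the set of solutions j may be empty or contain
  several elements.\<close>

lemma conv_delta:
  "conv (delta i) f k = (\<Sum>\<^sub>\<infinity>j\<in>{j. i + j = k}. f j)"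
  unfolding conv_def
  by (subst infsum_cong_neutral[where T = "{(i', j). i' = i \<and> i + j = k}" and g = "\<lambda>(i', j). f j"])
     (auto simp: delta_def split: if_splits intro!: infsum_reindex_bij_witness[of _ "\<lambda>j. (i, j)" snd])

lemma norm_conv_le:
  fixes f g :: "'i::comm_monoid_add \<Rightarrow> real"
  assumes f: "(\<lambda>i. \<bar>f i\<bar>) summable_on UNIV" and g: "(\<lambda>i. \<bar>g i\<bar>) summable_on UNIV"
  shows "(\<Sum>\<^sub>\<infinity>k. \<bar>conv f g k\<bar>) \<le> (\<Sum>\<^sub>\<infinity>i. \<bar>f i\<bar>) * (\<Sum>\<^sub>\<infinity>i. \<bar>g i\<bar>)"
proof -
  \<comment> \<open>Weighting by the signs of the convolution turns its sum of absolute values into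
    a plain weighted sum, to which the exchange of summation applies.\<close>
  define \<phi> where "\<phi> k = sgn (conv f g k)" for k
  have \<phi>: "norm (\<phi> k) \<le> 1" for k by (auto simp: \<phi>_def sgn_real_def)
  have "((\<lambda>k. \<bar>conv f g k\<bar>) has_sum (\<Sum>\<^sub>\<infinity>(i, j). \<phi> (i + j) * (f i * g j))) UNIV"
    using conv_has_sum_weighted(2)[OF f g, of \<phi> 1] \<phi> by (simp add: \<phi>_def abs_sgn mult.commute)
  hence "(\<Sum>\<^sub>\<infinity>k. \<bar>conv f g k\<bar>) = (\<Sum>\<^sub>\<infinity>(i, j). \<phi> (i + j) * (f i * g j))"
    by (rule infsumI)
  also have "\<dots> \<le> (\<Sum>\<^sub>\<infinity>(i, j). \<bar>f i\<bar> * \<bar>g j\<bar>)"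
  proof (rule infsum_mono)
    show "(\<lambda>(i, j). \<phi> (i + j) * (f i * g j)) summable_on UNIV"
      by (rule Infinite_Sum.abs_summable_summable)
        (use conv_has_sum_weighted(1)[OF f g \<phi>, of "\<lambda>x. x"] in \<open>simp add: case_prod_unfold\<close>)
    show "(\<lambda>(i, j). \<bar>f i\<bar> * \<bar>g j\<bar>) summable_on UNIV"
      using summable_on_times[OF f g] by simp
    show "(case x of (i, j) \<Rightarrow> \<phi> (i + j) * (f i * g j)) \<le> (case x of (i, j) \<Rightarrow> \<bar>f i\<bar> * \<bar>g j\<bar>)" for x
    proof (cases x)
      case (Pair i j)
      have "\<phi> (i + j) * (f i * g j) \<le> \<bar>\<phi> (i + j) * (f i * g j)\<bar>" by simp
      also have "\<dots> \<le> 1 * \<bar>f i * g j\<bar>"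
        unfolding abs_mult[of "\<phi> _"] using \<phi> by (intro mult_right_mono) auto
      finally show ?thesis using Pair by (simp add: abs_mult)
    qed
  qed
  also have "\<dots> = (\<Sum>\<^sub>\<infinity>i. \<bar>f i\<bar>) * (\<Sum>\<^sub>\<infinity>i. \<bar>g i\<bar>)"
    using infsumI[OF has_sum_times[where f = "\<lambda>i. \<bar>f i\<bar>" and g = "\<lambda>i. \<bar>g i\<bar>" and A = UNIV and B = UNIV]] f g by simp
  finally show ?thesis .
qed

instantiation l1 :: (comm_monoid_add) "{comm_ring_1, real_normed_algebra_1}"
begin

lift_definition times_l1 :: "'a l1 \<Rightarrow> 'a l1 \<Rightarrow> 'a l1" is conv
  by (simp add: conv_abs_summable)

lift_definition one_l1 :: "'a l1" is "delta 0"
  by (simp add: has_sum_imp_summable[OF delta_has_sum])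

instance
proof
  fix f g h :: "'a l1" and c :: real
  note s = coef_abs_summable
  show "f * g * h = f * (g * h)"
    by (intro l1_eqI) (simp add: times_l1.rep_eq conv_assoc s)
  show comm: "f * g = g * f" for f g :: "'a l1"
    by (intro l1_eqI) (simp add: times_l1.rep_eq conv_commute)
  show dist: "(f + g) * h = f * h + g * h" for f g h :: "'a l1"
  proof (rule l1_eqI)
    fix k
    have "coef ((f + g) * h) k =
        (\<Sum>\<^sub>\<infinity>x\<in>{(i, j). i + j = k}. (case x of (i, j) \<Rightarrow> coef f i * coef h j) + (case x of (i, j) \<Rightarrow> coef g i * coef h j))"
      by (simp add: times_l1.rep_eq conv_def case_prod_unfold distrib_right)
    also have "\<dots> = coef (f * h + g * h) k"
      unfolding coef_add times_l1.rep_eq conv_def by (intro infsum_add conv_fibre_summable s)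
    finally show "coef ((f + g) * h) k = coef (f * h + g * h) k" .
  qed
  show "f * (g + h) = f * g + f * h" for f g h :: "'a l1"
    unfolding comm[of f] by (rule dist)
  show one: "1 * f = f" for f :: "'a l1"
  proof (rule l1_eqI)
    fix i :: 'a
    have "{j. j = i} = {i}" by auto
    thus "coef (1 * f) i = coef f i" by (simp add: times_l1.rep_eq one_l1.rep_eq conv_delta)
  qed
  show "f * 1 = f"
    unfolding comm[of f] by (rule one)
  show "(0 :: 'a l1) \<noteq> 1"
    by (metis coef_zero delta_def one_l1.rep_eq zero_neq_one)
  show "c *\<^sub>R f * g = c *\<^sub>R (f * g)" for f g :: "'a l1"
    by (intro l1_eqI) (simp add: times_l1.rep_eq conv_def case_prod_unfold mult.assoc infsum_cmult_right')
  thus "f * c *\<^sub>R g = c *\<^sub>R (f * g)" by (metis comm)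
  show "norm (f * g) \<le> norm f * norm g"
    unfolding norm_l1_eq times_l1.rep_eq by (rule norm_conv_le) (rule s)+
  show "norm (1 :: 'a l1) = 1"
    unfolding norm_l1_eq one_l1.rep_eq using delta_has_sum by (rule infsumI)
qed

end

section \<open>Diagonal multipliers, index substitutions and monomials\<close>

definition lmul :: "('i \<Rightarrow> real) \<Rightarrow> 'i l1 \<Rightarrow> 'i l1" where
  "lmul t f = Abs_l1 (\<lambda>i. t i * coef f i)"

definition pull :: "('i \<Rightarrow> 'i) \<Rightarrow> 'i l1 \<Rightarrow> 'i l1" where
  "pull \<tau> f = Abs_l1 (\<lambda>i. coef f (\<tau> i))"

definition single :: "'i \<Rightarrow> 'i l1" where
  "single i = Abs_l1 (delta i)"

lemma coef_single [simp]: "coef (single i) j = delta i j"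
  unfolding single_def by (subst coef_Abs) (auto intro: has_sum_imp_summable[OF delta_has_sum])

lemma norm_single [simp]: "norm (single i) = 1"
  unfolding norm_l1_eq by (simp add: infsumI[OF delta_has_sum])

text \<open>\<open>Abs_l1\<close> is unspecified off the summable functions, so the bound on
  \<open>t\<close> is what gives \<open>lmul\<close> its meaning; injectivity plays the same part
  for \<open>pull\<close>.\<close>

lemma
  assumes t: "\<And>i. \<bar>t i\<bar> \<le> M"
  shows coef_lmul: "coef (lmul t f) i = t i * coef f i"
    and norm_lmul_le: "norm (lmul t f) \<le> M * norm f"
    and bounded_linear_lmul: "bounded_linear (lmul t)"
proof -
  have le: "\<bar>t i * coef f i\<bar> \<le> M * \<bar>coef f i\<bar>" for f :: "'a l1" and i
    unfolding abs_mult using t by (intro mult_right_mono) auto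
  have coef: "coef (lmul t f) i = t i * coef f i" for f i
    unfolding lmul_def
    by (subst coef_Abs)
       (auto intro!: summable_on_comparison_test[OF summable_on_cmult_right[OF coef_abs_summable] le])
  have norm: "norm (lmul t f) \<le> M * norm f" for f
    unfolding norm_l1_eq coef
    using coef_abs_summable[of "lmul t f"] coef_abs_summable[of f]
    by (subst infsum_cmult_right'[symmetric])
       (auto intro!: infsum_mono le summable_on_cmult_right simp: coef)
  show "coef (lmul t f) i = t i * coef f i" "norm (lmul t f) \<le> M * norm f"
    by (rule coef norm)+
  show "bounded_linear (lmul t)"
    by (rule bounded_linear_intro[where K = M])
       (auto intro!: l1_eqI simp: coef algebra_simps norm[simplified mult.commute])
qed

lemma
  assumes \<tau>: "inj \<tau>"
  shows coef_pull: "coef (pull \<tau> f) i = coef f (\<tau> i)"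
    and norm_pull_le: "norm (pull \<tau> f) \<le> norm f"
    and bounded_linear_pull: "bounded_linear (pull \<tau>)"
proof -
  have sub: "(\<lambda>i. \<bar>coef f i\<bar>) summable_on range \<tau>" for f :: "'a l1"
    by (rule summable_on_subset_banach[OF coef_abs_summable]) auto
  have s: "(\<lambda>i. \<bar>coef f (\<tau> i)\<bar>) summable_on UNIV" for f :: "'a l1"
    using summable_on_reindex[OF \<tau>, of "\<lambda>i. \<bar>coef f i\<bar>"] sub by (simp add: o_def)
  have coef: "coef (pull \<tau> f) i = coef f (\<tau> i)" for f i
    unfolding pull_def by (subst coef_Abs) (auto intro: s)
  have norm: "norm (pull \<tau> f) \<le> norm f" for f
  proof -
    have "norm (pull \<tau> f) = (\<Sum>\<^sub>\<infinity>i\<in>range \<tau>. \<bar>coef f i\<bar>)"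
      unfolding norm_l1_eq coef by (subst infsum_reindex[OF \<tau>]) (simp add: o_def)
    also have "\<dots> \<le> norm f"
      unfolding norm_l1_eq by (rule infsum_mono_neutral[OF sub coef_abs_summable]) auto
    finally show ?thesis .
  qed
  show "coef (pull \<tau> f) i = coef f (\<tau> i)" "norm (pull \<tau> f) \<le> norm f"
    by (rule coef norm)+
  show "bounded_linear (pull \<tau>)"
    by (rule bounded_linear_intro[where K = 1]) (auto intro!: l1_eqI simp: coef norm)
qed

lemma coef_times: "coef (f * g) k = conv (coef f) (coef g) k"
  by (simp add: times_l1.rep_eq)

lemma coef_one: "coef 1 k = delta 0 k"
  by (simp add: one_l1.rep_eq)

lemma pull_times:
  assumes \<tau>: "bij \<tau>" and add: "\<And>i j. \<tau> (i + j) = \<tau> i + \<tau> j"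
  shows "pull \<tau> (f * g) = pull \<tau> f * pull \<tau> g"
proof (rule l1_eqI)
  fix k
  have inj: "inj \<tau>" and inv: "\<And>i. \<tau> (inv \<tau> i) = i" "\<And>i. inv \<tau> (\<tau> i) = i"
    using \<tau> by (auto simp: bij_def inv_f_f surj_f_inv_f)
  show "coef (pull \<tau> (f * g)) k = coef (pull \<tau> f * pull \<tau> g) k"
    unfolding coef_times coef_pull[OF inj] conv_def
    by (rule infsum_reindex_bij_witness[of _ "\<lambda>(i, j). (\<tau> i, \<tau> j)" "\<lambda>(i, j). (inv \<tau> i, inv \<tau> j)"])
       (auto simp: inv add[symmetric], metis inv(2) inv(1) add)
qed

lemma pull_one:
  assumes \<tau>: "bij \<tau>" and "\<tau> 0 = 0"
  shows "pull \<tau> 1 = 1"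
proof (rule l1_eqI)
  fix i
  have "\<tau> i = 0 \<longleftrightarrow> i = 0" using assms(2) injD[OF bij_is_inj[OF \<tau>], of i 0] by auto
  thus "coef (pull \<tau> 1) i = coef 1 i"
    by (simp add: coef_pull[OF bij_is_inj[OF \<tau>]] coef_one delta_def)
qed

section \<open>Characters and evaluation\<close>

definition character :: "('i::comm_monoid_add \<Rightarrow> complex) \<Rightarrow> bool" where
  "character \<psi> \<longleftrightarrow> \<psi> 0 = 1 \<and> (\<forall>i j. \<psi> (i + j) = \<psi> i * \<psi> j) \<and> (\<forall>i. norm (\<psi> i) \<le> 1)"

text \<open>When the index set consists of exponents of monomials, the characters are the points of
  the closed unit polydisc and \<open>ev\<close> substitutes such a point into the series.\<close>

definition ev :: "('i \<Rightarrow> complex) \<Rightarrow> 'i l1 \<Rightarrow> complex" where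
  "ev \<psi> f = (\<Sum>\<^sub>\<infinity>i. \<psi> i * of_real (coef f i))"

lemma norm_ev_term:
  fixes \<psi> :: "'i \<Rightarrow> complex"
  assumes "\<And>i. norm (\<psi> i) \<le> 1"
  shows "norm (\<psi> i * complex_of_real c) \<le> \<bar>c\<bar>"
  using mult_right_mono[OF assms[of i], of "\<bar>c\<bar>"] by (simp add: norm_mult)

lemma ev_abs_summable:
  fixes \<psi> :: "'i \<Rightarrow> complex"
  assumes "\<And>i. norm (\<psi> i) \<le> 1"
  shows "(\<lambda>i. norm (\<psi> i * of_real (coef f i))) summable_on UNIV"
  by (rule summable_on_comparison_test[OF coef_abs_summable[of f]])
     (auto intro!: norm_ev_term[of \<psi>] assms)

lemma ev_has_sum:
  fixes \<psi> :: "'i \<Rightarrow> complex"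
  assumes "\<And>i. norm (\<psi> i) \<le> 1"
  shows "((\<lambda>i. \<psi> i * of_real (coef f i)) has_sum ev \<psi> f) UNIV"
  unfolding ev_def
  by (rule has_sum_infsum, rule Infinite_Sum.abs_summable_summable, rule ev_abs_summable) fact

lemma norm_ev_le:
  fixes \<psi> :: "'i \<Rightarrow> complex"
  assumes "\<And>i. norm (\<psi> i) \<le> 1"
  shows "norm (ev \<psi> f) \<le> norm f"
proof -
  have "norm (ev \<psi> f) \<le> (\<Sum>\<^sub>\<infinity>i. norm (\<psi> i * of_real (coef f i)))"
    unfolding ev_def by (rule norm_infsum_bound) (rule ev_abs_summable[OF assms])
  also have "\<dots> \<le> norm f"
    unfolding norm_l1_eq
    by (rule infsum_mono[OF ev_abs_summable[OF assms] coef_abs_summable])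
       (auto intro!: norm_ev_term[of \<psi>] assms)
  finally show ?thesis .
qed

lemma bounded_linear_ev:
  fixes \<psi> :: "'i \<Rightarrow> complex"
  assumes "\<And>i. norm (\<psi> i) \<le> 1"
  shows "bounded_linear (ev \<psi>)"
proof (rule bounded_linear_intro[where K = 1])
  note hs = ev_has_sum[of \<psi>, OF assms]
  show "ev \<psi> (f + g) = ev \<psi> f + ev \<psi> g" for f g
  proof (rule has_sum_unique[OF hs])
    show "((\<lambda>i. \<psi> i * of_real (coef (f + g) i)) has_sum (ev \<psi> f + ev \<psi> g)) UNIV"
      using has_sum_add[OF hs[of f] hs[of g]] by (simp add: distrib_left)
  qed
  show "ev \<psi> (c *\<^sub>R f) = c *\<^sub>R ev \<psi> f" for c f
  proof (rule has_sum_unique[OF hs])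
    have "(\<lambda>i. \<psi> i * of_real (coef (c *\<^sub>R f) i)) = (\<lambda>i. of_real c * (\<psi> i * of_real (coef f i)))"
      by (auto simp: fun_eq_iff)
    thus "((\<lambda>i. \<psi> i * of_real (coef (c *\<^sub>R f) i)) has_sum (c *\<^sub>R ev \<psi> f)) UNIV"
      using has_sum_cmult_right[OF hs[of f], of "of_real c"] by (simp add: scaleR_conv_of_real)
  qed
  show "norm (ev \<psi> f) \<le> norm f * 1" for f
    using norm_ev_le[OF assms] by simp
qed

lemma ev_times:
  assumes \<psi>: "character \<psi>"
  shows "ev \<psi> (f * g) = ev \<psi> f * ev \<psi> g"
proof -
  have b: "norm (\<psi> i) \<le> 1" for i using \<psi> by (auto simp: character_def)
  have "ev \<psi> (f * g) = (\<Sum>\<^sub>\<infinity>(i, j). \<psi> (i + j) * of_real (coef f i * coef g j))"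
    unfolding ev_def coef_times
    by (rule infsumI, rule conv_has_sum_weighted(2)[OF coef_abs_summable coef_abs_summable b])
  also have "\<dots> = (\<Sum>\<^sub>\<infinity>(i, j)\<in>UNIV \<times> UNIV. (\<psi> i * of_real (coef f i)) * (\<psi> j * of_real (coef g j)))"
    unfolding UNIV_Times_UNIV using \<psi> by (intro infsum_cong) (auto simp: character_def)
  also have "\<dots> = ev \<psi> f * ev \<psi> g"
    by (rule infsumI, rule has_sum_times) (rule ev_has_sum ev_abs_summable b)+
  finally show ?thesis .
qed

lemma ev_single: "ev \<psi> (single i) = \<psi> i"
  unfolding ev_def by (rule infsumI, rule has_sum_finite_neutralI[of "{i}"]) (auto simp: delta_def)

lemma ev_one:
  assumes \<psi>: "character \<psi>"
  shows "ev \<psi> 1 = 1"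
proof -
  have "1 = single (0 :: 'a)" by (rule l1_eqI) (simp add: coef_one)
  hence "ev \<psi> 1 = \<psi> 0" using ev_single[of \<psi> 0] by simp
  thus ?thesis using \<psi> by (simp add: character_def)
qed

subsection \<open>Power series in a Banach algebra\<close>

definition psum :: "(nat \<Rightarrow> real) \<Rightarrow> 'a::{real_normed_algebra_1,banach} \<Rightarrow> 'a" where
  "psum c x = (\<Sum>k. c k *\<^sub>R x ^ k)"

lemma psum_summable:
  fixes x :: "'a::{real_normed_algebra_1,banach}"
  assumes c: "summable (\<lambda>k. \<bar>c k\<bar> * r ^ k)" and x: "norm x \<le> r"
  shows "summable (\<lambda>k. norm (c k *\<^sub>R x ^ k))"
proof (rule summable_comparison_test'[OF c])
  show "norm (norm (c k *\<^sub>R x ^ k)) \<le> \<bar>c k\<bar> * r ^ k" for k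
    using order_trans[OF norm_power_ineq[of x k] power_mono[OF x norm_ge_zero]]
    by (auto intro: mult_left_mono)
qed

text \<open>A bounded unital homomorphism passes through each power and through the limit. It is
  applied to the swap of x and y, to evaluation at characters, and to the embedding of the reals
  into the complex numbers.\<close>

lemma psum_hom:
  fixes F :: "'a::{real_normed_algebra_1,banach} \<Rightarrow> 'b::{real_normed_algebra_1,banach}"
  assumes F: "bounded_linear F" "\<And>x y. F (x * y) = F x * F y" "F 1 = 1"
    and c: "summable (\<lambda>k. \<bar>c k\<bar> * r ^ k)" and x: "norm x \<le> r"
  shows "F (psum c x) = psum c (F x)"
proof -
  have pow: "F (x ^ k) = F x ^ k" for k by (induction k) (auto simp: F)
  have "F (psum c x) = (\<Sum>k. F (c k *\<^sub>R x ^ k))"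
    unfolding psum_def
    by (rule bounded_linear.suminf[OF F(1)]) (rule summable_norm_cancel[OF psum_summable[OF c x]])
  also have "\<dots> = psum c (F x)"
    by (simp add: psum_def pow linear_scale bounded_linear.linear[OF F(1)])
  finally show ?thesis .
qed

lemma norm_power_diff_le:
  fixes x y :: "'a::real_normed_algebra_1"
  assumes x: "norm x \<le> r" and y: "norm y \<le> r"
  shows "norm (x ^ k - y ^ k) \<le> real k * r ^ (k - 1) * norm (x - y)"
proof (induction k)
  case (Suc k)
  have r: "0 \<le> r" using order_trans[OF norm_ge_zero x] .
  have "norm (x ^ Suc k - y ^ Suc k) = norm (x * (x ^ k - y ^ k) + (x - y) * y ^ k)"
    by (simp add: algebra_simps)
  also have "\<dots> \<le> norm x * norm (x ^ k - y ^ k) + norm (x - y) * norm y ^ k"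
    by (intro norm_triangle_le add_mono order_trans[OF norm_mult_ineq] mult_left_mono norm_power_ineq) auto
  also have "\<dots> \<le> r * (real k * r ^ (k - 1) * norm (x - y)) + norm (x - y) * r ^ k"
    using r by (intro add_mono mult_mono Suc x mult_left_mono power_mono y) auto
  also have "\<dots> = real (Suc k) * r ^ (Suc k - 1) * norm (x - y)"
    by (cases k) (auto simp: algebra_simps)
  finally show ?case .
qed simp

text \<open>Since the series starts at order two, the factor r^(k-1) from the difference of k-th
  powers contains one free r; the remaining k - 2 factors are at most (1/2)^(k-2) = 4 (1/2)^k, which
  is where the 4 comes from.\<close>

lemma psum_quadratic_lipschitz:
  fixes x y :: "'a::{real_normed_algebra_1,banach}"
  assumes c: "summable (\<lambda>k. \<bar>c k\<bar> * (real k * (1/2) ^ k))" and c01: "c 0 = 0" "c 1 = 0"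
    and x: "norm x \<le> r" and y: "norm y \<le> r" and r: "r \<le> 1/2"
  shows "norm (psum c x - psum c y) \<le> 4 * (\<Sum>k. \<bar>c k\<bar> * (real k * (1/2) ^ k)) * r * norm (x - y)"
proof -
  have r0: "0 \<le> r" using order_trans[OF norm_ge_zero x] .
  have c': "summable (\<lambda>k. \<bar>c k\<bar> * (1/2) ^ k)"
  proof (rule summable_comparison_test'[OF c, of 0])
    show "norm (\<bar>c n\<bar> * (1/2) ^ n) \<le> \<bar>c n\<bar> * (real n * (1/2) ^ n)" for n
      using c01 by (cases n) (auto intro!: mult_left_mono)
  qed
  have "psum c x - psum c y = (\<Sum>k. c k *\<^sub>R x ^ k - c k *\<^sub>R y ^ k)"
    unfolding psum_def
    by (rule suminf_diff; rule summable_norm_cancel[OF psum_summable[OF c']])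
       (use x y r in auto)
  also have "norm \<dots> \<le> (\<Sum>k. \<bar>c k\<bar> * (real k * (1/2) ^ k) * (4 * r * norm (x - y)))"
  proof (rule norm_suminf_le)
    fix k
    show "norm (c k *\<^sub>R x ^ k - c k *\<^sub>R y ^ k) \<le> \<bar>c k\<bar> * (real k * (1/2) ^ k) * (4 * r * norm (x - y))"
    proof (cases "k < 2")
      case True
      hence "c k = 0" using c01 less_2_cases by auto
      thus ?thesis by simp
    next
      case False
      then obtain l where k: "k = Suc (Suc l)"
        by (metis One_nat_def Suc_1 less_Suc_eq_0_disj not0_implies_Suc not_less_iff_gr_or_eq)
      have "norm (x ^ k - y ^ k) \<le> real k * r ^ (k - 1) * norm (x - y)"
        by (rule norm_power_diff_le[OF x y])
      also have "r ^ (k - 1) \<le> r * (1/2) ^ l"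
        unfolding k using r r0 by (auto intro!: mult_left_mono power_mono)
      also have "r * (1/2) ^ l = (1/2) ^ k * (4 * r)" by (simp add: k)
      finally have "norm (x ^ k - y ^ k) \<le> real k * ((1/2) ^ k * (4 * r)) * norm (x - y)"
        by (simp add: mult_left_mono mult_right_mono)
      hence "\<bar>c k\<bar> * norm (x ^ k - y ^ k) \<le> \<bar>c k\<bar> * (real k * ((1/2) ^ k * (4 * r)) * norm (x - y))"
        by (intro mult_left_mono) auto
      thus ?thesis by (simp add: scaleR_diff_right[symmetric] mult_ac)
    qed
  qed (rule summable_mult2[OF c])
  also have "\<dots> = (\<Sum>k. \<bar>c k\<bar> * (real k * (1/2) ^ k)) * (4 * r * norm (x - y))"
    by (rule suminf_mult2[OF c, symmetric])
  finally show ?thesis by (simp add: mult_ac)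
qed

section \<open>The binomial series and its remainder of order two\<close>

lemma gbinomial_summable:
  fixes a :: real
  shows "summable (\<lambda>k. \<bar>a gchoose k\<bar> * (1/2) ^ k)"
    and "summable (\<lambda>k. \<bar>a gchoose k\<bar> * (real k * (1/2) ^ k))"
proof -
  have abs: "summable (\<lambda>k. \<bar>a gchoose k\<bar> * z ^ k)" if "norm z < 1" for z :: real
  proof -
    \<comment> \<open>Convergence at a point strictly between |z| and 1 forces absolute convergence
      at z.\<close>
    have "summable (\<lambda>k. (a gchoose k) * ((1 + norm z) / 2) ^ k)"
      using gen_binomial_real[of "(1 + norm z) / 2" a] that by (auto simp: sums_iff)
    from powser_insidea[OF this, of "norm z"] that
    have "summable (\<lambda>k. norm (\<bar>a gchoose k\<bar> * z ^ k))"
      by (simp add: abs_mult power_abs)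
    thus ?thesis by (rule summable_norm_cancel)
  qed
  show "summable (\<lambda>k. \<bar>a gchoose k\<bar> * (1/2) ^ k)" by (rule abs) simp
  have "summable (\<lambda>k. diffs (\<lambda>k. \<bar>a gchoose k\<bar>) k * (1/2) ^ k)"
    by (rule termdiff_converges[where K = 1]) (auto intro: abs)
  hence "summable (\<lambda>k. (diffs (\<lambda>k. \<bar>a gchoose k\<bar>) k * (1/2) ^ k) * (1/2))"
    by (rule summable_mult2)
  hence "summable (\<lambda>k. \<bar>a gchoose Suc k\<bar> * (real (Suc k) * (1/2) ^ Suc k))"
    by (simp add: diffs_def mult_ac)
  thus "summable (\<lambda>k. \<bar>a gchoose k\<bar> * (real k * (1/2) ^ k))"
    by (subst summable_Suc_iff[symmetric])
qed

lemma psum_gbinomial: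
  fixes r :: real
  assumes "\<bar>r\<bar> < 1"
  shows "psum (\<lambda>k. a gchoose k) r = (1 + r) powr a"
  unfolding psum_def using gen_binomial_real[OF assms, of a] by (simp add: sums_iff)

definition rest_coeff :: "real \<Rightarrow> nat \<Rightarrow> real" where
  "rest_coeff s k = (if k < 2 then 0 else s gchoose k)"

lemma psum_rest_coeff:
  fixes r :: real
  assumes "\<bar>r\<bar> < 1"
  shows "psum (rest_coeff s) r = (1 + r) powr s - 1 - s * r"
proof -
  have "(\<lambda>k. (s gchoose k) * r ^ k) sums (1 + r) powr s"
    by (rule gen_binomial_real[OF assms])
  hence "(\<lambda>k. (s gchoose (k + 2)) * r ^ (k + 2)) sums ((1 + r) powr s - (\<Sum>k<2. (s gchoose k) * r ^ k))"
    by (subst sums_iff_shift)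
       (simp add: )
  hence "(\<lambda>k. rest_coeff s (k + 2) * r ^ (k + 2)) sums ((1 + r) powr s - 1 - s * r)"
    by (simp add: rest_coeff_def numeral_2_eq_2 algebra_simps)
  hence "(\<lambda>k. rest_coeff s k * r ^ k) sums ((1 + r) powr s - 1 - s * r + (\<Sum>k<2. rest_coeff s k * r ^ k))"
    by (subst (asm) sums_iff_shift) simp
  thus ?thesis by (simp add: psum_def sums_iff rest_coeff_def)
qed

lemma rest_coeff_summable:
  shows "summable (\<lambda>k. \<bar>rest_coeff s k\<bar> * (1/2) ^ k)"
    and "summable (\<lambda>k. \<bar>rest_coeff s k\<bar> * (real k * (1/2) ^ k))"
  by (rule summable_comparison_test'[OF gbinomial_summable(1)[of s], of 0];
      simp add: rest_coeff_def)
     (rule summable_comparison_test'[OF gbinomial_summable(2)[of s], of 0];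
      simp add: rest_coeff_def)

subsection \<open>The fixed point problem\<close>

text \<open>An index \<open>(n, m, j)\<close> stands for the monomial \<open>x^n y^m t^j\<close> with
  \<open>x = a e^(iz) / \<rho>\<close>, \<open>y = a e^(-iz) / \<rho>\<close>, \<open>t = b / \<rho>\<close>, so that \<open>\<Lambda>^\<alpha>\<close> multiplies
  its coefficient by \<open>\<bar>n - m\<bar>^\<alpha>\<close> and the swap of \<open>n\<close> and \<open>m\<close> is complex conjugation.\<close>

type_synonym idx = "nat \<times> nat \<times> nat"

definition mode :: "idx \<Rightarrow> int" where
  "mode i = int (fst i) - int (fst (snd i))"

definition swap3 :: "idx \<Rightarrow> idx" where
  "swap3 i = (fst (snd i), fst i, snd (snd i))"

text \<open>Multiplication by x on exponents; pulling a series back along it discards the monomials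
  free of x and divides the others by x.\<close>

definition shift3 :: "idx \<Rightarrow> idx" where
  "shift3 i = (Suc (fst i), snd i)"

lemma mode_simps [simp]: "mode (n, m, j) = int n - int m" "mode (i + i') = mode i + mode i'"
  by (auto simp: mode_def)

lemma swap3_simps [simp]: "swap3 (n, m, j) = (m, n, j)" "swap3 (swap3 i) = i"
  "swap3 (i + i') = swap3 i + swap3 i'" "swap3 0 = 0" "mode (swap3 i) = - mode i"
  by (auto simp: swap3_def mode_def prod_eq_iff)

lemma bij_swap3: "bij swap3"
  by (rule involuntory_imp_bij) simp

lemma inj_shift3: "inj shift3"
  by (rule injI) (auto simp: shift3_def prod_eq_iff)

lemma delta_swap3: "delta i (swap3 j) = delta (swap3 i) j"
  by (auto simp: delta_def)

section \<open>Inversion of the linear part\<close>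

locale wave =
  fixes \<alpha> p :: real
  assumes \<alpha>: "\<alpha> > 0" and p: "p \<ge> 1"
begin

text \<open>\<open>inv_mult\<close> inverts \<open>p (1 - \<Lambda>^\<alpha>)\<close> off its kernel, the modes \<open>1\<close> and \<open>-1\<close>.\<close>

definition inv_mult :: "idx \<Rightarrow> real" where
  "inv_mult i = (if \<bar>mode i\<bar> = 1 then 0 else 1 / (p * (1 - \<bar>real_of_int (mode i)\<bar> powr \<alpha>)))"

definition lap_mult :: "idx \<Rightarrow> real" where
  "lap_mult i = \<bar>real_of_int (mode i)\<bar> powr \<alpha> * inv_mult i"

text \<open>The value of y / (y - 1) at y = 2^\<alpha>, the worst case among the frequencies of
  modulus at least two. It also dominates 1 / (y - 1) there and the value 1 / p at frequency
  zero.\<close>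

definition gap :: real where
  "gap = 1 + 1 / (2 powr \<alpha> - 1)"

lemma gap_ge_1: "gap \<ge> 1"
proof -
  have "2 powr \<alpha> > 1" using \<alpha> by simp
  thus ?thesis by (simp add: gap_def)
qed

lemma mode_powr_ge:
  assumes "mode i \<noteq> 0" "\<bar>mode i\<bar> \<noteq> 1"
  shows "\<bar>real_of_int (mode i)\<bar> powr \<alpha> \<ge> 2 powr \<alpha>" "2 powr \<alpha> > 1"
proof -
  have "\<bar>mode i\<bar> \<ge> 2" using assms by linarith
  hence "\<bar>real_of_int (mode i)\<bar> \<ge> 2" by linarith
  thus "\<bar>real_of_int (mode i)\<bar> powr \<alpha> \<ge> 2 powr \<alpha>"
    using \<alpha> by (intro powr_mono2) auto
  show "2 powr \<alpha> > 1" using \<alpha> by simp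
qed

lemma inv_mult_le: "\<bar>inv_mult i\<bar> \<le> gap"
  and lap_mult_le: "\<bar>lap_mult i\<bar> \<le> gap"
proof -
  have "\<bar>inv_mult i\<bar> \<le> gap \<and> \<bar>lap_mult i\<bar> \<le> gap"
  proof (cases "mode i = 0 \<or> \<bar>mode i\<bar> = 1")
    case True
    have "1 / p \<le> 1" using p by simp
    also note gap_ge_1
    finally show ?thesis using True p gap_ge_1 by (auto simp: inv_mult_def lap_mult_def)
  next
    case False
    define y where "y = \<bar>real_of_int (mode i)\<bar> powr \<alpha>"
    have y: "y \<ge> 2 powr \<alpha>" "2 powr \<alpha> > 1" using mode_powr_ge[of i] False by (auto simp: y_def)
    have inv: "\<bar>inv_mult i\<bar> = 1 / (p * (y - 1))"
      using False p y by (simp add: inv_mult_def y_def[symmetric] abs_mult)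
    have py: "p * (y - 1) \<ge> y - 1" using p y by (simp add: mult_le_cancel_right1)
    have "1 / (p * (y - 1)) \<le> 1 / (2 powr \<alpha> - 1)"
      using p y order_trans[OF _ py, of "2 powr \<alpha> - 1"] by (intro divide_left_mono mult_pos_pos) auto
    moreover have "y * (1 / (p * (y - 1))) \<le> gap"
    proof -
      have "y * (1 / (p * (y - 1))) \<le> y * (1 / (y - 1))"
        using p y py by (intro mult_left_mono divide_left_mono mult_pos_pos) auto
      also have "\<dots> = 1 + 1 / (y - 1)" using y by (simp add: field_simps)
      also have "\<dots> \<le> gap"
        unfolding gap_def using y by (intro add_left_mono divide_left_mono) auto
      finally show ?thesis .
    qed
    moreover have "\<bar>lap_mult i\<bar> = y * (1 / (p * (y - 1)))"
      using y by (simp add: lap_mult_def abs_mult inv y_def[symmetric])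
    ultimately show ?thesis unfolding inv by (simp add: gap_def)
  qed
  thus "\<bar>inv_mult i\<bar> \<le> gap" "\<bar>lap_mult i\<bar> \<le> gap" by auto
qed

lemma inv_mult_eq:
  assumes "\<bar>mode i\<bar> \<noteq> 1"
  shows "p * (inv_mult i - lap_mult i) = 1"
proof (cases "mode i = 0")
  case True
  thus ?thesis using p by (simp add: inv_mult_def lap_mult_def)
next
  case False
  have "\<bar>real_of_int (mode i)\<bar> powr \<alpha> > 1"
    using mode_powr_ge[OF False assms] by linarith
  hence "p * (1 - \<bar>real_of_int (mode i)\<bar> powr \<alpha>) \<noteq> 0" using p by simp
  moreover have "p * (inv_mult i - lap_mult i) = (p * (1 - \<bar>real_of_int (mode i)\<bar> powr \<alpha>)) * inv_mult i"
    by (simp add: lap_mult_def algebra_simps)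
  ultimately show ?thesis using assms by (simp add: inv_mult_def)
qed

lemmas coef_inv = coef_lmul[of inv_mult, OF inv_mult_le]
lemmas coef_lap = coef_lmul[of lap_mult, OF lap_mult_le]
lemmas bounded_linear_inv = bounded_linear_lmul[of inv_mult, OF inv_mult_le]
lemmas bounded_linear_lap = bounded_linear_lmul[of lap_mult, OF lap_mult_le]
lemmas norm_inv_le = norm_lmul_le[of inv_mult, OF inv_mult_le]
lemmas norm_lap_le = norm_lmul_le[of lap_mult, OF lap_mult_le]

definition cos1 :: "idx l1" where
  "cos1 = (1/2) *\<^sub>R (single (1, 0, 0) + single (0, 1, 0))"

definition bvar :: "idx l1" where "bvar = single (0, 0, 1)"

text \<open>The perturbation f is \<rho> times \<open>prof h\<close>, and \<open>lap h\<close> is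
  \<Lambda>^\<alpha> applied to \<open>prof h\<close>: frequencies 1 and -1 are fixed by
  \<Lambda>^\<alpha>, so \<open>cos1\<close> enters both unchanged.\<close>

definition prof :: "idx l1 \<Rightarrow> idx l1" where "prof h = cos1 + lmul inv_mult h"
definition lap :: "idx l1 \<Rightarrow> idx l1" where "lap h = cos1 + lmul lap_mult h"

text \<open>This is N(\<rho> x) / \<rho>^2, whose bounds are uniform in small \<rho> because N is of
  order two. The polymorphic type lets homomorphisms carry one formula from series to complex and to
  real numbers.\<close>

definition nonl :: "real \<Rightarrow> 'a \<Rightarrow> 'a::{real_normed_algebra_1,banach}" where
  "nonl \<rho> x = (1 / \<rho>\<^sup>2) *\<^sub>R psum (rest_coeff (p + 1)) (\<rho> *\<^sub>R x)"

text \<open>Division by \<open>x\<close> of the frequency-one part: the solvability condition at frequency one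
  forces \<open>k^\<alpha> - p\<close> to be \<open>\<rho>\<close> times twice this part of the nonlinearity.\<close>

definition diag :: "idx l1 \<Rightarrow> idx l1" where
  "diag g = lmul (\<lambda>i. if mode i = 0 then 1 else 0) (pull shift3 g)"

definition disp :: "real \<Rightarrow> idx l1 \<Rightarrow> idx l1" where "disp \<rho> h = 2 *\<^sub>R diag (nonl \<rho> (prof h))"

text \<open>Insert f = \<rho> \<open>prof h\<close> and \<mu> = \<rho> \<open>disp \<rho> h\<close>
  into the equation and divide by \<rho>: the term b becomes the variable t, while \<mu>
  \<Lambda>^\<alpha> f and N(f) are both of size \<rho>^2 and keep one factor \<rho>.\<close>

definition step :: "real \<Rightarrow> idx l1 \<Rightarrow> idx l1" where
  "step \<rho> h = bvar + \<rho> *\<^sub>R (disp \<rho> h * lap h - nonl \<rho> (prof h))"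

lemma coef_diag: "coef (diag g) i = (if mode i = 0 then coef g (shift3 i) else 0)"
  unfolding diag_def by (subst coef_lmul[where M = 1]) (auto simp: coef_pull[OF inj_shift3])

lemma norm_diag_le: "norm (diag g) \<le> norm g"
  unfolding diag_def
  by (rule order_trans[OF norm_lmul_le[where M = 1]]) (auto simp: norm_pull_le[OF inj_shift3])

lemma diag_diff: "diag (f - g) = diag f - diag g"
  by (rule l1_eqI) (simp add: coef_diag)

lemma coef_cos1: "coef cos1 i = (delta (1, 0, 0) i + delta (0, 1, 0) i) / 2"
  by (simp add: cos1_def)

lemma norm_cos1_le: "norm cos1 \<le> 1"
  unfolding cos1_def using norm_triangle_ineq[of "single (1, 0, 0) :: idx l1" "single (0, 1, 0)"] by simp

section \<open>Estimates and the contraction\<close>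

definition lipc :: real where
  "lipc = 4 * (\<Sum>k. \<bar>rest_coeff (p + 1) k\<bar> * (real k * (1/2) ^ k))"

lemma lipc_nonneg: "lipc \<ge> 0"
  unfolding lipc_def by (auto intro!: suminf_nonneg rest_coeff_summable)

text \<open>The division by \<rho>^2 is used up exactly: one \<rho> comes from the radius \<rho> R
  in the quadratic estimate and one from the scaled difference.\<close>

lemma nonl_lipschitz:
  fixes x y :: "'a::{real_normed_algebra_1,banach}"
  assumes x: "norm x \<le> R" and y: "norm y \<le> R" and \<rho>: "\<rho> > 0" "\<rho> * R \<le> 1/2"
  shows "norm (nonl \<rho> x - nonl \<rho> y) \<le> lipc * R * norm (x - y)"
proof -
  have "norm (psum (rest_coeff (p + 1)) (\<rho> *\<^sub>R x) - psum (rest_coeff (p + 1)) (\<rho> *\<^sub>R y))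
      \<le> lipc * (\<rho> * R) * norm (\<rho> *\<^sub>R x - \<rho> *\<^sub>R y)"
    unfolding lipc_def
    by (rule psum_quadratic_lipschitz[OF rest_coeff_summable(2)]) (use assms in \<open>auto simp: rest_coeff_def\<close>)
  also have "\<dots> = \<rho>\<^sup>2 * (lipc * R * norm (x - y))"
    using \<rho> by (simp add: scaleR_diff_right[symmetric] power2_eq_square)
  finally show ?thesis
    using \<rho> unfolding nonl_def scaleR_diff_right[symmetric] norm_scaleR
    by (simp add: divide_le_eq mult.commute[of _ "\<rho>\<^sup>2"])
qed

lemma nonl_zero: "nonl \<rho> 0 = 0"
proof -
  have "(\<lambda>k. rest_coeff (p + 1) k *\<^sub>R (0 :: 'a) ^ k) = (\<lambda>_. 0)"
    by (auto simp: rest_coeff_def fun_eq_iff power_0_left)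
  thus ?thesis by (simp add: nonl_def psum_def)
qed

lemma nonl_hom:
  fixes F :: "'a::{real_normed_algebra_1,banach} \<Rightarrow> 'b::{real_normed_algebra_1,banach}"
  assumes F: "bounded_linear F" "\<And>x y. F (x * y) = F x * F y" "F 1 = 1"
    and x: "\<rho> > 0" "\<rho> * norm x \<le> 1/2"
  shows "F (nonl \<rho> x) = nonl \<rho> (F x)"
proof -
  have "F (psum (rest_coeff (p + 1)) (\<rho> *\<^sub>R x)) = psum (rest_coeff (p + 1)) (F (\<rho> *\<^sub>R x))"
    by (rule psum_hom[OF F rest_coeff_summable(1)]) (use x in auto)
  thus ?thesis
    by (simp add: nonl_def linear_scale[OF bounded_linear.linear[OF F(1)]])
qed

lemma pull_swap_prof: "pull swap3 h = h \<Longrightarrow> pull swap3 (prof h) = prof h"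
  and pull_swap_lap: "pull swap3 h = h \<Longrightarrow> pull swap3 (lap h) = lap h"
proof -
  assume h: "pull swap3 h = h"
  have h': "coef h (swap3 i) = coef h i" for i
    using arg_cong[OF h, of "\<lambda>h. coef h i"] by (simp add: coef_pull[OF bij_is_inj[OF bij_swap3]])
  have e: "coef cos1 (swap3 i) = coef cos1 i" for i
    by (simp add: coef_cos1 delta_swap3)
  show "pull swap3 (prof h) = prof h" "pull swap3 (lap h) = lap h"
    by (intro l1_eqI;
        simp add: coef_pull[OF bij_is_inj[OF bij_swap3]] prof_def lap_def coef_inv coef_lap e h'
          inv_mult_def lap_mult_def)+
qed

lemma pull_swap_nonl:
  assumes "pull swap3 g = g" "\<rho> > 0" "\<rho> * norm g \<le> 1/2"
  shows "pull swap3 (nonl \<rho> g) = nonl \<rho> g"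
  using nonl_hom[OF bounded_linear_pull[OF bij_is_inj[OF bij_swap3]] pull_times[OF bij_swap3]
      pull_one[OF bij_swap3] assms(2,3)] assms(1) by simp

lemma pull_swap_diag: "pull swap3 (diag g) = diag g"
proof (rule l1_eqI)
  fix i :: idx
  have "mode i = 0 \<Longrightarrow> swap3 i = i"
    by (auto simp: mode_def swap3_def prod_eq_iff)
  thus "coef (pull swap3 (diag g)) i = coef (diag g) i"
    by (auto simp: coef_pull[OF bij_is_inj[OF bij_swap3]] coef_diag)
qed

text \<open>Bound for \<open>prof h\<close> and \<open>lap h\<close> on the ball of radius 2: 1 for
  \<open>cos1\<close> and twice the multiplier bound. Radius 2 leaves room around
  \<open>bvar\<close>, which has norm 1.\<close>

definition rad :: real where "rad = 1 + 2 * gap"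

lemma norm_prof_le: "norm h \<le> 2 \<Longrightarrow> norm (prof h) \<le> rad"
  and norm_lap_le': "norm h \<le> 2 \<Longrightarrow> norm (lap h) \<le> rad"
proof -
  assume h: "norm h \<le> 2"
  have "gap * norm h \<le> gap * 2" using h gap_ge_1 by (intro mult_left_mono) auto
  thus "norm (prof h) \<le> rad" "norm (lap h) \<le> rad"
    unfolding prof_def lap_def rad_def
    using norm_triangle_ineq[of cos1 "lmul inv_mult h"] norm_triangle_ineq[of cos1 "lmul lap_mult h"]
      norm_cos1_le norm_inv_le[of h] norm_lap_le[of h] by linarith+
qed

lemma norm_prof_diff_le: "norm (prof h - prof h') \<le> gap * norm (h - h')"
  and norm_lap_diff_le: "norm (lap h - lap h') \<le> gap * norm (h - h')"
  using norm_inv_le[of "h - h'"] norm_lap_le[of "h - h'"]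
  by (simp_all add: prof_def lap_def linear_diff[OF bounded_linear.linear[OF bounded_linear_inv]]
      linear_diff[OF bounded_linear.linear[OF bounded_linear_lap]])

text \<open>A single constant whose summands bound, in this order, \<open>prof\<close>, the product
  of \<open>disp\<close> and \<open>lap\<close>, \<open>nonl\<close>, the Lipschitz constants of
  that product and of \<open>nonl\<close>, and \<open>disp\<close>. One smallness condition on
  \<rho> then covers them all.\<close>

definition stepc :: real where
  "stepc = rad + 2 * lipc * rad ^ 3 + lipc * rad\<^sup>2 + 4 * lipc * rad\<^sup>2 * gap + lipc * rad * gap + 2 * lipc * rad\<^sup>2"

text \<open>Banach's theorem is applied on the swap-invariant part of a ball, which is closed and
  preserved by \<open>step\<close>, so the fixed point inherits the symmetry. The two further bounds
  keep the binomial series convergent and the profile near 1.\<close>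

lemma exists_fixed_point:
  assumes \<rho>: "\<rho> > 0" "\<rho> * stepc \<le> 1/2"
  shows "\<exists>h. norm h \<le> 2 \<and> pull swap3 h = h \<and> step \<rho> h = h"
    and "norm h \<le> 2 \<Longrightarrow> \<rho> * norm (prof h) \<le> \<rho> * stepc"
    and "norm h \<le> 2 \<Longrightarrow> \<rho> * norm (disp \<rho> h) \<le> \<rho> * stepc"
proof -
  have rad: "rad \<ge> 1" "gap \<ge> 1" "lipc \<ge> 0" using gap_ge_1 lipc_nonneg by (auto simp: rad_def)
  hence nn: "lipc * rad ^ 3 \<ge> 0" "lipc * rad\<^sup>2 \<ge> 0" "lipc * rad\<^sup>2 * gap \<ge> 0" "lipc * rad * gap \<ge> 0"
    by auto
  have "rad \<le> stepc" using nn rad unfolding stepc_def by linarith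
  hence "\<rho> * rad \<le> \<rho> * stepc" using \<rho> by (intro mult_left_mono) auto
  hence \<rho>R: "\<rho> * rad \<le> 1/2" using \<rho> by linarith
  note P = norm_prof_le and L = norm_lap_le'
  have N: "norm (nonl \<rho> (prof h)) \<le> lipc * rad\<^sup>2" if h: "norm h \<le> 2" for h
  proof -
    have "norm (nonl \<rho> (prof h) - nonl \<rho> 0) \<le> lipc * rad * norm (prof h - 0)"
      by (rule nonl_lipschitz) (use P[OF h] rad \<rho>(1) \<rho>R in auto)
    also have "\<dots> \<le> lipc * rad * rad" using P[OF h] rad by (intro mult_left_mono) auto
    finally show ?thesis by (simp add: nonl_zero power2_eq_square)
  qed
  have ND: "norm (nonl \<rho> (prof h) - nonl \<rho> (prof h')) \<le> lipc * rad * gap * norm (h - h')"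
    if h: "norm h \<le> 2" "norm h' \<le> 2" for h h'
  proof -
    have "norm (nonl \<rho> (prof h) - nonl \<rho> (prof h')) \<le> lipc * rad * norm (prof h - prof h')"
      by (rule nonl_lipschitz) (use P[OF h(1)] P[OF h(2)] \<rho>(1) \<rho>R in auto)
    also have "\<dots> \<le> lipc * rad * (gap * norm (h - h'))"
      using rad by (intro mult_left_mono norm_prof_diff_le) auto
    finally show ?thesis by (simp add: mult_ac)
  qed
  have M: "norm (disp \<rho> h) \<le> 2 * lipc * rad\<^sup>2" if "norm h \<le> 2" for h
    using N[OF that] norm_diag_le[of "nonl \<rho> (prof h)"] by (simp add: disp_def)
  have MD: "norm (disp \<rho> h - disp \<rho> h') \<le> 2 * lipc * rad * gap * norm (h - h')"
    if "norm h \<le> 2" "norm h' \<le> 2" for h h'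
    using ND[OF that] norm_diag_le[of "nonl \<rho> (prof h) - nonl \<rho> (prof h')"]
    by (simp add: disp_def scaleR_diff_right[symmetric] diag_diff[symmetric])
  show "\<rho> * norm (prof h) \<le> \<rho> * stepc" if "norm h \<le> 2" for h
    using P[OF that] \<open>rad \<le> stepc\<close> \<rho> by (intro mult_left_mono) auto
  show "\<rho> * norm (disp \<rho> h) \<le> \<rho> * stepc" if "norm h \<le> 2" for h
    using M[OF that] nn rad \<rho> unfolding stepc_def by (intro mult_left_mono) linarith+
  define S where "S = {h :: idx l1. norm h \<le> 2 \<and> pull swap3 h = h}"
  have "closed S"
    unfolding S_def
    by (intro closed_Collect_conj closed_Collect_le closed_Collect_eq continuous_intros
        linear_continuous_on bounded_linear_pull bij_is_inj bij_swap3)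
  hence "complete S" by (rule complete_closed_subset[OF _ _ complete_UNIV]) auto
  moreover have "S \<noteq> {}"
    using linear_0[OF bounded_linear.linear[OF bounded_linear_pull[OF bij_is_inj[OF bij_swap3]]]]
    unfolding S_def by (auto intro!: exI[of _ 0])
  moreover have "step \<rho> ` S \<subseteq> S"
  proof safe
    fix h assume "h \<in> S"
    hence h: "norm h \<le> 2" "pull swap3 h = h" by (auto simp: S_def)
    have "norm (disp \<rho> h * lap h - nonl \<rho> (prof h)) \<le> 2 * lipc * rad\<^sup>2 * rad + lipc * rad\<^sup>2"
      by (intro norm_triangle_le_diff add_mono order_trans[OF norm_mult_ineq] mult_mono M L N h)
         (use rad in auto)
    also have "\<dots> \<le> stepc" using nn rad unfolding stepc_def power2_eq_square power3_eq_cube by linarith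
    finally have "\<rho> * norm (disp \<rho> h * lap h - nonl \<rho> (prof h)) \<le> \<rho> * stepc"
      using \<rho> by (intro mult_left_mono) auto
    hence "norm (\<rho> *\<^sub>R (disp \<rho> h * lap h - nonl \<rho> (prof h))) \<le> 1/2"
      using \<rho> unfolding norm_scaleR abs_of_pos[OF \<rho>(1)] by linarith
    hence "norm (step \<rho> h) \<le> 2"
      using norm_triangle_ineq[of bvar "\<rho> *\<^sub>R (disp \<rho> h * lap h - nonl \<rho> (prof h))"]
      by (simp add: step_def bvar_def)
    moreover have "pull swap3 (step \<rho> h) = step \<rho> h"
    proof -
      note lin = bounded_linear.linear[OF bounded_linear_pull[OF bij_is_inj[OF bij_swap3]]]
      have "\<rho> * norm (prof h) \<le> 1/2"
        using mult_left_mono[OF P[OF h(1)], of \<rho>] \<rho> \<rho>R by linarith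
      hence "pull swap3 (nonl \<rho> (prof h)) = nonl \<rho> (prof h)"
        using \<rho> h by (intro pull_swap_nonl pull_swap_prof) auto
      moreover have "pull swap3 bvar = bvar"
        by (rule l1_eqI) (simp add: bvar_def coef_pull[OF bij_is_inj[OF bij_swap3]] delta_swap3)
      moreover have "pull swap3 (disp \<rho> h) = disp \<rho> h"
        by (simp add: disp_def linear_scale[OF lin] pull_swap_diag)
      ultimately show ?thesis
        by (simp add: step_def linear_add[OF lin] linear_scale[OF lin] linear_diff[OF lin]
            pull_times[OF bij_swap3] pull_swap_lap[OF h(2)])
    qed
    ultimately show "step \<rho> h \<in> S" by (simp add: S_def)
  qed
  moreover have "dist (step \<rho> h) (step \<rho> h') \<le> 1/2 * dist h h'" if "h \<in> S" "h' \<in> S" for h h'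
  proof -
    have h: "norm h \<le> 2" "norm h' \<le> 2" using that by (auto simp: S_def)
    have "disp \<rho> h * lap h - disp \<rho> h' * lap h' =
        (disp \<rho> h - disp \<rho> h') * lap h + disp \<rho> h' * (lap h - lap h')"
      by (simp add: algebra_simps)
    also have "norm \<dots> \<le> (2 * lipc * rad * gap * norm (h - h')) * rad + (2 * lipc * rad\<^sup>2) * (gap * norm (h - h'))"
      by (intro norm_triangle_le add_mono order_trans[OF norm_mult_ineq] mult_mono MD L M norm_lap_diff_le h)
         (use rad in auto)
    finally have A: "norm (disp \<rho> h * lap h - disp \<rho> h' * lap h')
        \<le> (2 * lipc * rad * gap * norm (h - h')) * rad + (2 * lipc * rad\<^sup>2) * (gap * norm (h - h'))" .
    have "norm ((disp \<rho> h * lap h - disp \<rho> h' * lap h') - (nonl \<rho> (prof h) - nonl \<rho> (prof h')))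
        \<le> (2 * lipc * rad * gap * norm (h - h')) * rad + (2 * lipc * rad\<^sup>2) * (gap * norm (h - h'))
          + lipc * rad * gap * norm (h - h')"
      by (rule norm_triangle_le_diff[OF add_mono[OF A ND[OF h]]])
    also have "\<dots> = (4 * lipc * rad\<^sup>2 * gap + lipc * rad * gap) * norm (h - h')"
      by (simp add: algebra_simps power2_eq_square)
    also have "\<dots> \<le> stepc * norm (h - h')"
      using nn rad unfolding stepc_def by (intro mult_right_mono) auto
    finally have "\<rho> * norm ((disp \<rho> h * lap h - disp \<rho> h' * lap h') - (nonl \<rho> (prof h) - nonl \<rho> (prof h')))
        \<le> \<rho> * stepc * norm (h - h')" using \<rho> by (simp add: mult.assoc)
    also have "\<dots> \<le> 1/2 * norm (h - h')" using \<rho> by (intro mult_right_mono) auto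
    finally have "norm (\<rho> *\<^sub>R ((disp \<rho> h * lap h - disp \<rho> h' * lap h') - (nonl \<rho> (prof h) - nonl \<rho> (prof h'))))
        \<le> 1/2 * norm (h - h')" using \<rho> by simp
    moreover have "step \<rho> h - step \<rho> h' =
        \<rho> *\<^sub>R ((disp \<rho> h * lap h - disp \<rho> h' * lap h') - (nonl \<rho> (prof h) - nonl \<rho> (prof h')))"
      by (simp add: step_def algebra_simps)
    ultimately show ?thesis by (simp add: dist_norm)
  qed
  ultimately have "\<exists>!h\<in>S. step \<rho> h = h"
    by (intro Banach_fix[where c = "1/2"]) auto
  thus "\<exists>h. norm h \<le> 2 \<and> pull swap3 h = h \<and> step \<rho> h = h"
    by (auto simp: S_def)
qed

text \<open>In \<open>fixed_point_eq\<close> no projection off the kernel appears: the choice of \<open>disp\<close> cancels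
  frequency one in \<open>step\<close>, and the swap symmetry then gives frequency minus one.\<close>

lemma coef_times_radial:
  assumes radial: "\<And>i. mode i \<noteq> 0 \<Longrightarrow> coef \<mu> i = 0"
    and g: "\<And>j. mode j = mode i \<Longrightarrow> coef g j = coef g' j"
  shows "coef (\<mu> * g) i = coef (\<mu> * g') i"
  unfolding coef_times conv_def
proof (rule infsum_cong, clarify)
  fix a b assume "i = a + b"
  thus "coef \<mu> a * coef g b = coef \<mu> a * coef g' b"
    using radial[of a] g[of b] by (cases "mode a = 0") (simp_all only: mode_simps, auto)
qed

lemma fixed_point_eq:
  assumes h: "pull swap3 h = h" and fp: "step \<rho> h = h"
  shows "p *\<^sub>R (prof h - lap h) = h"
proof -
  have one: "coef h i = 0" if i: "mode i = 1" for i
  proof -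
    obtain m j where ij: "i = (Suc m, m, j)"
      using i by (cases i) (auto simp: mode_def)
    have rad: "coef (disp \<rho> h) i = 0" if "mode i \<noteq> 0" for i
      using that by (simp add: disp_def coef_diag)
    \<comment> \<open>As \<open>disp\<close> lives on frequency zero, only the frequency-one
      coefficients of \<open>lap h\<close> enter. The multiplier vanishes there, which leaves the
      monomial x with coefficient 1/2 from \<open>cos1\<close>.\<close>
    have "coef (disp \<rho> h * lap h) i = coef (disp \<rho> h * ((1/2) *\<^sub>R single (1, 0, 0))) i"
    proof (rule coef_times_radial[OF rad])
      fix j :: idx assume "mode j = mode i"
      hence "mode j = 1" using i by simp
      hence "j \<noteq> (0, 1, 0)" "lap_mult j = 0" by (auto simp: lap_mult_def inv_mult_def)
      thus "coef (lap h) j = coef ((1/2) *\<^sub>R single (1, 0, 0)) j"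
        by (simp add: lap_def coef_lap coef_cos1) (simp add: delta_def)
    qed auto
    also have "\<dots> = 1/2 * coef (single (1, 0, 0) * disp \<rho> h) i"
      by (simp add: mult.commute)
    also have "coef (single (1, 0, 0) * disp \<rho> h) i = conv (delta (1, 0, 0)) (coef (disp \<rho> h)) i"
      unfolding coef_times by (rule arg_cong[where f = "\<lambda>f. conv f _ _"]) auto
    also have "\<dots> = (\<Sum>\<^sub>\<infinity>k\<in>{(m, m, j)}. coef (disp \<rho> h) k)"
      unfolding conv_delta by (rule arg_cong[where f = "infsum _"]) (auto simp: ij)
    \<comment> \<open>The factor 2 in \<open>disp\<close> compensates the 1/2 in
      \<open>cos1\<close>, and \<open>shift3\<close> restores the power of x that multiplication by
      x had removed from the index.\<close>
    also have "\<dots> = 2 * coef (nonl \<rho> (prof h)) i"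
      by (simp add: disp_def coef_diag shift3_def ij)
    finally have "coef (disp \<rho> h * lap h) i = coef (nonl \<rho> (prof h)) i" by simp
    moreover have "coef bvar i = 0" using i by (auto simp: bvar_def delta_def)
    ultimately have "coef (step \<rho> h) i = 0" by (simp add: step_def)
    thus ?thesis by (simp add: fp)
  qed
  have zero: "coef h i = 0" if "\<bar>mode i\<bar> = 1" for i
  proof (cases "mode i = 1")
    case False
    hence "coef h (swap3 i) = 0" using that by (intro one) auto
    thus ?thesis using arg_cong[OF h, of "\<lambda>h. coef h i"] by (simp add: coef_pull[OF bij_is_inj[OF bij_swap3]])
  qed (rule one)
  show ?thesis
  proof (rule l1_eqI)
    fix i
    have "coef (p *\<^sub>R (prof h - lap h)) i = (p * (inv_mult i - lap_mult i)) * coef h i"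
      by (simp add: prof_def lap_def coef_inv coef_lap algebra_simps)
    thus "coef (p *\<^sub>R (prof h - lap h)) i = coef h i"
      using zero[of i] inv_mult_eq[of i] by (cases "\<bar>mode i\<bar> = 1") auto
  qed
qed

end

subsection \<open>Absolutely convergent trigonometric series\<close>

lemma has_sum_fibres:
  fixes g :: "'x \<Rightarrow> 'b::banach"
  assumes g: "(g has_sum S) X"
    and fib: "\<And>l. (g has_sum G l) {x \<in> X. lam x = l}"
  shows "(G has_sum S) UNIV"
proof -
  have "((\<lambda>(l, x). g x) has_sum S) (SIGMA l:UNIV. {x \<in> X. lam x = l})"
    using g
    by (subst has_sum_reindex_bij_witness[where i = "\<lambda>x. (lam x, x)" and j = snd and T = X and h = g]) auto
  thus ?thesis by (rule has_sum_SigmaD) (use fib in simp)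
qed

lemma abs_summable_fibres:
  fixes g :: "'x \<Rightarrow> real"
  assumes g: "g summable_on X" and nonneg: "\<And>x. x \<in> X \<Longrightarrow> g x \<ge> 0"
  shows "((\<lambda>l. infsum g {x \<in> X. lam x = l}) has_sum infsum g X) UNIV"
  by (rule has_sum_fibres[OF has_sum_infsum[OF g], of lam], rule has_sum_infsum,
      rule summable_on_subset_banach[OF g]) auto

lemma integral_cis_period:
  fixes n :: int
  assumes T: "T > 0"
  shows "((\<lambda>y. cis (2 * pi * of_int n * y / T)) has_integral (if n = 0 then of_real T else 0)) {0..T}"
proof (cases "n = 0")
  case True
  thus ?thesis using has_integral_const_real[of "1 :: complex" 0 T] T by (simp add: scaleR_conv_of_real)
next
  case False
  define c where "c = 2 * pi * of_int n / T"
  have c: "c \<noteq> 0" using False T by (simp add: c_def)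
  have "((\<lambda>y. cis (c * y)) has_integral (cis (c * T) / (\<i> * c) - cis (c * 0) / (\<i> * c))) {0..T}"
  proof (rule fundamental_theorem_of_calculus)
    fix y
    have "((\<lambda>y. exp (\<i> * of_real c * of_real y)) has_vector_derivative
        (exp (\<i> * of_real c * of_real y) * (\<i> * of_real c))) (at y within {0..T})"
      by (rule has_vector_derivative_real_field) (auto intro!: derivative_eq_intros)
    hence "((\<lambda>y. cis (c * y)) has_vector_derivative (c * (\<i> * cis (c * y)))) (at y within {0..T})"
      by (simp add: cis_conv_exp mult_ac)
    from has_vector_derivative_mult_right[OF this, of "1 / (\<i> * c)"]
    show "((\<lambda>y. cis (c * y) / (\<i> * c)) has_vector_derivative cis (c * y)) (at y within {0..T})"
      using c by simp
  qed (use T in auto)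
  moreover have "cis (c * T) = 1"
    using T cis_multiple_2pi[of "of_int n"] by (simp add: c_def mult.commute)
  ultimately show ?thesis using False T by (simp add: c_def)
qed

lemma norm_of_real_cis [simp]: "norm (complex_of_real r * cis t) = \<bar>r\<bar>"
  by (simp add: norm_mult)

lemma uniform_limit_trig_series:
  assumes f: "\<And>z. ((\<lambda>x. of_real (u x) * cis (c * of_int (lam x) * z)) has_sum of_real (f z)) X"
    and u: "(\<lambda>x. \<bar>u x\<bar>) summable_on X"
  shows "uniform_limit S (\<lambda>F z. \<Sum>x\<in>F. of_real (u x) * cis (c * of_int (lam x) * z))
           (\<lambda>z. complex_of_real (f z)) (finite_subsets_at_top X)"
  by (rule Weierstrass_m_test_general'[where M = "\<lambda>x. \<bar>u x\<bar>"]) (use f u in auto)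

lemma trig_series_continuous:
  assumes f: "\<And>z. ((\<lambda>x. of_real (u x) * cis (c * of_int (lam x) * z)) has_sum of_real (f z)) X"
    and u: "(\<lambda>x. \<bar>u x\<bar>) summable_on X"
  shows "continuous_on S f"
proof -
  have "continuous_on S (\<lambda>z. complex_of_real (f z))"
    by (rule uniform_limit_theorem[OF _ uniform_limit_trig_series[OF f u]])
       (auto intro!: always_eventually continuous_intros simp: cis_conv_exp)
  from continuous_on_Re[OF this] show ?thesis by simp
qed

text \<open>Many summands may share one frequency, so the Fourier coefficient appears as a sum over
  a fibre of \<open>lam\<close>. Uniform convergence along finite subsets permits integration term
  by term.\<close>

lemma fcT_trig_series:
  fixes lam :: "'x \<Rightarrow> int"
  assumes T: "T > 0"
    and f: "\<And>z. ((\<lambda>x. of_real (u x) * cis (2 * pi / T * of_int (lam x) * z)) has_sum of_real (f z)) X"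
    and u: "(\<lambda>x. \<bar>u x\<bar>) summable_on X"
  shows "((\<lambda>x. of_real (u x)) has_sum fcT T f l) {x \<in> X. lam x = l}"
proof -
  define g where "g x z = of_real (u x) * cis (2 * pi * of_int (lam x - l) * z / T)" for x z
  have g_eq: "of_real (u x) * cis (2 * pi / T * of_int (lam x) * z) * cis (- 2 * pi * of_int l * z / T) = g x z"
    for x z
    unfolding g_def mult.assoc cis_mult by (simp add: algebra_simps diff_divide_distrib)
  have "((\<lambda>x. g x z) has_sum (of_real (f z) * cis (- 2 * pi * of_int l * z / T))) X" for z
    using has_sum_cmult_left[OF f[of z], of "cis (- 2 * pi * of_int l * z / T)"] by (simp only: g_eq)
  hence "uniform_limit {0..T} (\<lambda>F z. \<Sum>x\<in>F. g x z)
      (\<lambda>z. of_real (f z) * cis (- 2 * pi * of_int l * z / T)) (finite_subsets_at_top X)"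
    by (intro Weierstrass_m_test_general'[where M = "\<lambda>x. \<bar>u x\<bar>"]) (use u in \<open>auto simp: g_def\<close>)
  then obtain I J where I: "\<And>F. ((\<lambda>z. \<Sum>x\<in>F. g x z) has_integral I F) {0..T}"
    and J: "((\<lambda>z. of_real (f z) * cis (- 2 * pi * of_int l * z / T)) has_integral J) {0..T}"
    and lim: "(I \<longlongrightarrow> J) (finite_subsets_at_top X)"
    by (rule uniform_limit_integral_cbox[where a = 0 and b = T, simplified])
       (use T in \<open>auto simp: g_def cis_conv_exp intro!: continuous_intros\<close>)
  have "I F = (\<Sum>x\<in>F. of_real (u x) * (if lam x = l then of_real T else 0))" if "finite F" for F
  proof (rule has_integral_unique[OF I])
    show "((\<lambda>z. \<Sum>x\<in>F. g x z) has_integral (\<Sum>x\<in>F. of_real (u x) * (if lam x = l then of_real T else 0))) {0..T}"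
      unfolding g_def
      using integral_cis_period[OF T, of "lam _ - l"]
      by (intro has_integral_sum that has_integral_mult_right) auto
  qed
  hence "\<forall>\<^sub>F F in finite_subsets_at_top X. I F = (\<Sum>x\<in>F. of_real (u x) * (if lam x = l then of_real T else 0))"
    by (auto intro: eventually_finite_subsets_at_top_weakI)
  hence "((\<lambda>x. of_real (u x) * (if lam x = l then of_real T else 0)) has_sum J) X"
    unfolding has_sum_def using lim by (simp add: filterlim_cong)
  from has_sum_cmult_right[OF this, of "of_real (1 / T)"]
  have "((\<lambda>x. if lam x = l then of_real (u x) else 0) has_sum (of_real (1 / T) * J)) X"
    using T by (simp add: if_distrib[of "\<lambda>x. _ * x"] cong: if_cong)
  also have "of_real (1 / T) * J = fcT T f l"
    unfolding fcT_def using integral_unique[OF J] by simp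
  finally show ?thesis
    by (subst has_sum_cong_neutral[where T = X and g = "\<lambda>x. if lam x = l then of_real (u x) else 0"]) auto
qed

lemma trig_series_periodic:
  assumes f: "\<And>z. ((\<lambda>x. of_real (u x) * cis (of_int (lam x) * z)) has_sum of_real (f z)) X"
  shows "f (z + 2 * pi) = f z"
proof -
  have "cis (of_int (lam x) * (z + 2 * pi)) = cis (of_int (lam x) * z)" for x
  proof -
    have "cis (of_int (lam x) * (z + 2 * pi)) = cis (of_int (lam x) * z) * cis (2 * pi * of_int (lam x))"
      unfolding cis_mult by (simp add: algebra_simps)
    thus ?thesis by (simp add: cis_multiple_2pi)
  qed
  hence "complex_of_real (f (z + 2 * pi)) = of_real (f z)"
    using f[of "z + 2 * pi"] by (intro has_sum_unique[OF _ f[of z]]) simp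
  thus ?thesis by simp
qed

section \<open>Sobolev membership and smoothness of trigonometric series\<close>

definition hs_weight :: "real \<Rightarrow> int \<Rightarrow> real" where
  "hs_weight s l = (1 + (of_int l)\<^sup>2) powr (s / 2)"

lemma hs_weight_pos: "hs_weight s l > 0"
proof -
  have "1 + (real_of_int l)\<^sup>2 > 0" by (rule add_pos_nonneg) auto
  thus ?thesis by (simp add: hs_weight_def)
qed

lemma hs_weight_ge_1: "s \<ge> 0 \<Longrightarrow> hs_weight s l \<ge> 1"
  unfolding hs_weight_def by (intro ge_one_powr_ge_zero) auto

text \<open>Weighted l1 embeds in H^s with constant one. If y_l is the weighted absolute sum over
  frequency l and Y is the total, then the l-th term of the squared norm is at most y_l^2 \<le> Y
  y_l, and these add up to Y^2.\<close>

lemma trig_series_in_Hs: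
  fixes lam :: "'x \<Rightarrow> int"
  assumes s: "s \<ge> 0"
    and f: "\<And>z. ((\<lambda>x. of_real (u x) * cis (of_int (lam x) * z)) has_sum of_real (f z)) X"
    and u: "(\<lambda>x. hs_weight s (lam x) * \<bar>u x\<bar>) summable_on X"
  shows "in_Hs s f" and "Hs_norm s f \<le> (\<Sum>\<^sub>\<infinity>x\<in>X. hs_weight s (lam x) * \<bar>u x\<bar>)"
proof -
  define Y where "Y = (\<Sum>\<^sub>\<infinity>x\<in>X. hs_weight s (lam x) * \<bar>u x\<bar>)"
  define y where "y l = (\<Sum>\<^sub>\<infinity>x\<in>{x \<in> X. lam x = l}. hs_weight s (lam x) * \<bar>u x\<bar>)" for l
  have nonneg: "hs_weight s l * \<bar>r\<bar> \<ge> 0" for l r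
    using hs_weight_pos[of s l] by simp
  have u': "(\<lambda>x. \<bar>u x\<bar>) summable_on X"
    by (rule summable_on_comparison_test[OF u])
       (use mult_right_mono[OF hs_weight_ge_1[OF s] abs_ge_zero] in auto)
  have f': "((\<lambda>x. of_real (u x) * cis (2 * pi / (2 * pi) * of_int (lam x) * z)) has_sum of_real (f z)) X" for z
    using f[of z] by simp
  have fc: "((\<lambda>x. of_real (u x)) has_sum fc f l) {x \<in> X. lam x = l}" for l
    unfolding fc_def by (rule fcT_trig_series[OF _ f' u']) auto
  have y: "(y has_sum Y) UNIV"
    unfolding y_def Y_def by (rule abs_summable_fibres[OF u nonneg])
  have y0: "y l \<ge> 0" for l unfolding y_def by (rule infsum_nonneg) (rule nonneg)
  have yY: "y l \<le> Y" for l
    using finite_sum_le_has_sum[OF y, of "{l}"] y0 by simp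
  have Y0: "Y \<ge> 0" using order_trans[OF y0 yY] .
  have fc_le: "hs_weight s l * cmod (fc f l) \<le> y l" for l
  proof -
    have sub: "(\<lambda>x. \<bar>u x\<bar>) summable_on {x \<in> X. lam x = l}"
      by (rule summable_on_subset_banach[OF u']) auto
    have "cmod (fc f l) \<le> (\<Sum>\<^sub>\<infinity>x\<in>{x \<in> X. lam x = l}. \<bar>u x\<bar>)"
      using norm_has_sum_bound[OF _ fc[of l]] has_sum_infsum[OF sub] by simp
    hence "hs_weight s l * cmod (fc f l) \<le> hs_weight s l * (\<Sum>\<^sub>\<infinity>x\<in>{x \<in> X. lam x = l}. \<bar>u x\<bar>)"
      using hs_weight_pos[of s l] by (intro mult_left_mono) auto
    also have "\<dots> = y l"
      unfolding y_def by (subst infsum_cmult_right'[symmetric]) (auto intro!: infsum_cong)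
    finally show ?thesis .
  qed
  have term_eq: "(1 + (of_int l)\<^sup>2) powr s * (cmod (fc f l))\<^sup>2 = (hs_weight s l * cmod (fc f l))\<^sup>2" for l
  proof -
    have "1 + (real_of_int l)\<^sup>2 > 0" by (rule add_pos_nonneg) auto
    hence "(hs_weight s l)\<^sup>2 = (1 + (of_int l)\<^sup>2) powr s"
      unfolding hs_weight_def power2_eq_square[of "_ powr _"] by (simp flip: powr_add)
    thus ?thesis by (simp add: power_mult_distrib)
  qed
  have term_le: "(1 + (of_int l)\<^sup>2) powr s * (cmod (fc f l))\<^sup>2 \<le> Y * y l" for l
  proof -
    have "(hs_weight s l * cmod (fc f l))\<^sup>2 \<le> (y l)\<^sup>2"
      using hs_weight_pos[of s l] by (intro power_mono fc_le) auto
    also have "\<dots> \<le> Y * y l"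
      unfolding power2_eq_square by (intro mult_right_mono yY y0)
    finally show ?thesis unfolding term_eq .
  qed
  have sumY: "((\<lambda>l. Y * y l) has_sum (Y * Y)) UNIV" by (rule has_sum_cmult_right[OF y])
  have summ: "(\<lambda>l::int. (1 + (of_int l)\<^sup>2) powr s * (cmod (fc f l))\<^sup>2) summable_on UNIV"
    by (rule summable_on_comparison_test[OF has_sum_imp_summable[OF sumY]]) (auto intro: term_le)
  have cont: "continuous_on {0..2*pi} f"
    by (rule trig_series_continuous[of u 1, OF _ u']) (use f in simp)
  show "in_Hs s f"
    unfolding in_Hs_def
    by (intro conjI allI summ trig_series_periodic[OF f] integrable_continuous_real cont continuous_intros)
  have "infsum (\<lambda>l::int. (1 + (of_int l)\<^sup>2) powr s * (cmod (fc f l))\<^sup>2) UNIV \<le> Y * Y"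
    using infsum_mono[OF summ has_sum_imp_summable[OF sumY] term_le] infsumI[OF sumY] by simp
  hence "Hs_norm s f \<le> sqrt (Y * Y)" unfolding Hs_norm_def by (rule real_sqrt_le_mono)
  thus "Hs_norm s f \<le> (\<Sum>\<^sub>\<infinity>x\<in>X. hs_weight s (lam x) * \<bar>u x\<bar>)"
    using Y0 by (simp add: Y_def)
qed

text \<open>The form Re H(e^(iz)) is stable under differentiation in z: H is replaced by \<i> w
  H'(w), holomorphic on the same disc, so induction on the order applies.\<close>

lemma smooth_fun_holomorphic:
  assumes H: "H holomorphic_on ball 0 R" and R: "R > 1" and f: "\<And>z. f z = Re (H (cis z))"
  shows "smooth_fun f"
proof -
  have deriv: "((\<lambda>z. Re (H (cis z))) has_real_derivative Re (\<i> * cis z * deriv H (cis z))) (at z)"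
    if H: "H holomorphic_on ball 0 R" for H z
  proof -
    have "(H has_field_derivative deriv H (cis z)) (at (cis z))"
      using R by (intro holomorphic_derivI[OF H]) auto
    moreover have "(cis has_vector_derivative (\<i> * cis z)) (at z)"
    proof -
      have "((\<lambda>y. exp (\<i> * of_real y)) has_vector_derivative (exp (\<i> * of_real z) * \<i>)) (at z)"
        by (rule has_vector_derivative_real_field) (auto intro!: derivative_eq_intros)
      thus ?thesis by (simp add: cis_conv_exp[abs_def] mult_ac)
    qed
    ultimately have "(H \<circ> cis has_vector_derivative (\<i> * cis z * deriv H (cis z))) (at z)"
      using field_vector_diff_chain_at by blast
    from bounded_linear.has_vector_derivative[OF bounded_linear_Re this]
    show ?thesis by (simp add: has_real_derivative_iff_has_vector_derivative o_def)
  qed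
  have "\<exists>H. H holomorphic_on ball 0 R \<and> (\<forall>z. (deriv ^^ n) f z = Re (H (cis z)))" for n
  proof (induction n)
    case 0
    thus ?case using H f by auto
  next
    case (Suc n)
    then obtain H where H: "H holomorphic_on ball 0 R" and eq: "(deriv ^^ n) f = (\<lambda>z. Re (H (cis z)))"
      by auto
    have "(\<lambda>w. \<i> * w * deriv H w) holomorphic_on ball 0 R"
      by (intro holomorphic_intros holomorphic_deriv H) auto
    moreover have "(deriv ^^ Suc n) f z = Re (\<i> * cis z * deriv H (cis z))" for z
      using DERIV_imp_deriv[OF deriv[OF H]] by (simp add: eq)
    ultimately show ?case by blast
  qed
  thus ?thesis
    unfolding smooth_fun_def
    by (metis (no_types, lifting) deriv ext field_differentiable_def field_differentiable_imp_differentiable)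
qed

text \<open>For real coefficients the real part of each term is a cosine and depends only on the
  modulus of the frequency. Negative frequencies can thus be folded onto positive ones, which makes
  f the real part of a power series in w = e^(iz) converging beyond the unit circle.\<close>

lemma trig_series_smooth:
  fixes lam :: "'x \<Rightarrow> int"
  assumes R: "R > 1"
    and f: "\<And>z. ((\<lambda>x. of_real (u x) * cis (of_int (lam x) * z)) has_sum of_real (f z)) X"
    and u: "(\<lambda>x. \<bar>u x\<bar> * R ^ nat \<bar>lam x\<bar>) summable_on X"
  shows "smooth_fun f"
proof -
  define N where "N x = nat \<bar>lam x\<bar>" for x
  define d where "d n = (\<Sum>\<^sub>\<infinity>x\<in>{x \<in> X. N x = n}. u x)" for n
  define H where "H w = (\<Sum>\<^sub>\<infinity>x\<in>X. of_real (u x) * w ^ N x)" for w :: complex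
  have abs: "(\<lambda>x. norm (of_real (u x) * w ^ N x)) summable_on X" if "norm w \<le> R" for w :: complex
    by (rule summable_on_comparison_test[OF u])
       (use that in \<open>auto simp: norm_mult norm_power N_def intro!: mult_left_mono power_mono\<close>)
  have hs: "((\<lambda>x. of_real (u x) * w ^ N x) has_sum H w) X" if "norm w \<le> R" for w
    unfolding H_def by (rule has_sum_infsum, rule Infinite_Sum.abs_summable_summable, rule abs[OF that])
  have u1: "(\<lambda>x. \<bar>u x\<bar>) summable_on X"
    using abs[of 1] R by (simp add: norm_mult)
  have fib: "((\<lambda>x. of_real (u x) * w ^ N x) has_sum (of_real (d n) * w ^ n)) {x \<in> X. N x = n}"
    for w :: complex and n
  proof -
    have "(\<lambda>x. \<bar>u x\<bar>) summable_on {x \<in> X. N x = n}"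
      by (rule summable_on_subset_banach[OF u1]) auto
    hence "u summable_on {x \<in> X. N x = n}"
      by (subst summable_on_iff_abs_summable_on_real) simp
    hence "(u has_sum d n) {x \<in> X. N x = n}" unfolding d_def by (rule has_sum_infsum)
    hence "((\<lambda>x. of_real (u x)) has_sum (of_real (d n) :: complex)) {x \<in> X. N x = n}"
      by (rule has_sum_of_real)
    from has_sum_cmult_left[OF this, of "w ^ n"] show ?thesis
      by (subst has_sum_cong[where g = "\<lambda>x. of_real (u x) * w ^ n"]) auto
  qed
  have "H holomorphic_on ball 0 R"
  proof (rule power_series_holomorphic)
    fix w :: complex assume "w \<in> ball 0 R"
    hence "norm w \<le> R" by simp
    from has_sum_imp_sums[OF has_sum_fibres[OF hs[OF this] fib]]
    show "(\<lambda>n. of_real (d n) * (w - 0) ^ n) sums H w" by simp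
  qed
  moreover have "f z = Re (H (cis z))" for z
  proof (rule has_sum_unique)
    show "((\<lambda>x. u x * cos (of_int (lam x) * z)) has_sum f z) X"
      using has_sum_Re[OF f[of z]] by simp
    have "Re (of_real (u x) * cis z ^ N x) = u x * cos (of_int (lam x) * z)" for x
    proof -
      have "cos (real (N x) * z) = cos (of_int (lam x) * z)"
        by (cases "lam x \<ge> 0") (auto simp: N_def)
      moreover have "cis z ^ N x = cis (real (N x) * z)" by (rule Complex.DeMoivre)
      ultimately show ?thesis by simp
    qed
    moreover have "((\<lambda>x. Re (of_real (u x) * cis z ^ N x)) has_sum Re (H (cis z))) X"
      by (rule has_sum_Re[OF hs]) (use R in simp)
    ultimately show "((\<lambda>x. u x * cos (of_int (lam x) * z)) has_sum Re (H (cis z))) X"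
      by (simp only:)
  qed
  ultimately show ?thesis by (rule smooth_fun_holomorphic[OF _ R])
qed

subsection \<open>Re-expansion of power series about another centre\<close>

definition tc :: "real \<Rightarrow> nat \<Rightarrow> nat \<Rightarrow> real" where
  "tc a n i = real (n choose i) * a ^ (n - i)"

lemma tc_has_sum: "((\<lambda>i. tc a n i * h ^ i) has_sum (a + h) ^ n) UNIV"
proof (rule has_sum_finite_neutralI[of "{..n}"])
  show "(a + h) ^ n = (\<Sum>i\<in>{..n}. tc a n i * h ^ i)"
    using binomial_ring[of h a n] by (simp add: tc_def add.commute mult_ac)
qed (auto simp: tc_def)

lemma abs_tc: "\<bar>tc a n i * h ^ i\<bar> = tc \<bar>a\<bar> n i * \<bar>h\<bar> ^ i"
  by (simp add: tc_def abs_mult power_abs)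

text \<open>The weight \<open>w\<close> lets one computation serve both real-valued analyticity,
  with weight 1, and Sobolev-valued analyticity, with the Sobolev weight of the frequency.\<close>

locale reexpansion =
  fixes u :: "'x \<Rightarrow> real" and N J :: "'x \<Rightarrow> nat" and w :: "'x \<Rightarrow> real" and s t a0 b0 r :: real
  assumes w: "\<And>x. w x \<ge> 1"
    and u: "(\<lambda>x. w x * \<bar>u x\<bar> * s ^ N x * t ^ J x) summable_on UNIV"
    and r: "r > 0" "\<bar>a0\<bar> + r \<le> s" "\<bar>b0\<bar> + r \<le> t"
begin

definition tc2 :: "nat \<times> nat \<Rightarrow> 'x \<Rightarrow> real" where
  "tc2 ij x = u x * (tc a0 (N x) (fst ij) * tc b0 (J x) (snd ij))"

definition mon :: "real \<Rightarrow> real \<Rightarrow> nat \<times> nat \<Rightarrow> real" where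
  "mon h k ij = h ^ fst ij * k ^ snd ij"

text \<open>After passing to absolute values the inner sum over the Taylor indices is, by the
  binomial theorem, (|a0| + |h|)^N (|b0| + |k|)^J, and the choice of \<open>r\<close> keeps both
  bases below the radii \<open>s\<close> and \<open>t\<close>.\<close>

lemma joint_summable:
  assumes h: "\<bar>h\<bar> \<le> r" and k: "\<bar>k\<bar> \<le> r"
  shows "(\<lambda>(ij, x). w x * \<bar>tc2 ij x * mon h k ij\<bar>) summable_on UNIV \<times> UNIV"
proof -
  have "(\<lambda>(x, ij). w x * \<bar>tc2 ij x * mon h k ij\<bar>) summable_on UNIV \<times> UNIV"
  proof (rule summable_on_SigmaI)
    fix x
    have abs: "(\<lambda>i. \<bar>tc a n i * h ^ i\<bar>) summable_on UNIV" for a h n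
      unfolding abs_tc by (rule has_sum_imp_summable[OF tc_has_sum])
    have "((\<lambda>(i, j). (tc \<bar>a0\<bar> (N x) i * \<bar>h\<bar> ^ i) * (tc \<bar>b0\<bar> (J x) j * \<bar>k\<bar> ^ j)) has_sum
        ((\<bar>a0\<bar> + \<bar>h\<bar>) ^ N x * (\<bar>b0\<bar> + \<bar>k\<bar>) ^ J x)) (UNIV \<times> UNIV)"
      by (rule has_sum_times[OF tc_has_sum tc_has_sum]) (auto intro: abs)
    from has_sum_cmult_right[OF this, of "w x * \<bar>u x\<bar>"]
    have "((\<lambda>ij. w x * \<bar>u x\<bar> * (\<bar>tc a0 (N x) (fst ij) * h ^ fst ij\<bar> * \<bar>tc b0 (J x) (snd ij) * k ^ snd ij\<bar>)) has_sum
        (w x * \<bar>u x\<bar> * ((\<bar>a0\<bar> + \<bar>h\<bar>) ^ N x * (\<bar>b0\<bar> + \<bar>k\<bar>) ^ J x))) UNIV"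
      by (simp add: abs_tc case_prod_unfold)
    thus "((\<lambda>y. case (x, y) of (x, ij) \<Rightarrow> w x * \<bar>tc2 ij x * mon h k ij\<bar>) has_sum
        (w x * \<bar>u x\<bar> * ((\<bar>a0\<bar> + \<bar>h\<bar>) ^ N x * (\<bar>b0\<bar> + \<bar>k\<bar>) ^ J x))) UNIV"
      by (simp add: tc2_def mon_def abs_mult mult_ac)
  next
    show "(\<lambda>x. w x * \<bar>u x\<bar> * ((\<bar>a0\<bar> + \<bar>h\<bar>) ^ N x * (\<bar>b0\<bar> + \<bar>k\<bar>) ^ J x)) summable_on UNIV"
    proof (rule summable_on_comparison_test[OF u])
      fix x
      have wu: "w x * \<bar>u x\<bar> \<ge> 0" using w[of x] by simp
      have "(\<bar>a0\<bar> + \<bar>h\<bar>) ^ N x * (\<bar>b0\<bar> + \<bar>k\<bar>) ^ J x \<le> s ^ N x * t ^ J x"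
        using r h k by (intro mult_mono power_mono) auto
      from mult_left_mono[OF this wu]
      show "w x * \<bar>u x\<bar> * ((\<bar>a0\<bar> + \<bar>h\<bar>) ^ N x * (\<bar>b0\<bar> + \<bar>k\<bar>) ^ J x) \<le> w x * \<bar>u x\<bar> * s ^ N x * t ^ J x"
        by (simp add: mult.assoc)
      show "0 \<le> w x * \<bar>u x\<bar> * ((\<bar>a0\<bar> + \<bar>h\<bar>) ^ N x * (\<bar>b0\<bar> + \<bar>k\<bar>) ^ J x)"
        using wu by simp
    qed
  next
    show "0 \<le> (case (x, ij) of (x, ij) \<Rightarrow> w x * \<bar>tc2 ij x * mon h k ij\<bar>)" for x ij
      using w[of x] by simp
  qed
  thus ?thesis by (subst summable_on_swap) (simp add: case_prod_unfold)
qed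

lemma coeff_summable: "(\<lambda>x. w x * \<bar>tc2 ij x\<bar>) summable_on UNIV"
proof -
  \<comment> \<open>Joint summability is used at h = k = r > 0, where the monomial is nonzero and
    can be divided out.\<close>
  have "(\<lambda>x. w x * \<bar>tc2 ij x * mon r r ij\<bar>) summable_on UNIV"
    using summable_on_SigmaD1[OF joint_summable[of r r], of ij] r by simp
  from summable_on_cmult_left[OF this, of "1 / mon r r ij"]
  show ?thesis using r by (simp add: mon_def abs_mult)
qed

lemma coeff_has_sum:
  fixes v :: "'x \<Rightarrow> complex"
  assumes v: "\<And>x. norm (v x) \<le> w x"
  shows "((\<lambda>x. v x * of_real (tc2 ij x)) has_sum (\<Sum>\<^sub>\<infinity>x. v x * of_real (tc2 ij x))) UNIV"
proof (rule has_sum_infsum, rule Infinite_Sum.abs_summable_summable)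
  show "(\<lambda>x. norm (v x * of_real (tc2 ij x))) summable_on UNIV"
    by (rule summable_on_comparison_test[OF coeff_summable[of ij]])
       (auto simp: norm_mult intro!: mult_right_mono v)
qed

lemma joint_has_sum:
  fixes v :: "'x \<Rightarrow> complex"
  assumes v: "\<And>x. norm (v x) \<le> w x" and h: "\<bar>h\<bar> \<le> r" and k: "\<bar>k\<bar> \<le> r"
    and S: "((\<lambda>x. v x * of_real (u x * (a0 + h) ^ N x * (b0 + k) ^ J x)) has_sum S) UNIV"
  shows "((\<lambda>(ij, x). v x * of_real (tc2 ij x * mon h k ij)) has_sum S) (UNIV \<times> UNIV)"
proof -
  have "(\<lambda>y. norm (case y of (ij, x) \<Rightarrow> v x * of_real (tc2 ij x * mon h k ij))) summable_on UNIV \<times> UNIV"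
    by (rule summable_on_comparison_test[OF joint_summable[OF h k]])
       (auto simp: norm_mult abs_mult intro!: mult_right_mono v)
  hence sm: "(\<lambda>(ij, x). v x * of_real (tc2 ij x * mon h k ij)) summable_on UNIV \<times> UNIV"
    by (rule Infinite_Sum.abs_summable_summable)
  define S' where "S' = (\<Sum>\<^sub>\<infinity>(ij, x)\<in>UNIV \<times> UNIV. v x * of_real (tc2 ij x * mon h k ij))"
  have S': "((\<lambda>(ij, x). v x * of_real (tc2 ij x * mon h k ij)) has_sum S') (UNIV \<times> UNIV)"
    unfolding S'_def by (rule has_sum_infsum[OF sm])
  hence sw: "((\<lambda>(x, ij). v x * of_real (tc2 ij x * mon h k ij)) has_sum S') (UNIV \<times> UNIV)"
    by (subst (asm) has_sum_swap) (simp add: case_prod_unfold)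
  have "((\<lambda>x. v x * of_real (u x * (a0 + h) ^ N x * (b0 + k) ^ J x)) has_sum S') UNIV"
  proof (rule has_sum_SigmaD[OF sw])
    fix x
    have abs: "(\<lambda>i. \<bar>tc a n i * h ^ i\<bar>) summable_on UNIV" for a h n
      unfolding abs_tc by (rule has_sum_imp_summable[OF tc_has_sum])
    have "((\<lambda>(i, j). (tc a0 (N x) i * h ^ i) * (tc b0 (J x) j * k ^ j)) has_sum
        ((a0 + h) ^ N x * (b0 + k) ^ J x)) (UNIV \<times> UNIV)"
      by (rule has_sum_times[OF tc_has_sum tc_has_sum]) (auto intro: abs)
    from has_sum_cmult_right[OF has_sum_of_real[OF this], of "v x * of_real (u x)"]
    show "((\<lambda>y. case (x, y) of (x, ij) \<Rightarrow> v x * of_real (tc2 ij x * mon h k ij)) has_sum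
        v x * of_real (u x * (a0 + h) ^ N x * (b0 + k) ^ J x)) UNIV"
      by (simp add: tc2_def mon_def case_prod_unfold mult_ac)
  qed
  hence "S' = S" by (rule has_sum_unique) (rule S)
  thus ?thesis using S' by simp
qed

lemma expansion_has_sum:
  fixes v :: "'x \<Rightarrow> complex"
  assumes v: "\<And>x. norm (v x) \<le> w x" and h: "\<bar>h\<bar> \<le> r" and k: "\<bar>k\<bar> \<le> r"
    and S: "((\<lambda>x. v x * of_real (u x * (a0 + h) ^ N x * (b0 + k) ^ J x)) has_sum S) UNIV"
  shows "((\<lambda>ij. (\<Sum>\<^sub>\<infinity>x. v x * of_real (tc2 ij x)) * of_real (mon h k ij)) has_sum S) UNIV"
  by (rule has_sum_SigmaD[OF joint_has_sum[OF assms]])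
     (use has_sum_cmult_left[OF coeff_has_sum[of v, OF v]] in \<open>simp add: mult.assoc\<close>)

end

section \<open>Criteria for joint analyticity\<close>

lemma filterlim_squares:
  "filterlim (\<lambda>n::nat. {..n} \<times> {..n}) (finite_subsets_at_top UNIV) sequentially"
  unfolding filterlim_finite_subsets_at_top
proof safe
  fix X :: "(nat \<times> nat) set" assume X: "finite X"
  define M where "M = Max (insert 0 (fst ` X \<union> snd ` X))"
  have "x \<in> {..n} \<times> {..n}" if "n \<ge> M" "x \<in> X" for x n
  proof -
    have "fst x \<le> M" "snd x \<le> M" unfolding M_def using X that(2) by (auto intro!: Max_ge)
    thus ?thesis using that(1) by (cases x) auto
  qed
  thus "\<forall>\<^sub>F n in sequentially. finite ({..n} \<times> {..n}) \<and> X \<subseteq> {..n} \<times> {..n} \<and> {..n} \<times> {..n} \<subseteq> UNIV"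
    unfolding eventually_sequentially by blast
qed

lemma real_analytic2_power_series:
  fixes u :: "'x \<Rightarrow> real"
  assumes u: "(\<lambda>x. \<bar>u x\<bar> * s ^ N x * s ^ J x) summable_on UNIV" and c: "0 < c" "c < s"
    and f: "\<And>a b. \<bar>a\<bar> < s \<Longrightarrow> \<bar>b\<bar> < s \<Longrightarrow> ((\<lambda>x. u x * a ^ N x * b ^ J x) has_sum f a b) UNIV"
  shows "real_analytic2_on ({-c<..<c} \<times> {-c<..<c}) f"
  unfolding real_analytic2_on_def
proof safe
  fix a0 b0 assume ab: "a0 \<in> {-c<..<c}" "b0 \<in> {-c<..<c}"
  \<comment> \<open>One radius serves every centre, since both coordinates of the centre are below
    \<open>c\<close> in modulus.\<close>
  define r where "r = s - c"
  interpret reexpansion u N J "\<lambda>_. 1" s s a0 b0 r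
    by unfold_locales (use ab c u in \<open>auto simp: r_def\<close>)
  define C where "C i j = (\<Sum>\<^sub>\<infinity>x. tc2 (i, j) x)" for i j
  have C: "(\<Sum>\<^sub>\<infinity>x. 1 * complex_of_real (tc2 ij x)) = of_real (C (fst ij) (snd ij))" for ij
  proof (rule infsumI)
    have "(\<lambda>x. tc2 ij x) summable_on UNIV"
      using coeff_summable[of ij] by (subst summable_on_iff_abs_summable_on_real) simp
    thus "((\<lambda>x. 1 * complex_of_real (tc2 ij x)) has_sum of_real (C (fst ij) (snd ij))) UNIV"
      unfolding C_def by (auto intro!: has_sum_of_real has_sum_infsum)
  qed
  show "\<exists>r>0. \<exists>c. \<forall>x y. \<bar>x - a0\<bar> < r \<and> \<bar>y - b0\<bar> < r \<longrightarrow>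
      ((\<lambda>(i, j). c i j * (x - a0) ^ i * (y - b0) ^ j) has_sum f x y) UNIV"
  proof (rule exI[of _ r], intro conjI exI[of _ C] allI impI)
    fix a b assume h: "\<bar>a - a0\<bar> < r \<and> \<bar>b - b0\<bar> < r"
    hence "\<bar>a\<bar> < s" "\<bar>b\<bar> < s" using r(2,3) by linarith+
    from has_sum_of_real[OF f[OF this], where ?'a = complex]
    have "((\<lambda>ij. (\<Sum>\<^sub>\<infinity>x. 1 * complex_of_real (tc2 ij x)) * of_real (mon (a - a0) (b - b0) ij)) has_sum
        of_real (f a b)) UNIV"
      by (intro expansion_has_sum) (use h in auto)
    hence "((\<lambda>ij. complex_of_real (C (fst ij) (snd ij) * mon (a - a0) (b - b0) ij)) has_sum of_real (f a b)) UNIV"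
      unfolding C by simp
    thus "((\<lambda>(i, j). C i j * (a - a0) ^ i * (b - b0) ^ j) has_sum f a b) UNIV"
      by (subst (asm) has_sum_of_real_iff) (simp add: mon_def case_prod_unfold mult.assoc)
  qed (use c in \<open>simp add: r_def\<close>)
qed

lemma Hs_norm_nonneg: "Hs_norm s f \<ge> 0"
  unfolding Hs_norm_def by (auto intro!: infsum_nonneg)

text \<open>The involution \<tau> reverses the frequency and preserves all other data. Each Taylor
  coefficient is a priori a complex trigonometric series; reindexing by \<tau> shows that it equals
  its conjugate, hence is a real function of z.\<close>

lemma Hs_analytic2_power_series:
  fixes u :: "'x \<Rightarrow> real" and lam :: "'x \<Rightarrow> int"
  assumes \<sigma>: "\<sigma> \<ge> 0"
    and u: "(\<lambda>x. hs_weight \<sigma> (lam x) * \<bar>u x\<bar> * s ^ N x * s ^ J x) summable_on UNIV"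
    and c: "0 < c" "c < s"
    and f: "\<And>a b z. \<bar>a\<bar> < s \<Longrightarrow> \<bar>b\<bar> < s \<Longrightarrow>
       ((\<lambda>x. cis (of_int (lam x) * z) * of_real (u x * a ^ N x * b ^ J x)) has_sum of_real (f a b z)) UNIV"
    and \<tau>: "\<And>x. \<tau> (\<tau> x) = x"
      "\<And>x. u (\<tau> x) = u x" "\<And>x. N (\<tau> x) = N x" "\<And>x. J (\<tau> x) = J x" "\<And>x. lam (\<tau> x) = - lam x"
  shows "Hs_analytic2_on \<sigma> ({-c<..<c} \<times> {-c<..<c}) f"
proof -
  have inHs: "in_Hs \<sigma> (f a b)" if ab: "\<bar>a\<bar> < s" "\<bar>b\<bar> < s" for a b
  proof (rule trig_series_in_Hs(1)[OF \<sigma>])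
    show "((\<lambda>x. of_real (u x * a ^ N x * b ^ J x) * cis (of_int (lam x) * z)) has_sum of_real (f a b z)) UNIV" for z
      using f[OF ab, of z] by (simp add: mult_ac)
    show "(\<lambda>x. hs_weight \<sigma> (lam x) * \<bar>u x * a ^ N x * b ^ J x\<bar>) summable_on UNIV"
    proof (rule summable_on_comparison_test[OF u])
      fix x
      have "\<bar>a\<bar> ^ N x * \<bar>b\<bar> ^ J x \<le> s ^ N x * s ^ J x"
        using ab by (intro mult_mono power_mono) auto
      hence "hs_weight \<sigma> (lam x) * \<bar>u x\<bar> * (\<bar>a\<bar> ^ N x * \<bar>b\<bar> ^ J x) \<le> hs_weight \<sigma> (lam x) * \<bar>u x\<bar> * (s ^ N x * s ^ J x)"
        using hs_weight_pos[of \<sigma> "lam x"] by (intro mult_left_mono) auto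
      thus "hs_weight \<sigma> (lam x) * \<bar>u x * a ^ N x * b ^ J x\<bar> \<le> hs_weight \<sigma> (lam x) * \<bar>u x\<bar> * s ^ N x * s ^ J x"
        by (simp add: abs_mult power_abs mult.assoc)
    qed (use hs_weight_pos[of \<sigma>] in \<open>auto simp: less_imp_le\<close>)
  qed
  show ?thesis
    unfolding Hs_analytic2_on_def
  proof (intro conjI ballI, safe)
    fix a b assume "a \<in> {-c<..<c}" "b \<in> {-c<..<c}"
    thus "in_Hs \<sigma> (f a b)" using c by (intro inHs) auto
  next
    fix a0 b0 assume ab: "a0 \<in> {-c<..<c}" "b0 \<in> {-c<..<c}"
    define r where "r = s - c"
    interpret reexpansion u N J "\<lambda>x. hs_weight \<sigma> (lam x)" s s a0 b0 r
      by unfold_locales (use ab c u hs_weight_ge_1[OF \<sigma>] in \<open>auto simp: r_def\<close>)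
    define v where "v z x = cis (of_int (lam x) * z)" for z x
    have v: "norm (v z x) \<le> hs_weight \<sigma> (lam x)" for z x
      using hs_weight_ge_1[OF \<sigma>] by (simp add: v_def)
    define C where "C ij z = Re (\<Sum>\<^sub>\<infinity>x. v z x * of_real (tc2 ij x))" for ij z
    have tc2_\<tau>: "tc2 ij (\<tau> x) = tc2 ij x" for ij x by (simp add: tc2_def \<tau>)
    have C_eq: "(\<Sum>\<^sub>\<infinity>x. v z x * of_real (tc2 ij x)) = of_real (C ij z)" for ij z
    proof -
      have "cnj (\<Sum>\<^sub>\<infinity>x. v z x * of_real (tc2 ij x)) = (\<Sum>\<^sub>\<infinity>x. cnj (v z x * of_real (tc2 ij x)))"
        by (rule infsum_cnj[symmetric])
      also have "\<dots> = (\<Sum>\<^sub>\<infinity>x. v z x * of_real (tc2 ij x))"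
        by (rule infsum_reindex_bij_witness[of _ \<tau> \<tau>]) (auto simp: \<tau> tc2_\<tau> v_def cis_cnj)
      finally show ?thesis
        unfolding C_def by (metis Reals_cnj_iff of_real_Re)
    qed
    have C: "((\<lambda>x. of_real (tc2 ij x) * cis (of_int (lam x) * z)) has_sum of_real (C ij z)) UNIV" for ij z
      using coeff_has_sum[of "v z" ij, OF v] unfolding C_eq by (simp add: v_def mult.commute)
    note C_Hs = trig_series_in_Hs[OF \<sigma> C coeff_summable]
    show "\<exists>r>0. \<exists>C. (\<forall>i j. in_Hs \<sigma> (C i j)) \<and>
      (\<forall>a b. \<bar>a - a0\<bar> < r \<and> \<bar>b - b0\<bar> < r \<longrightarrow>
        (\<lambda>(i, j). Hs_norm \<sigma> (C i j) * \<bar>a - a0\<bar> ^ i * \<bar>b - b0\<bar> ^ j) summable_on UNIV \<and>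
        (\<lambda>M. Hs_norm \<sigma> (\<lambda>z. f a b z - (\<Sum>(i, j)\<in>{..M} \<times> {..M}. C i j z * (a - a0) ^ i * (b - b0) ^ j))) \<longlonglongrightarrow> 0)"
    proof (rule exI[of _ r], intro conjI exI[of _ "\<lambda>i j. C (i, j)"] allI impI)
      fix a b assume h: "\<bar>a - a0\<bar> < r \<and> \<bar>b - b0\<bar> < r"
      hence h': "\<bar>a - a0\<bar> \<le> r" "\<bar>b - b0\<bar> \<le> r" and ab: "\<bar>a\<bar> < s" "\<bar>b\<bar> < s" using r(2,3) by linarith+
      define m where "m = mon (a - a0) (b - b0)"
      define G where "G = (\<lambda>(ij, x). hs_weight \<sigma> (lam x) * \<bar>tc2 ij x * m ij\<bar>)"
      define E where "E ij = (\<Sum>\<^sub>\<infinity>x. hs_weight \<sigma> (lam x) * \<bar>tc2 ij x\<bar>) * \<bar>m ij\<bar>" for ij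
      have G: "G summable_on UNIV \<times> UNIV" unfolding G_def m_def by (rule joint_summable[OF h'])
      have GE: "((\<lambda>x. G (ij, x)) has_sum E ij) UNIV" for ij
        using has_sum_cmult_left[OF has_sum_infsum[OF coeff_summable[of ij]], of "\<bar>m ij\<bar>"]
        by (simp add: G_def E_def abs_mult mult.assoc)
      have E: "(E has_sum infsum G (UNIV \<times> UNIV)) UNIV"
        by (rule has_sum_SigmaD[OF has_sum_infsum[OF G] GE])
      show "(\<lambda>(i, j). Hs_norm \<sigma> (C (i, j)) * \<bar>a - a0\<bar> ^ i * \<bar>b - b0\<bar> ^ j) summable_on UNIV"
      proof (rule summable_on_comparison_test[OF has_sum_imp_summable[OF E]], safe)
        fix i j
        have "Hs_norm \<sigma> (C (i, j)) * \<bar>m (i, j)\<bar> \<le> E (i, j)"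
          unfolding E_def by (intro mult_right_mono C_Hs) auto
        thus "Hs_norm \<sigma> (C (i, j)) * \<bar>a - a0\<bar> ^ i * \<bar>b - b0\<bar> ^ j \<le> E (i, j)"
          by (simp add: m_def mon_def abs_mult power_abs mult.assoc)
      qed (auto intro!: Hs_norm_nonneg mult_nonneg_nonneg)
      define sq where "sq M = ({..M} \<times> {..M} :: (nat \<times> nat) set)" for M
      \<comment> \<open>The remainder is again a trigonometric series, indexed by the pairs whose
        Taylor index lies outside the square, so its norm is at most the tail of
        \<open>G\<close>.\<close>
      have le: "Hs_norm \<sigma> (\<lambda>z. f a b z - (\<Sum>(i, j)\<in>sq M. C (i, j) z * (a - a0) ^ i * (b - b0) ^ j))
          \<le> infsum G (UNIV \<times> UNIV) - sum E (sq M)" for M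
      proof -
        have fin: "finite (sq M)" by (simp add: sq_def)
        have diff: "UNIV \<times> UNIV - sq M \<times> (UNIV :: 'x set) = (- sq M) \<times> UNIV" by auto
        have "(G has_sum (sum E (sq M))) (sq M \<times> UNIV)"
          by (rule has_sum_SigmaI[OF GE has_sum_finite[OF fin]])
             (rule summable_on_subset_banach[OF G], auto)
        from has_sum_Diff[OF has_sum_infsum[OF G] this]
        have rest: "(G has_sum (infsum G (UNIV \<times> UNIV) - sum E (sq M))) ((- sq M) \<times> UNIV)"
          unfolding diff by auto
        define P where "P z = (\<lambda>(ij, x). v z x * of_real (tc2 ij x * m ij))" for z
        have P: "(P z has_sum of_real (f a b z)) (UNIV \<times> UNIV)" for z
          unfolding P_def m_def
          by (rule joint_has_sum[OF v h']) (use f[OF ab, of z] in \<open>simp add: v_def\<close>)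
        have "(P z has_sum of_real (\<Sum>ij\<in>sq M. C ij z * m ij)) (sq M \<times> UNIV)" for z
        proof (rule has_sum_SigmaI)
          show "((\<lambda>x. P z (ij, x)) has_sum of_real (C ij z * m ij)) UNIV" for ij
            using has_sum_cmult_left[OF C[of ij z], of "of_real (m ij)"] by (simp add: P_def v_def mult_ac)
          show "((\<lambda>ij. complex_of_real (C ij z * m ij)) has_sum of_real (\<Sum>ij\<in>sq M. C ij z * m ij)) (sq M)"
            unfolding of_real_sum by (rule has_sum_finite[OF fin])
          show "P z summable_on sq M \<times> UNIV"
            by (rule summable_on_subset_banach[OF has_sum_imp_summable[OF P]]) auto
        qed
        from has_sum_Diff[OF P this]
        have "(P z has_sum of_real (f a b z - (\<Sum>(i, j)\<in>sq M. C (i, j) z * (a - a0) ^ i * (b - b0) ^ j)))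
            ((- sq M) \<times> UNIV)" for z
          unfolding diff by (simp add: m_def mon_def case_prod_unfold mult.assoc)
        hence "((\<lambda>y. of_real (tc2 (fst y) (snd y) * m (fst y)) * cis (of_int (lam (snd y)) * z)) has_sum
            of_real (f a b z - (\<Sum>(i, j)\<in>sq M. C (i, j) z * (a - a0) ^ i * (b - b0) ^ j)))
            ((- sq M) \<times> UNIV)" for z
          by (simp add: P_def v_def case_prod_unfold mult_ac)
        from trig_series_in_Hs(2)[OF \<sigma> this]
        show ?thesis
          using rest by (simp add: G_def case_prod_unfold has_sum_iff)
      qed
      \<comment> \<open>The squares eventually contain every finite index set, so the unconditional
        sum is also the limit along squares.\<close>
      have "(\<lambda>M. sum E (sq M)) \<longlonglongrightarrow> infsum G (UNIV \<times> UNIV)"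
        unfolding sq_def by (rule filterlim_compose[OF E[unfolded has_sum_def] filterlim_squares])
      hence "(\<lambda>M. infsum G (UNIV \<times> UNIV) - sum E (sq M)) \<longlonglongrightarrow> infsum G (UNIV \<times> UNIV) - infsum G (UNIV \<times> UNIV)"
        by (intro tendsto_intros)
      hence lim: "(\<lambda>M. infsum G (UNIV \<times> UNIV) - sum E (sq M)) \<longlonglongrightarrow> 0" by simp
      show "(\<lambda>M. Hs_norm \<sigma> (\<lambda>z. f a b z - (\<Sum>(i, j)\<in>{..M} \<times> {..M}. C (i, j) z * (a - a0) ^ i * (b - b0) ^ j))) \<longlonglongrightarrow> 0"
      proof (rule tendsto_sandwich[OF _ _ tendsto_const lim])
        show "\<forall>\<^sub>F M in sequentially. Hs_norm \<sigma> (\<lambda>z. f a b z -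
            (\<Sum>(i, j)\<in>{..M} \<times> {..M}. C (i, j) z * (a - a0) ^ i * (b - b0) ^ j))
            \<le> infsum G (UNIV \<times> UNIV) - sum E (sq M)"
          using le unfolding sq_def by (intro always_eventually allI)
      qed (intro always_eventually allI Hs_norm_nonneg)
    qed (use c C_Hs in \<open>auto simp: r_def\<close>)
  qed
qed

subsection \<open>Evaluation of the fixed point\<close>

lemma has_sum_diff:
  fixes f g :: "'a \<Rightarrow> 'b::real_normed_vector"
  assumes "(f has_sum a) A" "(g has_sum b) A"
  shows "((\<lambda>x. f x - g x) has_sum (a - b)) A"
proof -
  have "((\<lambda>x. - g x) has_sum - b) A"
    using assms(2) by (simp add: has_sum_uminus)
  from has_sum_add[OF assms(1) this] show ?thesis by simp
qed

lemma ev_cong: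
  assumes "\<And>i. coef g i \<noteq> 0 \<Longrightarrow> \<psi> i = \<psi>' i"
  shows "ev \<psi> g = ev \<psi>' g"
  unfolding ev_def by (rule infsum_cong) (use assms in force)

lemma character_norm: "character \<psi> \<Longrightarrow> norm (\<psi> i) \<le> 1"
  unfolding character_def by blast

text \<open>The threshold is the critical point of q^(p+1) - q; to its right the derivative is
  positive, so the value b is attained at most once.\<close>

lemma Qb_eqI:
  assumes p: "p \<ge> 1" and q: "q > (1 / (p + 1)) powr (1 / p)" "q powr (p + 1) - q = b"
  shows "Qb p b = q"
proof -
  define \<theta> where "\<theta> = (1 / (p + 1)) powr (1 / p)"
  have \<theta>: "\<theta> > 0" using p by (simp add: \<theta>_def)
  have incr: "x powr (p + 1) - x < y powr (p + 1) - y" if xy: "\<theta> < x" "x < y" for x y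
  proof (rule DERIV_pos_imp_increasing[OF xy(2)])
    fix t assume "x \<le> t" "t \<le> y"
    hence t: "t > \<theta>" using xy by simp
    have "1 = (p + 1) * \<theta> powr p" using p by (simp add: \<theta>_def powr_powr)
    also have "\<dots> < (p + 1) * t powr p"
      using p t \<theta> by (intro mult_strict_left_mono powr_less_mono2) auto
    finally have "(p + 1) * t powr p - 1 > 0" by simp
    moreover have "((\<lambda>x. x powr (p + 1) - x) has_real_derivative ((p + 1) * t powr p - 1)) (at t)"
      using t \<theta> by (auto intro!: derivative_eq_intros)
    ultimately show "\<exists>D. ((\<lambda>x. x powr (p + 1) - x) has_real_derivative D) (at t) \<and> 0 < D" by blast
  qed
  show ?thesis
    unfolding Qb_def \<theta>_def[symmetric]
  proof (rule the_equality)
    fix q' assume "\<theta> < q' \<and> q' powr (p + 1) - q' = b"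
    thus "q' = q" using incr[of q q'] incr[of q' q] q unfolding \<theta>_def[symmetric]
      by (cases q q' rule: linorder_cases) auto
  qed (use q in \<open>simp add: \<theta>_def\<close>)
qed

lemma threshold_less_1: "p \<ge> 1 \<Longrightarrow> (1 / (p + 1)) powr (1 / p) < (1 :: real)"
  using powr_less_mono2[of "1 / p" "1 / (p + 1)" 1] by simp

lemma Qb_0: "p \<ge> 1 \<Longrightarrow> Qb p 0 = 1"
  by (rule Qb_eqI) (auto simp: threshold_less_1)

section \<open>Gradings of monomials and evaluation at (a, b, z)\<close>

definition deg :: "idx \<Rightarrow> nat" where "deg i = fst i + fst (snd i)"
definition bdeg :: "idx \<Rightarrow> nat" where "bdeg i = snd (snd i)"

lemma deg_simps [simp]: "deg (n, m, j) = n + m" "deg (i + i') = deg i + deg i'" "deg (swap3 i) = deg i" "deg 0 = 0"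
  "bdeg (n, m, j) = j" "bdeg (i + i') = bdeg i + bdeg i'" "bdeg (swap3 i) = bdeg i" "bdeg 0 = 0"
  by (auto simp: deg_def bdeg_def swap3_def)

text \<open>Every unit of frequency costs a power of a. Smoothness in z, the Sobolev bounds and the
  decay of the Fourier coefficients all rest on this.\<close>

lemma mode_le_deg: "nat \<bar>mode i\<bar> \<le> deg i"
  by (auto simp: mode_def deg_def)

text \<open>Links parity in a to parity of the frequency, since n + m and n - m differ by an even
  number.\<close>

lemma even_deg_iff: "even (deg i) \<longleftrightarrow> even (mode i)"
  by (simp add: mode_def deg_def)

lemma mode_0 [simp]: "mode 0 = 0"
  by (simp add: mode_def)

text \<open>Substitution of the point (x e^(iz), x e^(-iz), y) of the polydisc.\<close>

definition rot :: "real \<Rightarrow> real \<Rightarrow> real \<Rightarrow> idx \<Rightarrow> complex" where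
  "rot x y z i = cis (of_int (mode i) * z) * of_real (x ^ deg i * y ^ bdeg i)"

lemma character_rot:
  assumes "\<bar>x\<bar> \<le> 1" "\<bar>y\<bar> \<le> 1"
  shows "character (rot x y z)"
  unfolding character_def
proof (intro conjI allI)
  show "rot x y z (i + j) = rot x y z i * rot x y z j" for i j
    by (simp add: rot_def power_add distrib_right flip: cis_mult)
  have "\<bar>x\<bar> ^ n * \<bar>y\<bar> ^ m \<le> 1 * 1" for n m
    using assms by (intro mult_mono power_le_one) auto
  thus "norm (rot x y z i) \<le> 1" for i
    by (simp add: rot_def norm_mult norm_power)
qed (simp add: rot_def)

text \<open>The Sobolev weight grows polynomially in the frequency, hence in the degree at most, so
  shrinking the radius by 3/4 pays for it.\<close>

lemma hs_weight_bound:
  obtains B where "B > 0" "\<And>i. hs_weight s (mode i) * (3/4) ^ deg i \<le> B"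
proof -
  have "(\<lambda>n::nat. (1 + (real n)\<^sup>2) powr (s / 2) * (3/4) ^ n) \<longlonglongrightarrow> 0"
    by real_asymp
  hence "Bseq (\<lambda>n::nat. (1 + (real n)\<^sup>2) powr (s / 2) * (3/4) ^ n)"
    by (intro convergent_imp_Bseq convergentI)
  then obtain B where B: "B > 0" "\<And>n::nat. norm ((1 + (real n)\<^sup>2) powr (s / 2) * (3/4) ^ n) \<le> B"
    by (auto elim: BseqE)
  have "hs_weight s (mode i) * (3/4) ^ deg i \<le> B" for i
  proof -
    define n where "n = nat \<bar>mode i\<bar>"
    have n: "(real n)\<^sup>2 = (real_of_int (mode i))\<^sup>2" by (simp add: n_def)
    have "hs_weight s (mode i) * (3/4) ^ deg i \<le> hs_weight s (mode i) * (3/4) ^ n"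
      using hs_weight_pos[of s "mode i"] mode_le_deg[of i]
      by (intro mult_left_mono power_decreasing) (auto simp: n_def)
    also have "\<dots> \<le> B"
      using B(2)[of n] by (simp add: hs_weight_def n)
    finally show ?thesis .
  qed
  with B(1) show ?thesis by (rule that)
qed

lemma cnj_rot: "cnj (rot x y z i) = rot x y z (swap3 i)" "cnj (rot x y z i) = rot x y (- z) i"
  by (simp_all add: rot_def cis_cnj)

lemma ev_cnj: "ev (\<lambda>i. cnj (\<psi> i)) g = cnj (ev \<psi> g)"
  unfolding ev_def by (simp flip: infsum_cnj)

lemma coef_swap3:
  assumes "pull swap3 g = g"
  shows "coef g (swap3 i) = coef g i"
  using arg_cong[OF assms, of "\<lambda>h. coef h i"] by (simp add: coef_pull[OF bij_is_inj[OF bij_swap3]])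

text \<open>Conjugation of \<open>rot\<close> amounts both to swapping the index and to reflecting
  z. For swap-invariant g the first description shows that the value is real, and the second then
  shows that it is even in z.\<close>

lemma ev_rot_sym:
  assumes g: "pull swap3 g = g"
  shows "ev (rot x y z) g = of_real (Re (ev (rot x y z) g))"
    and "ev (rot x y (- z)) g = ev (rot x y z) g"
proof -
  have "cnj (ev (rot x y z) g) = (\<Sum>\<^sub>\<infinity>i. rot x y z (swap3 i) * of_real (coef g i))"
    unfolding ev_cnj[symmetric] cnj_rot(1) by (simp add: ev_def)
  also have "\<dots> = ev (rot x y z) g"
    unfolding ev_def
    by (rule infsum_reindex_bij_witness[of _ swap3 swap3]) (auto simp: coef_swap3[OF g])
  finally have *: "cnj (ev (rot x y z) g) = ev (rot x y z) g" .
  thus "ev (rot x y z) g = of_real (Re (ev (rot x y z) g))"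
    by (metis Reals_cnj_iff of_real_Re)
  show "ev (rot x y (- z)) g = ev (rot x y z) g"
    using * unfolding ev_cnj[symmetric] cnj_rot(2) .
qed

text \<open>The character \<open>slope_char w y\<close> is evaluation at \<open>(w, 0, y)\<close>; its derivative at \<open>w = 0\<close>
  picks out the coefficients of the first power of the first variable.\<close>

definition slope_char :: "real \<Rightarrow> real \<Rightarrow> idx \<Rightarrow> complex" where
  "slope_char w y i = of_real (w ^ fst i * 0 ^ fst (snd i) * y ^ bdeg i)"

definition slope_coeff :: "real \<Rightarrow> idx \<Rightarrow> complex" where
  "slope_coeff y i = of_real ((if fst i = 1 \<and> fst (snd i) = 0 then 1 else 0) * y ^ bdeg i)"

lemma character_slope:
  assumes "\<bar>w\<bar> \<le> 1" "\<bar>y\<bar> \<le> 1"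
  shows "character (slope_char w y)"
  unfolding character_def
proof (intro conjI allI)
  show "slope_char w y (i + j) = slope_char w y i * slope_char w y j" for i j
    by (simp add: slope_char_def power_add)
  have "\<bar>w\<bar> ^ n * 0 ^ m * \<bar>y\<bar> ^ j \<le> 1 * 1 * 1" for n m j
    using assms by (intro mult_mono power_le_one) auto
  thus "norm (slope_char w y i) \<le> 1" for i
    by (simp add: slope_char_def norm_mult norm_power)
qed (simp add: slope_char_def)

lemma norm_slope_coeff: "\<bar>y\<bar> \<le> 1 \<Longrightarrow> norm (slope_coeff y i) \<le> 1"
  by (simp add: slope_coeff_def norm_mult norm_power power_le_one)

text \<open>With \<open>0 ^ 0 = 1\<close>, the difference from the linearisation vanishes exactly
  for the monomials containing the second variable and for those of order 0 or 1 in the first; the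
  others contribute at most w^2 times their coefficient.\<close>

lemma slope_derivative:
  assumes y: "\<bar>y\<bar> \<le> 1"
  shows "((\<lambda>w. Re (ev (slope_char w y) g)) has_real_derivative Re (ev (slope_coeff y) g)) (at 0)"
proof -
  have bound: "norm (ev (slope_char w y) g - ev (slope_char 0 y) g - of_real w * ev (slope_coeff y) g) \<le> w\<^sup>2 * norm g"
    if w: "\<bar>w\<bar> \<le> 1" for w
  proof -
    have w': "norm (slope_char w y i) \<le> 1" "norm (slope_char 0 y i) \<le> 1" for i
      by (rule character_norm[OF character_slope]; use w y in simp)+
    have hs: "((\<lambda>i. slope_char w y i * of_real (coef g i) - slope_char 0 y i * of_real (coef g i)
          - of_real w * (slope_coeff y i * of_real (coef g i))) has_sum
        (ev (slope_char w y) g - ev (slope_char 0 y) g - of_real w * ev (slope_coeff y) g)) UNIV"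
      by (intro has_sum_diff has_sum_cmult_right ev_has_sum w' norm_slope_coeff[OF y])
    have le: "norm (slope_char w y i * of_real (coef g i) - slope_char 0 y i * of_real (coef g i)
          - of_real w * (slope_coeff y i * of_real (coef g i))) \<le> w\<^sup>2 * \<bar>coef g i\<bar>" for i
    proof -
      obtain n m j where i: "i = (n, m, j)" by (cases i)
      have "\<bar>w ^ n * 0 ^ m * y ^ j - 0 ^ n * 0 ^ m * y ^ j - w * ((if n = 1 \<and> m = 0 then 1 else 0) * y ^ j)\<bar> \<le> w\<^sup>2"
      proof (cases "m = 0 \<and> n \<ge> 2")
        case True
        then obtain l where l: "n = l + 2" by (metis le_add_diff_inverse2)
        have "\<bar>w\<bar> ^ l * \<bar>y\<bar> ^ j \<le> 1 * 1" using w y by (intro mult_mono power_le_one) auto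
        hence "w\<^sup>2 * (\<bar>w\<bar> ^ l * \<bar>y\<bar> ^ j) \<le> w\<^sup>2 * 1" by (intro mult_left_mono) auto
        thus ?thesis using True by (simp add: l power_add abs_mult power_abs mult_ac power2_eq_square)
      next
        case False
        then consider "m > 0" | "m = 0" "n = 0" | "m = 0" "n = 1" by linarith
        thus ?thesis by cases (auto simp: power_0_left)
      qed
      hence "norm (complex_of_real (w ^ n * 0 ^ m * y ^ j - 0 ^ n * 0 ^ m * y ^ j
            - w * ((if n = 1 \<and> m = 0 then 1 else 0) * y ^ j)) * of_real (coef g i)) \<le> w\<^sup>2 * \<bar>coef g i\<bar>"
        unfolding norm_mult norm_of_real by (intro mult_right_mono) auto
      thus ?thesis by (simp add: slope_char_def slope_coeff_def i algebra_simps)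
    qed
    have "(\<lambda>i. w\<^sup>2 * \<bar>coef g i\<bar>) summable_on UNIV"
      by (intro summable_on_cmult_right coef_abs_summable)
    from norm_infsum_le[OF hs has_sum_infsum[OF this] le]
    show ?thesis unfolding norm_l1_eq by (simp add: infsum_cmult_right')
  qed
  have "((\<lambda>w. (Re (ev (slope_char w y) g) - Re (ev (slope_char 0 y) g)) / (w - 0) - Re (ev (slope_coeff y) g))
      \<longlongrightarrow> 0) (at 0)"
  proof (rule Lim_null_comparison)
    show "((\<lambda>w. \<bar>w\<bar> * norm g) \<longlongrightarrow> 0) (at 0)"
      by (auto intro!: tendsto_eq_intros)
    have "norm ((Re (ev (slope_char w y) g) - Re (ev (slope_char 0 y) g)) / (w - 0) - Re (ev (slope_coeff y) g)) \<le> \<bar>w\<bar> * norm g"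
      if w: "w \<noteq> 0" "\<bar>w\<bar> \<le> 1" for w
    proof -
      have "\<bar>Re (ev (slope_char w y) g - ev (slope_char 0 y) g - of_real w * ev (slope_coeff y) g)\<bar> \<le> w\<^sup>2 * norm g"
        by (rule order_trans[OF abs_Re_le_cmod bound[OF w(2)]])
      hence "\<bar>Re (ev (slope_char w y) g) - Re (ev (slope_char 0 y) g) - w * Re (ev (slope_coeff y) g)\<bar> / \<bar>w\<bar>
          \<le> (w\<^sup>2 * norm g) / \<bar>w\<bar>"
        by (intro divide_right_mono) auto
      also have "(w\<^sup>2 * norm g) / \<bar>w\<bar> = \<bar>w\<bar> * norm g"
        using w by (simp add: power2_eq_square field_simps)
      finally show ?thesis
        using w by (simp add: abs_divide[symmetric] diff_divide_distrib)
    qed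
    thus "\<forall>\<^sub>F w in at 0. norm ((Re (ev (slope_char w y) g) - Re (ev (slope_char 0 y) g)) / (w - 0)
        - Re (ev (slope_coeff y) g)) \<le> \<bar>w\<bar> * norm g"
      unfolding eventually_at by (intro exI[of _ 1]) (auto simp: dist_real_def)
  qed
  thus ?thesis
    unfolding has_field_derivative_iff by (rule LIM_zero_cancel)
qed

section \<open>The fixed point as a function of a, b and z\<close>

locale wave_solution = wave +
  fixes \<rho> :: real and h :: "idx l1"
  assumes \<rho>: "\<rho> > 0" and sym: "pull swap3 h = h" and fixed: "step \<rho> h = h"
    and small: "\<rho> * norm (prof h) \<le> 1/2" "\<rho> * norm (disp \<rho> h) \<le> 1/2"
    and thr: "\<rho> * norm (prof h) < 1 - (1 / (p + 1)) powr (1 / p)"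
begin

definition wprof :: "idx l1" where "wprof = 1 + \<rho> *\<^sub>R prof h"

definition kpow :: "idx l1" where "kpow = p *\<^sub>R 1 + \<rho> *\<^sub>R disp \<rho> h"

text \<open>The binomial series of p^(1/\<alpha>) (1 + (\<rho>/p)
  \<open>disp \<rho> h\<close>)^(1/\<alpha>). Taking the root of \<open>kpow\<close> inside the
  algebra exhibits k itself, not only its power, as a power series in a and b.\<close>

definition wnum :: "idx l1" where
  "wnum = p powr (1 / \<alpha>) *\<^sub>R psum (\<lambda>k. (1 / \<alpha>) gchoose k) ((\<rho> / p) *\<^sub>R disp \<rho> h)"

definition evr :: "idx l1 \<Rightarrow> real \<Rightarrow> real \<Rightarrow> real \<Rightarrow> real" where
  "evr g a b z = Re (ev (rot (a / \<rho>) (b / \<rho>) z) g)"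

text \<open>Coefficients in the original parameters a and b, with the scaling by \<rho>
  undone.\<close>

definition uc :: "idx l1 \<Rightarrow> idx \<Rightarrow> real" where
  "uc g i = coef g i / \<rho> ^ (deg i + bdeg i)"

lemma char_rot: "\<bar>a\<bar> \<le> \<rho> \<Longrightarrow> \<bar>b\<bar> \<le> \<rho> \<Longrightarrow> character (rot (a / \<rho>) (b / \<rho>) z)"
  using \<rho> by (intro character_rot) auto

lemmas rot_le = character_norm[OF char_rot]

lemma rot_uc: "rot (a / \<rho>) (b / \<rho>) z i * of_real (coef g i)
    = cis (of_int (mode i) * z) * of_real (uc g i * a ^ deg i * b ^ bdeg i)"
  by (simp add: rot_def uc_def power_divide power_add)

lemma sym_prof: "pull swap3 (prof h) = prof h" and sym_lap: "pull swap3 (lap h) = lap h"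
  and sym_disp: "pull swap3 (disp \<rho> h) = disp \<rho> h"
proof -
  note lin = bounded_linear.linear[OF bounded_linear_pull[OF bij_is_inj[OF bij_swap3]]]
  show "pull swap3 (prof h) = prof h" "pull swap3 (lap h) = lap h"
    by (rule pull_swap_prof[OF sym] pull_swap_lap[OF sym])+
  show "pull swap3 (disp \<rho> h) = disp \<rho> h"
    by (simp add: disp_def linear_scale[OF lin] pull_swap_diag)
qed

lemma sym_wprof: "pull swap3 wprof = wprof"
proof -
  note lin = bounded_linear.linear[OF bounded_linear_pull[OF bij_is_inj[OF bij_swap3]]]
  show ?thesis
    by (simp add: wprof_def linear_add[OF lin] linear_scale[OF lin] sym_prof pull_one[OF bij_swap3])
qed

lemma ev_evr:
  assumes "pull swap3 g = g"
  shows "ev (rot (a / \<rho>) (b / \<rho>) z) g = of_real (evr g a b z)"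
  unfolding evr_def by (rule ev_rot_sym(1)[OF assms])

lemma evr_has_sum:
  assumes "pull swap3 g = g" "\<bar>a\<bar> \<le> \<rho>" "\<bar>b\<bar> \<le> \<rho>"
  shows "((\<lambda>i. cis (of_int (mode i) * z) * of_real (uc g i * a ^ deg i * b ^ bdeg i)) has_sum
           of_real (evr g a b z)) UNIV"
  using ev_has_sum[of "rot (a / \<rho>) (b / \<rho>) z" g, OF rot_le[OF assms(2,3)]]
  unfolding ev_evr[OF assms(1)] rot_uc .

lemma evr_le: "\<bar>a\<bar> \<le> \<rho> \<Longrightarrow> \<bar>b\<bar> \<le> \<rho> \<Longrightarrow> \<bar>evr g a b z\<bar> \<le> norm g"
  unfolding evr_def by (rule order_trans[OF abs_Re_le_cmod norm_ev_le[OF rot_le]])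

lemma disp_radial: "mode i \<noteq> 0 \<Longrightarrow> coef (disp \<rho> h) i = 0"
  by (simp add: disp_def coef_diag)

lemma evr_disp_phase: "evr (disp \<rho> h) a b z = evr (disp \<rho> h) a b 0"
  unfolding evr_def
proof (intro arg_cong[where f = Re] ev_cong)
  fix i assume "coef (disp \<rho> h) i \<noteq> 0"
  hence "mode i = 0" using disp_radial[of i] by blast
  thus "rot (a / \<rho>) (b / \<rho>) z i = rot (a / \<rho>) (b / \<rho>) 0 i"
    by (simp add: rot_def)
qed

lemma evr_disp_even: "evr (disp \<rho> h) (- a) b 0 = evr (disp \<rho> h) a b 0"
  unfolding evr_def
proof (intro arg_cong[where f = Re] ev_cong)
  fix i assume "coef (disp \<rho> h) i \<noteq> 0"
  hence "mode i = 0" using disp_radial[of i] by blast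
  hence "even (deg i)" by (simp add: even_deg_iff)
  thus "rot (- a / \<rho>) (b / \<rho>) 0 i = rot (a / \<rho>) (b / \<rho>) 0 i"
    by (simp add: rot_def power_divide)
qed

text \<open>Norms bound values at every point with |a|, |b| \<le> \<rho>, so the smallness
  assumptions become pointwise: \<open>thr\<close> keeps the profile above the critical point of
  q^(p+1) - q, and the bound 1/2 on \<mu> keeps p + \<mu> positive.\<close>

lemma
  assumes ab: "\<bar>a\<bar> \<le> \<rho>" "\<bar>b\<bar> \<le> \<rho>"
  shows evr_wprof: "evr wprof a b z = 1 + \<rho> * evr (prof h) a b z"
    and evr_kpow: "evr kpow a b z = p + \<rho> * evr (disp \<rho> h) a b z"
    and evr_wprof_pos: "evr wprof a b z > (1 / (p + 1)) powr (1 / p)"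
    and evr_kpow_pos: "evr kpow a b z > 0"
    and evr_wnum: "evr wnum a b 0 = evr kpow a b 0 powr (1 / \<alpha>)"
proof -
  note c = char_rot[OF ab, of z]
  note lin = bounded_linear.linear[OF bounded_linear_ev[of "rot (a / \<rho>) (b / \<rho>) z", OF rot_le[OF ab]]]
  show P: "evr wprof a b z = 1 + \<rho> * evr (prof h) a b z"
    by (simp add: evr_def wprof_def linear_add[OF lin] linear_scale[OF lin] ev_one[OF c])
  show K: "evr kpow a b z = p + \<rho> * evr (disp \<rho> h) a b z" for z
  proof -
    note lin = bounded_linear.linear[OF bounded_linear_ev[of "rot (a / \<rho>) (b / \<rho>) z", OF rot_le[OF ab]]]
    show ?thesis
      by (simp add: evr_def kpow_def linear_add[OF lin] linear_scale[OF lin] ev_one[OF char_rot[OF ab]])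
  qed
  have bd: "\<bar>\<rho> * evr g a b z\<bar> \<le> \<rho> * norm g" for g z
    using \<rho> evr_le[OF ab, of g z] by (simp add: abs_mult)
  show "evr wprof a b z > (1 / (p + 1)) powr (1 / p)"
    unfolding P using bd[of "prof h" z] thr by linarith
  show "evr kpow a b z > 0" unfolding K using bd[of "disp \<rho> h" z] small p by linarith
  define d where "d = \<rho> / p * evr (disp \<rho> h) a b 0"
  note c0 = char_rot[OF ab, of 0]
  note bl = bounded_linear_ev[of "rot (a / \<rho>) (b / \<rho>) 0", OF rot_le[OF ab]]
  have nd: "norm ((\<rho> / p) *\<^sub>R disp \<rho> h) \<le> 1/2"
  proof -
    have "\<rho> * norm (disp \<rho> h) / p \<le> (1/2) / 1"
      using small p \<rho> by (intro frac_le) auto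
    thus ?thesis using \<rho> p by simp
  qed
  have d: "\<bar>d\<bar> \<le> 1/2"
    using order_trans[OF order_trans[OF abs_Re_le_cmod norm_ev_le[of "rot (a / \<rho>) (b / \<rho>) 0", OF rot_le[OF ab]]] nd]
    by (simp add: d_def evr_def linear_scale[OF bounded_linear.linear[OF bl]])
  have "ev (rot (a / \<rho>) (b / \<rho>) 0) (psum (\<lambda>k. (1 / \<alpha>) gchoose k) ((\<rho> / p) *\<^sub>R disp \<rho> h))
      = psum (\<lambda>k. (1 / \<alpha>) gchoose k) (ev (rot (a / \<rho>) (b / \<rho>) 0) ((\<rho> / p) *\<^sub>R disp \<rho> h))"
    by (rule psum_hom[OF bl ev_times[OF c0] ev_one[OF c0] gbinomial_summable(1) nd])
  also have "ev (rot (a / \<rho>) (b / \<rho>) 0) ((\<rho> / p) *\<^sub>R disp \<rho> h) = of_real d"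
    by (simp add: linear_scale[OF bounded_linear.linear[OF bl]] ev_evr[OF sym_disp] d_def scaleR_conv_of_real[where 'a = complex])
  \<comment> \<open>A second passage through a homomorphism, the embedding of the reals: the closed
    form by \<open>powr\<close> is needed at a real argument.\<close>
  also have "psum (\<lambda>k. (1 / \<alpha>) gchoose k) (complex_of_real d) = of_real (psum (\<lambda>k. (1 / \<alpha>) gchoose k) d)"
    by (rule psum_hom[symmetric, OF bounded_linear_of_real _ _ gbinomial_summable(1)])
       (use d in simp_all)
  also have "psum (\<lambda>k. (1 / \<alpha>) gchoose k) d = (1 + d) powr (1 / \<alpha>)"
    by (rule psum_gbinomial) (use d in linarith)
  finally have "evr wnum a b 0 = p powr (1 / \<alpha>) * (1 + d) powr (1 / \<alpha>)"
    by (simp add: evr_def wnum_def linear_scale[OF bounded_linear.linear[OF bl]])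
  also have "\<dots> = (p * (1 + d)) powr (1 / \<alpha>)"
    using p d by (simp add: powr_mult)
  also have "p * (1 + d) = evr kpow a b 0"
    using p by (simp add: K d_def field_simps)
  finally show "evr wnum a b 0 = evr kpow a b 0 powr (1 / \<alpha>)" .
qed

lemma nonl_real:
  assumes "\<bar>\<rho> * x\<bar> < 1"
  shows "nonl \<rho> x = ((1 + \<rho> * x) powr (p + 1) - 1 - (p + 1) * (\<rho> * x)) / \<rho>\<^sup>2"
  using psum_rest_coeff[OF assms, of "p + 1"] by (simp add: nonl_def)

lemma ev_nonl:
  assumes \<psi>: "character \<psi>" and x: "ev \<psi> (prof h) = of_real x"
  shows "ev \<psi> (nonl \<rho> (prof h)) = of_real (nonl \<rho> x)"
proof -
  have "norm (complex_of_real x) \<le> norm (prof h)"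
    unfolding x[symmetric] by (rule norm_ev_le[OF character_norm[OF \<psi>]])
  hence x': "\<bar>x\<bar> \<le> norm (prof h)" by simp
  have x2: "\<rho> * \<bar>x\<bar> \<le> 1/2" using mult_left_mono[OF x', of \<rho>] \<rho> small by linarith
  have "ev \<psi> (nonl \<rho> (prof h)) = nonl \<rho> (ev \<psi> (prof h))"
    by (rule nonl_hom[OF bounded_linear_ev[of \<psi>, OF character_norm[OF \<psi>]] ev_times[OF \<psi>] ev_one[OF \<psi>] \<rho> small(1)])
  also have "\<dots> = of_real (nonl \<rho> x)"
    unfolding x by (rule nonl_hom[symmetric, OF bounded_linear_of_real]) (use \<rho> x2 in auto)
  finally show ?thesis .
qed

text \<open>Evaluating \<open>fixed_point_eq\<close> at a character and multiplying by \<rho> gives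
  the equation for f and \<mu>. The linear term (p + 1) f inside N(f) then recombines with p f,
  which undoes the splitting P = 1 + f, k^\<alpha> = p + \<mu>.\<close>

lemma profile_equation:
  assumes ab: "\<bar>a\<bar> \<le> \<rho>" "\<bar>b\<bar> \<le> \<rho>"
  shows "- (evr kpow a b 0 * (\<rho> * evr (lap h) a b z)) - evr wprof a b z + evr wprof a b z powr (p + 1) = b"
proof -
  define F A M where "F = evr (prof h) a b z" and "A = evr (lap h) a b z" and "M = evr (disp \<rho> h) a b 0"
  note c = char_rot[OF ab, of z]
  note lin = bounded_linear.linear[OF bounded_linear_ev[of "rot (a / \<rho>) (b / \<rho>) z", OF rot_le[OF ab]]]
  have "\<bar>F\<bar> \<le> norm (prof h)" unfolding F_def by (rule evr_le[OF ab])
  from mult_left_mono[OF this, of \<rho>] have "\<bar>\<rho> * F\<bar> < 1"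
    using \<rho> small(1) unfolding abs_mult abs_of_pos[OF \<rho>] by linarith
  note N = nonl_real[OF this]
  have "ev (rot (a / \<rho>) (b / \<rho>) z) (p *\<^sub>R (prof h - lap h)) = ev (rot (a / \<rho>) (b / \<rho>) z) (step \<rho> h)"
    by (simp add: fixed_point_eq[OF sym fixed] fixed)
  hence "of_real (p * (F - A)) = complex_of_real (b / \<rho> + \<rho> * (M * A - nonl \<rho> F))"
    unfolding step_def
    by (simp add: linear_add[OF lin] linear_scale[OF lin] linear_diff[OF lin] ev_times[OF c]
        ev_nonl[OF c ev_evr[OF sym_prof]] ev_evr[OF sym_prof] ev_evr[OF sym_lap] ev_evr[OF sym_disp]
        evr_disp_phase[of a b z] F_def A_def M_def bvar_def ev_single rot_def scaleR_conv_of_real[where 'a = complex])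
  hence "p * (F - A) = b / \<rho> + \<rho> * (M * A - nonl \<rho> F)"
    by (simp only: of_real_eq_iff)
  hence "\<rho> * (p * (F - A)) = \<rho> * (b / \<rho> + \<rho> * (M * A - nonl \<rho> F))" by simp
  hence "p * (\<rho> * F) - p * (\<rho> * A) = b + \<rho> * M * (\<rho> * A) - \<rho>\<^sup>2 * nonl \<rho> F"
    using \<rho> by (simp add: algebra_simps power2_eq_square)
  also have "\<rho>\<^sup>2 * nonl \<rho> F = (1 + \<rho> * F) powr (p + 1) - 1 - (p + 1) * (\<rho> * F)"
    using \<rho> by (simp add: N)
  finally show ?thesis
    by (simp add: evr_wprof[OF ab] evr_kpow[OF ab] F_def A_def M_def algebra_simps)
qed

text \<open>At a = 0 only pure powers of t survive. They have frequency zero, where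
  \<Lambda>^\<alpha> vanishes, so the profile is a constant solution; lying above the threshold, it
  must be the selected one.\<close>

lemma Qb_eq:
  assumes b: "\<bar>b\<bar> \<le> \<rho>"
  shows "evr wprof 0 b z = Qb p b"
proof -
  have ab: "\<bar>0 :: real\<bar> \<le> \<rho>" using \<rho> by simp
  have "ev (rot (0 / \<rho>) (b / \<rho>) z) (lap h) = ev (\<lambda>_. 0) (lap h)"
  proof (rule ev_cong)
    fix i assume i: "coef (lap h) i \<noteq> 0"
    have "deg i \<noteq> 0"
    proof
      assume "deg i = 0"
      hence "fst i = 0" "fst (snd i) = 0" by (auto simp: deg_def)
      hence "coef (lap h) i = 0"
        by (cases i) (auto simp: lap_def coef_lap lap_mult_def coef_cos1 delta_def)
      with i show False by simp
    qed
    thus "rot (0 / \<rho>) (b / \<rho>) z i = 0" by (simp add: rot_def power_0_left)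
  qed
  hence "evr (lap h) 0 b z = 0" by (simp add: evr_def ev_def)
  hence "evr wprof 0 b z powr (p + 1) - evr wprof 0 b z = b"
    using profile_equation[OF ab b, of z] by simp
  from Qb_eqI[OF p evr_wprof_pos[OF ab b] this] show ?thesis by simp
qed

text \<open>By construction \<mu> at a = 0 is determined by the part of N(f) that is linear in x and
  free of y. Setting y = 0 and keeping x real, f becomes a real function with value Q_b - 1 and
  slope \<rho>/2 at the origin, so the chain rule gives that part as N'(Q_b - 1) \<rho>/2, where
  N'(Q_b - 1) = (p + 1)(Q_b^p - 1).\<close>

lemma kstar_eq:
  assumes b: "\<bar>b\<bar> \<le> \<rho>"
  shows "evr kpow 0 b z = kstar p b"
proof -
  define y where "y = b / \<rho>"
  have y: "\<bar>y\<bar> \<le> 1" using b \<rho> by (simp add: y_def)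
  have r0: "\<bar>0 :: real\<bar> \<le> \<rho>" using \<rho> by simp
  define \<phi> where "\<phi> w = Re (ev (slope_char w y) (prof h))" for w
  have rot0: "rot (0 / \<rho>) (b / \<rho>) z = slope_char 0 y" for z
    by (rule ext) (auto simp: rot_def slope_char_def y_def deg_def power_0_left mode_def)
  have \<phi>0: "\<rho> * \<phi> 0 = Qb p b - 1"
    using evr_wprof[OF r0 b, of 0] Qb_eq[OF b, of 0] by (simp add: \<phi>_def evr_def rot0[simplified])
  have Q0: "Qb p b > 0"
    using evr_wprof_pos[OF r0 b, of 0] unfolding Qb_eq[OF b]
    by (rule le_less_trans[rotated]) simp
  have ev_slope_real: "ev (slope_char w y) (prof h) = of_real (\<phi> w)" if "\<bar>w\<bar> \<le> 1" for w
  proof -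
    have "(\<lambda>i. cnj (slope_char w y i)) = slope_char w y" by (rule ext) (simp add: slope_char_def)
    hence "cnj (ev (slope_char w y) (prof h)) = ev (slope_char w y) (prof h)"
      by (metis ev_cnj)
    thus ?thesis unfolding \<phi>_def by (metis Reals_cnj_iff of_real_Re)
  qed
  have d\<phi>: "(\<phi> has_real_derivative (1/2)) (at 0)"
  proof -
    \<comment> \<open>All monomials x t^j have frequency one, where \<open>inv_mult\<close>
      vanishes, so only \<open>cos1\<close> contributes.\<close>
    have e: "ev (slope_coeff y) (prof h) = 1/2"
    proof -
      have "ev (slope_coeff y) (prof h) = (\<Sum>\<^sub>\<infinity>i\<in>{(1, 0, 0)}. slope_coeff y i * of_real (coef (prof h) i))"
        unfolding ev_def
        by (rule infsum_cong_neutral)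
           (auto simp: slope_coeff_def prof_def coef_inv inv_mult_def coef_cos1 delta_def)
      thus ?thesis
        by (simp add: slope_coeff_def prof_def coef_inv inv_mult_def coef_cos1 delta_def)
    qed
    show ?thesis using slope_derivative[OF y, of "prof h", unfolded e] by (simp add: \<phi>_def[abs_def])
  qed
  have \<phi>_small: "\<bar>\<rho> * \<phi> w\<bar> < 1" if "\<bar>w\<bar> \<le> 1" for w
  proof -
    have "\<bar>\<phi> w\<bar> \<le> norm (prof h)"
      unfolding \<phi>_def
      by (rule order_trans[OF abs_Re_le_cmod norm_ev_le[OF character_norm[OF character_slope[OF that y]]]])
    from mult_left_mono[OF this, of \<rho>] show ?thesis
      using \<rho> small(1) unfolding abs_mult abs_of_pos[OF \<rho>] by linarith
  qed
  have "((\<lambda>w. Re (ev (slope_char w y) (nonl \<rho> (prof h)))) has_real_derivative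
      ((p + 1) * Qb p b powr p * (\<rho> / 2) - (p + 1) * (\<rho> / 2)) / \<rho>\<^sup>2) (at 0)"
  proof (rule has_field_derivative_transform_within[where d = 1])
    have pos: "1 + \<rho> * \<phi> 0 > 0" using \<phi>_small[of 0] by (simp add: abs_if split: if_splits)
    have "((\<lambda>w. ((1 + \<rho> * \<phi> w) powr (p + 1) - 1 - (p + 1) * (\<rho> * \<phi> w)) / \<rho>\<^sup>2) has_real_derivative
        ((p + 1) * (1 + \<rho> * \<phi> 0) powr p * (\<rho> * (1/2)) - (p + 1) * (\<rho> * (1/2))) / \<rho>\<^sup>2) (at 0)"
      by (rule DERIV_cdivide) (use pos in \<open>auto intro!: derivative_eq_intros d\<phi>\<close>)
    thus "((\<lambda>w. ((1 + \<rho> * \<phi> w) powr (p + 1) - 1 - (p + 1) * (\<rho> * \<phi> w)) / \<rho>\<^sup>2) has_real_derivative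
        ((p + 1) * Qb p b powr p * (\<rho> / 2) - (p + 1) * (\<rho> / 2)) / \<rho>\<^sup>2) (at 0)"
      by (simp add: \<phi>0)
    fix w :: real assume "dist w 0 < 1"
    hence w: "\<bar>w\<bar> \<le> 1" by simp
    show "((1 + \<rho> * \<phi> w) powr (p + 1) - 1 - (p + 1) * (\<rho> * \<phi> w)) / \<rho>\<^sup>2 = Re (ev (slope_char w y) (nonl \<rho> (prof h)))"
      using ev_nonl[OF character_slope[OF w y] ev_slope_real[OF w]] nonl_real[OF \<phi>_small[OF w]] by simp
  qed auto
  note slope_eq = DERIV_unique[OF this slope_derivative[OF y]]
  have "((p + 1) * X * (\<rho> / 2) - (p + 1) * (\<rho> / 2)) / \<rho>\<^sup>2 = (p + 1) * (X - 1) / (2 * \<rho>)" for X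
    using \<rho> by (simp add: field_simps power2_eq_square)
  from slope_eq[unfolded this]
  have slope: "Re (ev (slope_coeff y) (nonl \<rho> (prof h))) = (p + 1) * (Qb p b powr p - 1) / (2 * \<rho>)"
    by simp
  \<comment> \<open>At a = 0 only the pure powers t^j of \<open>disp\<close> remain, and
    \<open>diag\<close> takes these from the monomials x t^j of the nonlinearity.\<close>
  have "ev (slope_char 0 y) (disp \<rho> h) = 2 * ev (slope_coeff y) (nonl \<rho> (prof h))"
  proof -
    have "ev (slope_char 0 y) (disp \<rho> h) =
        (\<Sum>\<^sub>\<infinity>i\<in>{i. fst i = 0 \<and> fst (snd i) = 0}. of_real (y ^ bdeg i) * of_real (2 * coef (nonl \<rho> (prof h)) (shift3 i)))"
      unfolding ev_def
      by (rule infsum_cong_neutral)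
         (auto simp: slope_char_def disp_def coef_diag mode_def power_0_left)
    also have "\<dots> = (\<Sum>\<^sub>\<infinity>i\<in>{i. fst i = 1 \<and> fst (snd i) = 0}. 2 * (slope_coeff y i * of_real (coef (nonl \<rho> (prof h)) i)))"
      by (rule infsum_reindex_bij_witness[of _ "\<lambda>i. (0, snd i)" shift3])
         (auto simp: shift3_def slope_coeff_def bdeg_def)
    also have "\<dots> = (\<Sum>\<^sub>\<infinity>i. 2 * (slope_coeff y i * of_real (coef (nonl \<rho> (prof h)) i)))"
      by (rule infsum_cong_neutral) (auto simp: slope_coeff_def)
    also have "\<dots> = 2 * ev (slope_coeff y) (nonl \<rho> (prof h))"
      by (simp add: ev_def infsum_cmult_right')
    finally show ?thesis .
  qed
  hence "evr (disp \<rho> h) 0 b z = (p + 1) * (Qb p b powr p - 1) / \<rho>"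
    using \<rho> unfolding evr_def rot0 by (simp add: slope)
  hence "\<rho> * evr (disp \<rho> h) 0 b z = (p + 1) * (Qb p b powr p - 1)"
    using \<rho> by simp
  thus ?thesis
    unfolding evr_kpow[OF r0 b] kstar_def by (simp add: algebra_simps)
qed

end

subsection \<open>The family of waves\<close>

context wave_solution
begin

definition wave :: "real \<Rightarrow> real \<Rightarrow> real \<Rightarrow> real" where "wave a b z = evr wprof a b z"
definition wavenumber :: "real \<Rightarrow> real \<Rightarrow> real" where "wavenumber a b = evr wnum a b 0"

abbreviation amp :: "idx l1 \<Rightarrow> real \<Rightarrow> real \<Rightarrow> idx \<Rightarrow> real" where
  "amp g a b i \<equiv> uc g i * a ^ deg i * b ^ bdeg i"

lemma abs_amp: "\<bar>amp g a b i\<bar> = \<bar>coef g i\<bar> * ((\<bar>a\<bar> / \<rho>) ^ deg i * (\<bar>b\<bar> / \<rho>) ^ bdeg i)"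
  using \<rho> by (simp add: uc_def abs_mult power_abs power_divide power_add)

lemma abs_amp_le:
  assumes ab: "\<bar>a\<bar> \<le> \<rho>" "\<bar>b\<bar> \<le> \<rho>"
  shows "\<bar>amp g a b i\<bar> \<le> \<bar>coef g i\<bar> * (\<bar>a\<bar> / \<rho>) ^ deg i"
    and "\<bar>amp g a b i\<bar> \<le> \<bar>coef g i\<bar>"
proof -
  have "(\<bar>b\<bar> / \<rho>) ^ bdeg i \<le> 1" "(\<bar>a\<bar> / \<rho>) ^ deg i \<le> 1"
    using ab \<rho> by (auto intro!: power_le_one)
  hence "(\<bar>a\<bar> / \<rho>) ^ deg i * (\<bar>b\<bar> / \<rho>) ^ bdeg i \<le> (\<bar>a\<bar> / \<rho>) ^ deg i * 1"
    "(\<bar>a\<bar> / \<rho>) ^ deg i \<le> 1"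
    using \<rho> by (auto intro!: mult_left_mono simp del: mult_1_right)
  thus "\<bar>amp g a b i\<bar> \<le> \<bar>coef g i\<bar> * (\<bar>a\<bar> / \<rho>) ^ deg i" "\<bar>amp g a b i\<bar> \<le> \<bar>coef g i\<bar>"
    unfolding abs_amp
    using mult_left_mono[of _ _ "\<bar>coef g i\<bar>"] mult_left_mono[of _ 1 "\<bar>coef g i\<bar>"]
    by (auto intro: order_trans)
qed

lemma amp_summable: "\<bar>a\<bar> \<le> \<rho> \<Longrightarrow> \<bar>b\<bar> \<le> \<rho> \<Longrightarrow> (\<lambda>i. \<bar>amp g a b i\<bar>) summable_on UNIV"
  by (rule summable_on_comparison_test[OF coef_abs_summable[of g]]) (auto intro: abs_amp_le)

lemma wave_has_sum:
  assumes ab: "\<bar>a\<bar> \<le> \<rho>" "\<bar>b\<bar> \<le> \<rho>"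
  shows "((\<lambda>i. of_real (amp wprof a b i) * cis (of_int (mode i) * z)) has_sum of_real (wave a b z)) UNIV"
  using evr_has_sum[OF sym_wprof ab, of z] by (simp add: wave_def mult.commute)

lemma wave_even: "wave a b (- z) = wave a b z"
  unfolding wave_def evr_def by (simp add: ev_rot_sym(2)[OF sym_wprof])

lemma wave_periodic:
  assumes ab: "\<bar>a\<bar> \<le> \<rho>" "\<bar>b\<bar> \<le> \<rho>"
  shows "wave a b (z + 2 * pi) = wave a b z"
  by (rule trig_series_periodic[OF wave_has_sum[OF ab]])

text \<open>Staying at half the radius yields a factor (1/2)^deg, which absorbs the growth 2^|mode|
  required for holomorphy on the disc of radius 2.\<close>

lemma wave_smooth:
  assumes ab: "\<bar>a\<bar> \<le> \<rho> / 2" "\<bar>b\<bar> \<le> \<rho>"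
  shows "smooth_fun (wave a b)"
proof (rule trig_series_smooth[where R = 2])
  have ab': "\<bar>a\<bar> \<le> \<rho>" using ab \<rho> by linarith
  show "((\<lambda>i. of_real (amp wprof a b i) * cis (of_int (mode i) * z)) has_sum of_real (wave a b z)) UNIV" for z
    by (rule wave_has_sum[OF ab' ab(2)])
  show "(\<lambda>i. \<bar>amp wprof a b i\<bar> * 2 ^ nat \<bar>mode i\<bar>) summable_on UNIV"
  proof (rule summable_on_comparison_test[OF coef_abs_summable[of wprof]])
    fix i
    have "\<bar>amp wprof a b i\<bar> * 2 ^ nat \<bar>mode i\<bar> \<le> \<bar>coef wprof i\<bar> * (\<bar>a\<bar> / \<rho>) ^ deg i * 2 ^ deg i"
      by (intro mult_mono abs_amp_le ab ab' power_increasing mode_le_deg) (use \<rho> in auto)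
    also have "\<dots> \<le> \<bar>coef wprof i\<bar> * (1/2) ^ deg i * 2 ^ deg i"
      using ab \<rho> by (intro mult_right_mono mult_left_mono power_mono) (auto simp: field_simps)
    also have "\<dots> = \<bar>coef wprof i\<bar>" by (simp flip: power_mult_distrib add: mult.assoc)
    finally show "\<bar>amp wprof a b i\<bar> * 2 ^ nat \<bar>mode i\<bar> \<le> \<bar>coef wprof i\<bar>" .
  qed auto
qed simp

lemma wavenumber_eq: "\<bar>a\<bar> \<le> \<rho> \<Longrightarrow> \<bar>b\<bar> \<le> \<rho> \<Longrightarrow> wavenumber a b = evr kpow a b 0 powr (1 / \<alpha>)"
  unfolding wavenumber_def by (rule evr_wnum)

lemma wavenumber_pos: "\<bar>a\<bar> \<le> \<rho> \<Longrightarrow> \<bar>b\<bar> \<le> \<rho> \<Longrightarrow> wavenumber a b > 0"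
  using evr_kpow_pos[of a b 0] by (simp add: wavenumber_eq)

lemma wavenumber_powr: "\<bar>a\<bar> \<le> \<rho> \<Longrightarrow> \<bar>b\<bar> \<le> \<rho> \<Longrightarrow> wavenumber a b powr \<alpha> = evr kpow a b 0"
  using evr_kpow_pos[of a b 0] \<alpha> by (simp add: wavenumber_eq powr_powr)

lemma wavenumber_even: "\<bar>a\<bar> \<le> \<rho> \<Longrightarrow> \<bar>b\<bar> \<le> \<rho> \<Longrightarrow> wavenumber (- a) b = wavenumber a b"
  by (simp add: wavenumber_eq evr_kpow evr_disp_even)

text \<open>The constant 1 drops out because \<open>0 powr \<alpha> = 0\<close>, and
  \<open>cos1\<close> is unaffected because its frequencies have modulus one.\<close>

lemma lap_coef: "\<bar>real_of_int (mode i)\<bar> powr \<alpha> * coef wprof i = \<rho> * coef (lap h) i"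
proof -
  have c: "\<bar>real_of_int (mode i)\<bar> powr \<alpha> * coef cos1 i = coef cos1 i"
    by (cases i) (auto simp: coef_cos1 delta_def)
  have z: "\<bar>real_of_int (mode i)\<bar> powr \<alpha> * coef 1 i = 0"
    by (auto simp: coef_one delta_def mode_def zero_prod_def)
  have "\<bar>real_of_int (mode i)\<bar> powr \<alpha> * coef wprof i = \<bar>real_of_int (mode i)\<bar> powr \<alpha> * coef 1 i
      + \<rho> * (\<bar>real_of_int (mode i)\<bar> powr \<alpha> * coef cos1 i + lap_mult i * coef h i)"
    by (simp add: wprof_def prof_def coef_inv lap_mult_def algebra_simps)
  also have "\<dots> = \<rho> * coef (lap h) i"
    unfolding c z by (simp add: lap_def coef_lap)
  finally show ?thesis .
qed

text \<open>For the period 2 pi / k the multiplier at frequency l is k^\<alpha> |l|^\<alpha>, and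
  k^\<alpha> is the value of \<open>kpow\<close>. The sum over all monomials is known from
  \<open>lap h\<close>; grouping it by frequency produces the series of
  \<open>lam_term\<close>.\<close>

lemma frac_lap_wave:
  assumes ab: "\<bar>a\<bar> \<le> \<rho>" "\<bar>b\<bar> \<le> \<rho>"
  shows "(lam_term (2 * pi / wavenumber a b) \<alpha> (\<lambda>y. wave a b (wavenumber a b * y)) x has_sum
           of_real (evr kpow a b 0 * (\<rho> * evr (lap h) a b (wavenumber a b * x)))) UNIV"
proof -
  define k where "k = wavenumber a b"
  have k: "k > 0" unfolding k_def by (rule wavenumber_pos[OF ab])
  have phase: "2 * pi / (2 * pi / k) * of_int l * y = of_int l * (k * y)" for l y
    using k by simp
  have ser: "((\<lambda>i. of_real (amp wprof a b i) * cis (2 * pi / (2 * pi / k) * of_int (mode i) * y)) has_sum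
      of_real (wave a b (k * y))) UNIV" for y
    unfolding phase by (rule wave_has_sum[OF ab])
  have fc: "((\<lambda>i. of_real (amp wprof a b i)) has_sum fcT (2 * pi / k) (\<lambda>y. wave a b (k * y)) l)
      {i \<in> UNIV. mode i = l}" for l
    by (rule fcT_trig_series[OF _ ser amp_summable[OF ab]]) (use k in simp)
  have "((\<lambda>i. of_real (evr kpow a b 0 * \<rho>) * (cis (of_int (mode i) * (k * x)) * of_real (amp (lap h) a b i)))
      has_sum (of_real (evr kpow a b 0 * \<rho>) * of_real (evr (lap h) a b (k * x)))) UNIV"
    by (intro has_sum_cmult_right evr_has_sum[OF sym_lap ab])
  also have "(\<lambda>i. of_real (evr kpow a b 0 * \<rho>) * (cis (of_int (mode i) * (k * x)) * of_real (amp (lap h) a b i)))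
      = (\<lambda>i. of_real (\<bar>2 * pi * of_int (mode i) / (2 * pi / k)\<bar> powr \<alpha>) * of_real (amp wprof a b i)
          * cis (2 * pi * of_int (mode i) * x / (2 * pi / k)))"
  proof (rule ext)
    fix i
    have "\<bar>2 * pi * of_int (mode i) / (2 * pi / k)\<bar> powr \<alpha> * coef wprof i
        = k powr \<alpha> * (\<bar>real_of_int (mode i)\<bar> powr \<alpha> * coef wprof i)"
      using k by (simp add: abs_mult powr_mult)
    also have "\<dots> = evr kpow a b 0 * \<rho> * coef (lap h) i"
      unfolding lap_coef k_def wavenumber_powr[OF ab] by simp
    finally have e: "evr kpow a b 0 * \<rho> * coef (lap h) i = \<bar>2 * pi * of_int (mode i) / (2 * pi / k)\<bar> powr \<alpha> * coef wprof i" ..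
    have "evr kpow a b 0 * \<rho> * amp (lap h) a b i = (evr kpow a b 0 * \<rho> * coef (lap h) i) / \<rho> ^ (deg i + bdeg i) * a ^ deg i * b ^ bdeg i"
      by (simp add: uc_def)
    also have "\<dots> = \<bar>2 * pi * of_int (mode i) / (2 * pi / k)\<bar> powr \<alpha> * amp wprof a b i"
      unfolding e by (simp add: uc_def)
    finally have e: "evr kpow a b 0 * \<rho> * amp (lap h) a b i = \<bar>2 * pi * of_int (mode i) / (2 * pi / k)\<bar> powr \<alpha> * amp wprof a b i" .
    have ph: "2 * pi * of_int (mode i) * x / (2 * pi / k) = of_int (mode i) * (k * x)"
      using k by simp
    have "of_real (evr kpow a b 0 * \<rho>) * (cis (of_int (mode i) * (k * x)) * of_real (amp (lap h) a b i))
        = complex_of_real (evr kpow a b 0 * \<rho> * amp (lap h) a b i) * cis (of_int (mode i) * (k * x))"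
      by (simp add: mult_ac)
    also have "\<dots> = of_real (\<bar>2 * pi * of_int (mode i) / (2 * pi / k)\<bar> powr \<alpha>) * of_real (amp wprof a b i)
          * cis (2 * pi * of_int (mode i) * x / (2 * pi / k))"
      unfolding e ph by simp
    finally show "of_real (evr kpow a b 0 * \<rho>) * (cis (of_int (mode i) * (k * x)) * of_real (amp (lap h) a b i))
        = of_real (\<bar>2 * pi * of_int (mode i) / (2 * pi / k)\<bar> powr \<alpha>) * of_real (amp wprof a b i)
          * cis (2 * pi * of_int (mode i) * x / (2 * pi / k))" .
  qed
  finally have tot: "((\<lambda>i. of_real (\<bar>2 * pi * of_int (mode i) / (2 * pi / k)\<bar> powr \<alpha>) * of_real (amp wprof a b i)
          * cis (2 * pi * of_int (mode i) * x / (2 * pi / k))) has_sum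
      of_real (evr kpow a b 0 * (\<rho> * evr (lap h) a b (k * x)))) UNIV"
    by (simp add: mult.assoc)
  have "(lam_term (2 * pi / k) \<alpha> (\<lambda>y. wave a b (k * y)) x has_sum
      of_real (evr kpow a b 0 * (\<rho> * evr (lap h) a b (k * x)))) UNIV"
  proof (rule has_sum_fibres[OF tot, of mode])
    fix l
    have "((\<lambda>i. of_real (\<bar>2 * pi * of_int l / (2 * pi / k)\<bar> powr \<alpha>) * of_real (amp wprof a b i)
          * cis (2 * pi * of_int l * x / (2 * pi / k))) has_sum lam_term (2 * pi / k) \<alpha> (\<lambda>y. wave a b (k * y)) x l)
        {i \<in> UNIV. mode i = l}"
      unfolding lam_term_def by (intro has_sum_cmult_left has_sum_cmult_right fc)
    thus "((\<lambda>i. of_real (\<bar>2 * pi * of_int (mode i) / (2 * pi / k)\<bar> powr \<alpha>) * of_real (amp wprof a b i)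
          * cis (2 * pi * of_int (mode i) * x / (2 * pi / k))) has_sum lam_term (2 * pi / k) \<alpha> (\<lambda>y. wave a b (k * y)) x l)
        {i \<in> UNIV. mode i = l}"
      by (subst has_sum_cong[where g = "\<lambda>i. of_real (\<bar>2 * pi * of_int l / (2 * pi / k)\<bar> powr \<alpha>) * of_real (amp wprof a b i)
          * cis (2 * pi * of_int l * x / (2 * pi / k))"]) auto
  qed
  thus ?thesis unfolding k_def .
qed

lemma wave_pos: "\<bar>a\<bar> \<le> \<rho> \<Longrightarrow> \<bar>b\<bar> \<le> \<rho> \<Longrightarrow> wave a b z > 0"
  unfolding wave_def by (rule le_less_trans[OF _ evr_wprof_pos]) auto

lemma wave_equation:
  assumes ab: "\<bar>a\<bar> \<le> \<rho>" "\<bar>b\<bar> \<le> \<rho>"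
  defines "k \<equiv> wavenumber a b"
  shows "lam_term (2 * pi / k) \<alpha> (\<lambda>y. wave a b (k * y)) x summable_on UNIV"
    and "- frac_lap (2 * pi / k) \<alpha> (\<lambda>y. wave a b (k * y)) x - complex_of_real (wave a b (k * x))
       + complex_of_real (wave a b (k * x) * ppow p (wave a b (k * x))) = complex_of_real b"
proof -
  show "lam_term (2 * pi / k) \<alpha> (\<lambda>y. wave a b (k * y)) x summable_on UNIV"
    unfolding k_def by (rule has_sum_imp_summable[OF frac_lap_wave[OF ab]])
  have fl: "frac_lap (2 * pi / k) \<alpha> (\<lambda>y. wave a b (k * y)) x = of_real (evr kpow a b 0 * (\<rho> * evr (lap h) a b (k * x)))"
    unfolding frac_lap_def k_def by (rule infsumI[OF frac_lap_wave[OF ab]])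
  have "wave a b (k * x) * ppow p (wave a b (k * x)) = wave a b (k * x) powr (p + 1)"
    using wave_pos[OF ab, of "k * x"] by (simp add: ppow_def powr_add mult.commute)
  hence "complex_of_real (- (evr kpow a b 0 * (\<rho> * evr (lap h) a b (k * x))) - wave a b (k * x)
      + wave a b (k * x) * ppow p (wave a b (k * x))) = of_real b"
    unfolding of_real_eq_iff using profile_equation[OF ab, of "k * x"] by (simp add: wave_def)
  thus "- frac_lap (2 * pi / k) \<alpha> (\<lambda>y. wave a b (k * y)) x - complex_of_real (wave a b (k * x))
       + complex_of_real (wave a b (k * x) * ppow p (wave a b (k * x))) = complex_of_real b"
    unfolding fl by simp
qed

section \<open>Analytic dependence on a and b\<close>

lemma wavenumber_analytic: "real_analytic2_on ({-(\<rho>/2)<..<\<rho>/2} \<times> {-(\<rho>/2)<..<\<rho>/2}) wavenumber"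
proof (rule real_analytic2_power_series[where s = \<rho>])
  show "(\<lambda>i. \<bar>uc wnum i\<bar> * \<rho> ^ deg i * \<rho> ^ bdeg i) summable_on UNIV"
    using coef_abs_summable[of wnum] \<rho> by (simp add: uc_def power_add)
  fix a b assume ab: "\<bar>a\<bar> < \<rho>" "\<bar>b\<bar> < \<rho>"
  have "((\<lambda>i. rot (a / \<rho>) (b / \<rho>) 0 i * of_real (coef wnum i)) has_sum ev (rot (a / \<rho>) (b / \<rho>) 0) wnum) UNIV"
    by (rule ev_has_sum[OF rot_le]) (use ab in auto)
  from has_sum_Re[OF this]
  show "((\<lambda>i. uc wnum i * a ^ deg i * b ^ bdeg i) has_sum wavenumber a b) UNIV"
    unfolding rot_uc by (simp add: wavenumber_def evr_def)
qed (use \<rho> in auto)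

text \<open>The radius 3/4 \<rho> lies above the half-width \<rho>/2, which leaves room for
  re-expansion at every centre, and below \<rho>, which pays for the Sobolev weight through
  \<open>hs_weight_bound\<close>.\<close>

lemma wave_analytic: "Hs_analytic2_on \<alpha> ({-(\<rho>/2)<..<\<rho>/2} \<times> {-(\<rho>/2)<..<\<rho>/2}) wave"
proof (rule Hs_analytic2_power_series[where s = "3/4 * \<rho>" and u = "uc wprof" and N = deg and J = bdeg
      and lam = mode and \<tau> = swap3])
  obtain B where B: "B > 0" "\<And>i. hs_weight \<alpha> (mode i) * (3/4) ^ deg i \<le> B"
    using hs_weight_bound[of \<alpha>] by blast
  show "(\<lambda>i. hs_weight \<alpha> (mode i) * \<bar>uc wprof i\<bar> * (3/4 * \<rho>) ^ deg i * (3/4 * \<rho>) ^ bdeg i) summable_on UNIV"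
  proof (rule summable_on_comparison_test[OF summable_on_cmult_right[OF coef_abs_summable, of B wprof]])
    fix i
    have "hs_weight \<alpha> (mode i) * \<bar>uc wprof i\<bar> * (3/4 * \<rho>) ^ deg i * (3/4 * \<rho>) ^ bdeg i
        = (hs_weight \<alpha> (mode i) * (3/4) ^ deg i) * (3/4) ^ bdeg i * \<bar>coef wprof i\<bar>"
      using \<rho> by (simp add: uc_def power_add power_mult_distrib power_divide)
    also have "\<dots> \<le> B * 1 * \<bar>coef wprof i\<bar>"
      using B hs_weight_pos[of \<alpha> "mode i"] by (intro mult_mono power_le_one) auto
    finally show "hs_weight \<alpha> (mode i) * \<bar>uc wprof i\<bar> * (3/4 * \<rho>) ^ deg i * (3/4 * \<rho>) ^ bdeg i \<le> B * \<bar>coef wprof i\<bar>"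
      by simp
    show "0 \<le> hs_weight \<alpha> (mode i) * \<bar>uc wprof i\<bar> * (3/4 * \<rho>) ^ deg i * (3/4 * \<rho>) ^ bdeg i"
      using hs_weight_pos[of \<alpha> "mode i"] \<rho> by simp
  qed
  fix a b z assume "\<bar>a\<bar> < 3/4 * \<rho>" "\<bar>b\<bar> < 3/4 * \<rho>"
  thus "((\<lambda>i. cis (of_int (mode i) * z) * of_real (uc wprof i * a ^ deg i * b ^ bdeg i)) has_sum of_real (wave a b z)) UNIV"
    unfolding wave_def using \<rho> by (intro evr_has_sum sym_wprof) auto
qed (use \<rho> \<alpha> in \<open>auto simp: uc_def coef_swap3[OF sym_wprof]\<close>)

section \<open>Fourier coefficients of the profile\<close>

lemma fc_wave:
  assumes ab: "\<bar>a\<bar> \<le> \<rho>" "\<bar>b\<bar> \<le> \<rho>"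
  shows "((\<lambda>i. complex_of_real (amp wprof a b i)) has_sum fc (wave a b) l) {i. mode i = l}"
proof -
  have "((\<lambda>i. of_real (amp wprof a b i) * cis (2 * pi / (2 * pi) * of_int (mode i) * z)) has_sum
      of_real (wave a b z)) UNIV" for z
    using wave_has_sum[OF ab, of z] by simp
  from fcT_trig_series[OF _ this amp_summable[OF ab], of l] show ?thesis
    by (simp add: fc_def)
qed

lemma fc_wave_Re:
  assumes ab: "\<bar>a\<bar> \<le> \<rho>" "\<bar>b\<bar> \<le> \<rho>"
  shows "(amp wprof a b has_sum Re (fc (wave a b) l)) {i. mode i = l}" and "Im (fc (wave a b) l) = 0"
proof -
  show "(amp wprof a b has_sum Re (fc (wave a b) l)) {i. mode i = l}"
    using has_sum_Re[OF fc_wave[OF ab, of l]] by simp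
  show "Im (fc (wave a b) l) = 0"
    using has_sum_unique[OF has_sum_Im[OF fc_wave[OF ab, of l]], of 0] by simp
qed

lemma fc_wave_parity:
  assumes ab: "\<bar>a\<bar> \<le> \<rho>" "\<bar>b\<bar> \<le> \<rho>"
  shows "fc (wave (- a) b) l = (if even l then fc (wave a b) l else - fc (wave a b) l)"
proof -
  have e: "((\<lambda>i. (if even l then 1 else -1) * complex_of_real (amp wprof a b i)) has_sum
      (if even l then 1 else -1) * fc (wave a b) l) {i. mode i = l}"
    by (intro has_sum_cmult_right fc_wave ab)
  have "fc (wave (- a) b) l = (if even l then 1 else -1) * fc (wave a b) l"
  proof (rule has_sum_unique[OF fc_wave])
    show "((\<lambda>i. complex_of_real (amp wprof (- a) b i)) has_sum
        (if even l then 1 else -1) * fc (wave a b) l) {i. mode i = l}"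
    proof (subst has_sum_cong[where g = "\<lambda>i. (if even l then 1 else -1) * complex_of_real (amp wprof a b i)"])
      fix i assume "i \<in> {i. mode i = l}"
      hence "even (deg i) \<longleftrightarrow> even l" by (simp add: even_deg_iff)
      thus "complex_of_real (amp wprof (- a) b i) = (if even l then 1 else -1) * complex_of_real (amp wprof a b i)"
        by (cases "even (deg i)") auto
    qed (rule e)
  qed (use ab in auto)
  thus ?thesis by simp
qed

lemma fc_wave_bound:
  assumes a: "\<bar>a\<bar> \<le> \<rho>"
  shows "\<bar>Re (fc (wave a 0) l)\<bar> \<le> norm wprof / \<rho> ^ nat \<bar>l\<bar> * \<bar>a\<bar> ^ nat \<bar>l\<bar>"
proof -
  have b: "\<bar>0 :: real\<bar> \<le> \<rho>" using \<rho> by simp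
  have le: "\<bar>amp wprof a 0 i\<bar> \<le> (\<bar>a\<bar> / \<rho>) ^ nat \<bar>l\<bar> * \<bar>coef wprof i\<bar>" if "mode i = l" for i
  proof -
    have "\<bar>amp wprof a 0 i\<bar> \<le> \<bar>coef wprof i\<bar> * (\<bar>a\<bar> / \<rho>) ^ deg i" by (rule abs_amp_le(1)[OF a b])
    also have "\<dots> \<le> \<bar>coef wprof i\<bar> * (\<bar>a\<bar> / \<rho>) ^ nat \<bar>l\<bar>"
      using mode_le_deg[of i] a \<rho> that by (intro mult_left_mono power_decreasing) auto
    finally show ?thesis by (simp add: mult.commute)
  qed
  have sm: "(\<lambda>i. (\<bar>a\<bar> / \<rho>) ^ nat \<bar>l\<bar> * \<bar>coef wprof i\<bar>) summable_on X" for X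
    by (intro summable_on_cmult_right summable_on_subset_banach[OF coef_abs_summable]) auto
  have "norm (Re (fc (wave a 0) l)) \<le> (\<Sum>\<^sub>\<infinity>i\<in>{i. mode i = l}. (\<bar>a\<bar> / \<rho>) ^ nat \<bar>l\<bar> * \<bar>coef wprof i\<bar>)"
    by (rule norm_infsum_le[OF fc_wave_Re(1)[OF a b] has_sum_infsum[OF sm]]) (use le in auto)
  also have "\<dots> \<le> (\<Sum>\<^sub>\<infinity>i. (\<bar>a\<bar> / \<rho>) ^ nat \<bar>l\<bar> * \<bar>coef wprof i\<bar>)"
    by (rule infsum_mono_neutral[OF sm sm]) (use \<rho> in auto)
  also have "\<dots> = (\<bar>a\<bar> / \<rho>) ^ nat \<bar>l\<bar> * norm wprof"
    unfolding norm_l1_eq by (rule infsum_cmult_right')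
  finally show ?thesis by (simp add: power_divide mult.commute)
qed

text \<open>The value at a = 0 is Q_0 = 1 and comes from degree zero alone. The other monomials of
  frequency zero have positive even degree, hence degree at least two.\<close>

lemma fc_wave_0_bound:
  assumes a: "\<bar>a\<bar> \<le> \<rho>"
  shows "\<bar>Re (fc (wave a 0) 0) - 1\<bar> \<le> norm wprof / \<rho>\<^sup>2 * a\<^sup>2"
proof -
  have b: "\<bar>0 :: real\<bar> \<le> \<rho>" using \<rho> by simp
  have "((\<lambda>i. cis (of_int (mode i) * 0) * of_real (amp wprof 0 0 i)) has_sum of_real (evr wprof 0 0 0)) UNIV"
    by (rule evr_has_sum[OF sym_wprof b b])
  hence "((\<lambda>i. complex_of_real (amp wprof 0 0 i)) has_sum of_real 1) UNIV"
    by (simp add: Qb_eq[OF b] Qb_0[OF p])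
  hence "((\<lambda>i. amp wprof 0 0 i) has_sum 1) UNIV" by (simp only: has_sum_of_real_iff)
  hence one: "((\<lambda>i. amp wprof 0 0 i) has_sum 1) {i. mode i = 0}"
    by (subst has_sum_cong_neutral[where T = UNIV and g = "amp wprof 0 0"])
       (auto simp: deg_def mode_def power_0_left)
  have le: "norm (amp wprof a 0 i - amp wprof 0 0 i) \<le> (\<bar>a\<bar> / \<rho>)\<^sup>2 * \<bar>coef wprof i\<bar>" if "mode i = 0" for i
  proof (cases "deg i = 0")
    case True
    thus ?thesis by simp
  next
    case False
    moreover have "even (deg i)" using that by (simp add: even_deg_iff)
    ultimately have d: "deg i \<ge> 2" by (metis One_nat_def even_Suc_Suc_iff less_2_cases not_less odd_one)
    have "\<bar>amp wprof a 0 i\<bar> \<le> \<bar>coef wprof i\<bar> * (\<bar>a\<bar> / \<rho>) ^ deg i" by (rule abs_amp_le(1)[OF a b])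
    also have "\<dots> \<le> \<bar>coef wprof i\<bar> * (\<bar>a\<bar> / \<rho>)\<^sup>2"
      using d a \<rho> by (intro mult_left_mono power_decreasing) auto
    finally show ?thesis using False by (simp add: mult.commute power_0_left)
  qed
  have sm: "(\<lambda>i. (\<bar>a\<bar> / \<rho>)\<^sup>2 * \<bar>coef wprof i\<bar>) summable_on X" for X
    by (intro summable_on_cmult_right summable_on_subset_banach[OF coef_abs_summable]) auto
  have "norm (Re (fc (wave a 0) 0) - 1) \<le> (\<Sum>\<^sub>\<infinity>i\<in>{i. mode i = 0}. (\<bar>a\<bar> / \<rho>)\<^sup>2 * \<bar>coef wprof i\<bar>)"
    by (rule norm_infsum_le[OF has_sum_diff[OF fc_wave_Re(1)[OF a b] one] has_sum_infsum[OF sm]])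
       (use le in auto)
  also have "\<dots> \<le> (\<Sum>\<^sub>\<infinity>i. (\<bar>a\<bar> / \<rho>)\<^sup>2 * \<bar>coef wprof i\<bar>)"
    by (rule infsum_mono_neutral[OF sm sm]) auto
  also have "\<dots> = (\<bar>a\<bar> / \<rho>)\<^sup>2 * norm wprof"
    unfolding norm_l1_eq by (rule infsum_cmult_right')
  finally show ?thesis by (simp add: power_divide mult.commute)
qed

section \<open>Expansion in powers of a with coefficients depending on b\<close>

definition bser :: "idx l1 \<Rightarrow> nat \<Rightarrow> nat \<Rightarrow> real \<Rightarrow> real" where
  "bser g n m b = (\<Sum>\<^sub>\<infinity>j. uc g (n, m, j) * b ^ j)"

lemma bser_has_sum:
  assumes b: "\<bar>b\<bar> \<le> \<rho>"
  shows "((\<lambda>j. uc g (n, m, j) * b ^ j) has_sum bser g n m b) UNIV"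
    and "\<bar>bser g n m b\<bar> \<le> norm g / \<rho> ^ (n + m)"
proof -
  have s: "(\<lambda>j. \<bar>coef g (n, m, j)\<bar>) summable_on UNIV"
    using summable_on_reindex[of "\<lambda>j. (n, m, j)" UNIV "\<lambda>i. \<bar>coef g i\<bar>"]
      summable_on_subset_banach[OF coef_abs_summable[of g], of "range (\<lambda>j. (n, m, j))"]
    by (simp add: inj_on_def o_def)
  have le: "\<bar>uc g (n, m, j) * b ^ j\<bar> \<le> 1 / \<rho> ^ (n + m) * \<bar>coef g (n, m, j)\<bar>" for j
  proof -
    have "(\<bar>b\<bar> / \<rho>) ^ j \<le> 1" using b \<rho> by (intro power_le_one) auto
    hence "\<bar>coef g (n, m, j)\<bar> / \<rho> ^ (n + m) * (\<bar>b\<bar> / \<rho>) ^ j \<le> \<bar>coef g (n, m, j)\<bar> / \<rho> ^ (n + m) * 1"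
      using \<rho> by (intro mult_left_mono) auto
    thus ?thesis using \<rho> by (simp add: uc_def abs_mult power_abs power_divide power_add)
  qed
  have sm: "(\<lambda>j. 1 / \<rho> ^ (n + m) * \<bar>coef g (n, m, j)\<bar>) summable_on UNIV"
    by (rule summable_on_cmult_right[OF s])
  have "(\<lambda>j. \<bar>uc g (n, m, j) * b ^ j\<bar>) summable_on UNIV"
    by (rule summable_on_comparison_test[OF sm le]) auto
  hence "(\<lambda>j. uc g (n, m, j) * b ^ j) summable_on UNIV"
    by (subst summable_on_iff_abs_summable_on_real) simp
  thus hs: "((\<lambda>j. uc g (n, m, j) * b ^ j) has_sum bser g n m b) UNIV"
    unfolding bser_def by (rule has_sum_infsum)
  have "norm (bser g n m b) \<le> (\<Sum>\<^sub>\<infinity>j. 1 / \<rho> ^ (n + m) * \<bar>coef g (n, m, j)\<bar>)"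
    by (rule norm_infsum_le[OF hs has_sum_infsum[OF sm]]) (use le in auto)
  also have "\<dots> = 1 / \<rho> ^ (n + m) * (\<Sum>\<^sub>\<infinity>j. \<bar>coef g (n, m, j)\<bar>)" by (rule infsum_cmult_right')
  also have "\<dots> \<le> 1 / \<rho> ^ (n + m) * norm g"
  proof (rule mult_left_mono)
    have "(\<Sum>\<^sub>\<infinity>j. \<bar>coef g (n, m, j)\<bar>) = (\<Sum>\<^sub>\<infinity>i\<in>range (\<lambda>j. (n, m, j)). \<bar>coef g i\<bar>)"
      by (subst infsum_reindex) (auto simp: inj_on_def o_def)
    also have "\<dots> \<le> norm g"
      unfolding norm_l1_eq
      by (rule infsum_mono_neutral[OF summable_on_subset_banach[OF coef_abs_summable] coef_abs_summable]) auto
    finally show "(\<Sum>\<^sub>\<infinity>j. \<bar>coef g (n, m, j)\<bar>) \<le> norm g" .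
  qed (use \<rho> in simp)
  finally show "\<bar>bser g n m b\<bar> \<le> norm g / \<rho> ^ (n + m)" by simp
qed

lemma evr_double_series:
  assumes g: "pull swap3 g = g" and ab: "\<bar>a\<bar> \<le> \<rho>" "\<bar>b\<bar> \<le> \<rho>"
  shows "((\<lambda>(n, m). of_real (bser g n m b * a ^ (n + m)) * cis ((real n - real m) * z)) has_sum
           of_real (evr g a b z)) UNIV"
proof -
  let ?f = "\<lambda>i. cis (of_int (mode i) * z) * of_real (amp g a b i)"
  have "((\<lambda>(nm, j). ?f (fst nm, snd nm, j)) has_sum of_real (evr g a b z)) (UNIV \<times> UNIV)"
    using evr_has_sum[OF g ab, of z]
    by (subst has_sum_reindex_bij_witness[where i = "\<lambda>(n, m, j). ((n, m), j)"
          and j = "\<lambda>(nm, j). (fst nm, snd nm, j)" and T = UNIV and h = ?f]) auto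
  hence "((\<lambda>nm. of_real (bser g (fst nm) (snd nm) b * a ^ (fst nm + snd nm)) * cis ((real (fst nm) - real (snd nm)) * z)) has_sum
           of_real (evr g a b z)) UNIV"
  proof (rule has_sum_SigmaD)
    fix nm :: "nat \<times> nat"
    obtain n m where nm: "nm = (n, m)" by (cases nm)
    have "((\<lambda>j. cis ((real n - real m) * z) * of_real (a ^ (n + m)) * of_real (uc g (n, m, j) * b ^ j)) has_sum
        (cis ((real n - real m) * z) * of_real (a ^ (n + m)) * of_real (bser g n m b))) UNIV"
      by (intro has_sum_cmult_right has_sum_of_real bser_has_sum(1) ab)
    thus "((\<lambda>j. case (nm, j) of (nm, j) \<Rightarrow> ?f (fst nm, snd nm, j)) has_sum
        of_real (bser g (fst nm) (snd nm) b * a ^ (fst nm + snd nm)) * cis ((real (fst nm) - real (snd nm)) * z)) UNIV"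
      by (simp add: nm mult_ac)
  qed
  thus ?thesis by (simp add: case_prod_unfold)
qed

lemma bser_wprof_swap: "bser wprof n m b = bser wprof m n b"
proof -
  have "uc wprof (n, m, j) = uc wprof (m, n, j)" for j
    using coef_swap3[OF sym_wprof, of "(n, m, j)"] by (simp add: uc_def add.commute)
  thus ?thesis by (simp add: bser_def)
qed

text \<open>\<open>inv_mult\<close> vanishes at frequency one, so nothing but \<open>cos1\<close>
  contributes; this is why resonant pairs are absent from the expansion beyond a cos z.\<close>

lemma bser_wprof_mode1:
  "bser wprof (Suc m) m b = (if m = 0 then 1/2 else 0)"
proof -
  have "coef wprof (Suc m, m, j) = (if m = 0 \<and> j = 0 then \<rho> / 2 else 0)" for j
    by (simp add: wprof_def coef_one prof_def coef_inv inv_mult_def coef_cos1 delta_def zero_prod_def)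
  hence "bser wprof (Suc m) m b = (\<Sum>\<^sub>\<infinity>j\<in>{0::nat}. if m = 0 then 1/2 else 0)"
    unfolding bser_def using \<rho> by (intro infsum_cong_neutral) (auto simp: uc_def)
  thus ?thesis by simp
qed

lemma bser_wprof_00:
  assumes b: "\<bar>b\<bar> \<le> \<rho>"
  shows "bser wprof 0 0 b = Qb p b"
proof -
  have r0: "\<bar>0 :: real\<bar> \<le> \<rho>" using \<rho> by simp
  have "complex_of_real (Qb p b) = of_real (bser wprof 0 0 b)"
  proof (rule has_sum_unique)
    show "((\<lambda>(n, m). of_real (bser wprof n m b * 0 ^ (n + m)) * cis ((real n - real m) * 0)) has_sum complex_of_real (Qb p b)) UNIV"
      using evr_double_series[OF sym_wprof r0 b, of 0] unfolding Qb_eq[OF b] .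
    show "((\<lambda>(n, m). of_real (bser wprof n m b * 0 ^ (n + m)) * cis ((real n - real m) * 0)) has_sum complex_of_real (bser wprof 0 0 b)) UNIV"
      by (rule has_sum_finite_neutralI[of "{(0, 0)}"]) (auto simp: power_0_left split: if_splits)
  qed
  thus ?thesis by simp
qed

lemma wave_expansion:
  assumes ab: "\<bar>a\<bar> \<le> \<rho>" "\<bar>b\<bar> \<le> \<rho>"
  shows "((\<lambda>(n, m). complex_of_real (bser wprof n m b * a ^ (n + m)) * cis ((real n - real m) * z))
           has_sum complex_of_real (wave a b z - Qb p b - a * cos z)) Iset"
proof -
  let ?f = "\<lambda>(n, m). complex_of_real (bser wprof n m b * a ^ (n + m)) * cis ((real n - real m) * z)"
  have mode1: "bser wprof m (Suc m) b = (if m = 0 then 1/2 else 0)" for m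
    using bser_wprof_swap[of m "Suc m" b] by (simp add: bser_wprof_mode1)
  have "(?f has_sum complex_of_real (Qb p b + a * cos z)) (- Iset)"
  \<comment> \<open>Outside \<open>Iset\<close> lie the constant term Q_b, the two halves of a cos
    z, and the resonant pairs of higher order, whose coefficients vanish.\<close>
  proof (rule has_sum_finite_neutralI[of "{(0, 0), (1, 0), (0, 1)}"])
    have "cis z + cis (- z) = of_real (2 * cos z)" by (simp add: complex_eq_iff)
    hence "complex_of_real a * (cis z + cis (- z)) / 2 = of_real (a * cos z)" by simp
    thus "complex_of_real (Qb p b + a * cos z) = sum ?f {(0, 0), (1, 0), (0, 1)}"
      by (simp add: bser_wprof_00[OF ab(2)] mode1 bser_wprof_mode1 ring_distribs add_divide_distrib)
    fix nm assume nm: "nm \<in> - Iset - {(0, 0), (1, 0), (0, 1)}"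
    obtain n m where [simp]: "nm = (n, m)" by (cases nm)
    have "n = Suc m \<or> m = Suc n \<or> n + m < 2" using nm by (auto simp: Iset_def)
    moreover have "n + m \<noteq> 0" "(n, m) \<noteq> (1, 0)" "(n, m) \<noteq> (0, 1)" using nm by auto
    ultimately consider "n = Suc m" "m \<noteq> 0" | "m = Suc n" "n \<noteq> 0"
      by fastforce
    thus "?f nm = 0" by cases (auto simp: bser_wprof_mode1 mode1)
  qed (auto simp: Iset_def)
  from has_sum_Diff[OF evr_double_series[OF sym_wprof ab, of z] this]
  have "(?f has_sum complex_of_real (wave a b z) - complex_of_real (Qb p b + a * cos z)) (UNIV - - Iset)"
    by (simp add: wave_def)
  moreover have "UNIV - - Iset = Iset" by auto
  ultimately show ?thesis by (simp add: algebra_simps)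
qed

lemma kpow_expansion:
  assumes ab: "\<bar>a\<bar> \<le> \<rho>" "\<bar>b\<bar> \<le> \<rho>"
  shows "((\<lambda>n. \<rho> * bser (disp \<rho> h) n n b * a ^ (2 * n)) has_sum (wavenumber a b powr \<alpha> - kstar p b)) {1..}"
proof -
  have off: "bser (disp \<rho> h) n m b = 0" if "n \<noteq> m" for n m
    using that by (simp add: bser_def uc_def disp_radial)
  have series: "((\<lambda>n. \<rho> * bser (disp \<rho> h) n n b * a ^ (2 * n)) has_sum \<rho> * evr (disp \<rho> h) a b 0) UNIV"
    if a: "\<bar>a\<bar> \<le> \<rho>" for a
  proof -
    have "((\<lambda>nm. complex_of_real (bser (disp \<rho> h) (fst nm) (snd nm) b * a ^ (fst nm + snd nm))) has_sum
           of_real (evr (disp \<rho> h) a b 0)) UNIV"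
      using evr_double_series[OF sym_disp a ab(2), of 0] by (simp add: case_prod_unfold)
    hence "((\<lambda>nm. bser (disp \<rho> h) (fst nm) (snd nm) b * a ^ (fst nm + snd nm)) has_sum evr (disp \<rho> h) a b 0) UNIV"
      by (simp only: has_sum_of_real_iff)
    hence "((\<lambda>nm. bser (disp \<rho> h) (fst nm) (snd nm) b * a ^ (fst nm + snd nm)) has_sum evr (disp \<rho> h) a b 0) (range (\<lambda>n. (n, n)))"
      by (subst has_sum_cong_neutral[where T = UNIV
            and g = "\<lambda>nm. bser (disp \<rho> h) (fst nm) (snd nm) b * a ^ (fst nm + snd nm)"])
         (auto simp: off image_iff)
    hence "((\<lambda>n. bser (disp \<rho> h) n n b * a ^ (2 * n)) has_sum evr (disp \<rho> h) a b 0) UNIV"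
      by (subst (asm) has_sum_reindex) (auto simp: inj_on_def o_def mult_2)
    from has_sum_cmult_right[OF this, of \<rho>] show ?thesis by (simp add: mult.assoc)
  qed
  have r0: "\<bar>0 :: real\<bar> \<le> \<rho>" using \<rho> by simp
  \<comment> \<open>Evaluating the same series at a = 0 isolates its term n = 0, which is thereby
    identified with the difference of \<open>kstar p b\<close> and p.\<close>
  have "\<rho> * evr (disp \<rho> h) 0 b 0 = \<rho> * bser (disp \<rho> h) 0 0 b"
    by (rule has_sum_unique[OF series[OF r0]], rule has_sum_finite_neutralI[of "{0}"])
       (auto simp: power_0_left)
  hence k0: "kstar p b = p + \<rho> * bser (disp \<rho> h) 0 0 b"
    using kstar_eq[OF ab(2), of 0] evr_kpow[OF r0 ab(2), of 0] by linarith
  have "((\<lambda>n. \<rho> * bser (disp \<rho> h) n n b * a ^ (2 * n)) has_sum (\<rho> * bser (disp \<rho> h) 0 0 b)) {0}"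
    by (rule has_sum_finiteI) auto
  from has_sum_Diff[OF series[OF ab(1)] this]
  have "((\<lambda>n. \<rho> * bser (disp \<rho> h) n n b * a ^ (2 * n)) has_sum
      (\<rho> * evr (disp \<rho> h) a b 0 - \<rho> * bser (disp \<rho> h) 0 0 b)) (UNIV - {0})" by simp
  moreover have "UNIV - {0 :: nat} = {1..}" by auto
  ultimately show ?thesis
    unfolding wavenumber_powr[OF ab] evr_kpow[OF ab] k0 by simp
qed

end

section \<open>Choice of the radius and assembly\<close>

lemma (in wave) exists_solution: "\<exists>\<rho> h. wave_solution \<alpha> p \<rho> h"
proof -
  define \<theta> where "\<theta> = (1 / (p + 1)) powr (1 / p)"
  \<comment> \<open>One bound meets both demands: 1/2 for the binomial series, and half of the
    distance from 1 to the threshold so that the inequality in \<open>thr\<close> is strict.\<close>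
  define \<delta> where "\<delta> = min (1/2) ((1 - \<theta>) / 2)"
  have \<theta>: "\<theta> < 1" unfolding \<theta>_def by (rule threshold_less_1[OF p])
  hence \<delta>: "\<delta> > 0" "\<delta> \<le> 1/2" "\<delta> < 1 - \<theta>" by (auto simp: \<delta>_def min_def field_simps)
  have nn: "gap \<ge> 1" "lipc \<ge> 0" "rad \<ge> 1" using gap_ge_1 lipc_nonneg by (auto simp: rad_def)
  hence sc: "stepc > 0" unfolding stepc_def by (intro add_pos_nonneg) auto
  define \<rho> where "\<rho> = \<delta> / stepc"
  have \<rho>: "\<rho> > 0" "\<rho> * stepc = \<delta>" using \<delta> sc by (auto simp: \<rho>_def)
  have \<rho>': "\<rho> * stepc \<le> 1/2" using \<rho> \<delta> by simp
  obtain h where h: "norm h \<le> 2" "pull swap3 h = h" "step \<rho> h = h"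
    using exists_fixed_point(1)[OF \<rho>(1) \<rho>'] by blast
  have "wave_solution \<alpha> p \<rho> h"
    by unfold_locales
       (use exists_fixed_point(2,3)[OF \<rho>(1) \<rho>' h(1)] h \<rho> \<delta> in \<open>auto simp: \<theta>_def\<close>)
  thus ?thesis by blast
qed

theorem theoremA1:
  fixes \<alpha> p :: real
  assumes "\<alpha> > 1/2" and "p \<ge> 1"
    and "p \<in> \<nat> \<or> (\<exists>m n :: int. even m \<and> odd n \<and> p = of_int m / of_int n)"
  shows "\<exists>a0 > 0. \<exists>b0 > 0. \<exists>k :: real \<Rightarrow> real \<Rightarrow> real. \<exists>P :: real \<Rightarrow> real \<Rightarrow> real \<Rightarrow> real.
    (\<forall>a b. \<bar>a\<bar> < a0 \<and> \<bar>b\<bar> < b0 \<longrightarrow>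
       k a b > 0 \<and> smooth_fun (P a b) \<and> (\<forall>z. P a b (z + 2 * pi) = P a b z)
       \<and> (\<forall>z. P a b (- z) = P a b z)
       \<and> (\<forall>x. lam_term (2 * pi / k a b) \<alpha> (\<lambda>y. P a b (k a b * y)) x summable_on UNIV
            \<and> - frac_lap (2 * pi / k a b) \<alpha> (\<lambda>y. P a b (k a b * y)) x
              - complex_of_real (P a b (k a b * x))
              + complex_of_real (P a b (k a b * x) * ppow p (P a b (k a b * x)))
              = complex_of_real b))
    \<and> real_analytic2_on ({-a0<..<a0} \<times> {-b0<..<b0}) k
    \<and> (\<forall>a b. \<bar>a\<bar> < a0 \<and> \<bar>b\<bar> < b0 \<longrightarrow> k (- a) b = k a b)
    \<and> Hs_analytic2_on \<alpha> ({-a0<..<a0} \<times> {-b0<..<b0}) P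
    \<and> (\<exists>\<rho>0 > a0. \<exists>K0 > 0. \<exists>C0 > 0. \<exists>kt :: nat \<Rightarrow> real \<Rightarrow> real. \<exists>pt :: nat \<Rightarrow> nat \<Rightarrow> real \<Rightarrow> real.
         (\<forall>n \<ge> 1. \<forall>b. \<bar>b\<bar> < b0 \<longrightarrow> \<bar>kt n b\<bar> \<le> K0 / \<rho>0 ^ (2 * n))
       \<and> (\<forall>a b. \<bar>a\<bar> < a0 \<and> \<bar>b\<bar> < b0 \<longrightarrow>
            ((\<lambda>n. kt n b * a ^ (2 * n)) has_sum (k a b powr \<alpha> - kstar p b)) {1..})
       \<and> (\<forall>n m b. (n, m) \<in> Iset \<and> \<bar>b\<bar> < b0 \<longrightarrow>
            pt n m b = pt m n b \<and> \<bar>pt n m b\<bar> \<le> C0 / \<rho>0 ^ (n + m))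
       \<and> (\<forall>a b z. \<bar>a\<bar> < a0 \<and> \<bar>b\<bar> < b0 \<longrightarrow>
            ((\<lambda>(n, m). complex_of_real (pt n m b * a ^ (n + m)) * cis ((real n - real m) * z))
               has_sum complex_of_real (P a b z - Qb p b - a * cos z)) Iset))
    \<and> (\<forall>a b n. \<bar>a\<bar> < a0 \<and> \<bar>b\<bar> < b0 \<longrightarrow>
         Im (fc (P a b) n) = 0
       \<and> fc (P (- a) b) n = (if even n then fc (P a b) n else - fc (P a b) n))
    \<and> (\<lambda>a. Re (fc (P a 0) 0) - 1) \<in> O[at 0](\<lambda>a. a ^ 2)
    \<and> (\<forall>n :: int. n \<noteq> 0 \<longrightarrow> (\<lambda>a. Re (fc (P a 0) n)) \<in> O[at 0](\<lambda>a. \<bar>a\<bar> ^ nat \<bar>n\<bar>))"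
proof -
  interpret wave \<alpha> p by unfold_locales (use assms in auto)
  obtain \<rho> h where "wave_solution \<alpha> p \<rho> h" using exists_solution by blast
  then interpret wave_solution \<alpha> p \<rho> h .
  have half: "\<bar>x\<bar> \<le> \<rho>" if "\<bar>x\<bar> < \<rho> / 2" for x using that \<rho> by linarith
  have near: "\<forall>\<^sub>F a in at 0. \<bar>a\<bar> \<le> \<rho>"
    unfolding eventually_at using \<rho> by (intro exI[of _ \<rho>]) (auto simp: dist_real_def)
  have sol: "\<forall>a b. \<bar>a\<bar> < \<rho>/2 \<and> \<bar>b\<bar> < \<rho>/2 \<longrightarrow>
       wavenumber a b > 0 \<and> smooth_fun (wave a b) \<and> (\<forall>z. wave a b (z + 2 * pi) = wave a b z)
       \<and> (\<forall>z. wave a b (- z) = wave a b z)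
       \<and> (\<forall>x. lam_term (2 * pi / wavenumber a b) \<alpha> (\<lambda>y. wave a b (wavenumber a b * y)) x summable_on UNIV
            \<and> - frac_lap (2 * pi / wavenumber a b) \<alpha> (\<lambda>y. wave a b (wavenumber a b * y)) x
              - complex_of_real (wave a b (wavenumber a b * x))
              + complex_of_real (wave a b (wavenumber a b * x) * ppow p (wave a b (wavenumber a b * x)))
              = complex_of_real b)"
    using half
    by (intro allI impI conjI wavenumber_pos wave_smooth wave_periodic wave_even wave_equation) auto
  have expansions: "\<exists>\<rho>0 > \<rho>/2. \<exists>K0 > 0. \<exists>C0 > 0. \<exists>kt :: nat \<Rightarrow> real \<Rightarrow> real. \<exists>pt :: nat \<Rightarrow> nat \<Rightarrow> real \<Rightarrow> real.
         (\<forall>n \<ge> 1. \<forall>b. \<bar>b\<bar> < \<rho>/2 \<longrightarrow> \<bar>kt n b\<bar> \<le> K0 / \<rho>0 ^ (2 * n))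
       \<and> (\<forall>a b. \<bar>a\<bar> < \<rho>/2 \<and> \<bar>b\<bar> < \<rho>/2 \<longrightarrow>
            ((\<lambda>n. kt n b * a ^ (2 * n)) has_sum (wavenumber a b powr \<alpha> - kstar p b)) {1..})
       \<and> (\<forall>n m b. (n, m) \<in> Iset \<and> \<bar>b\<bar> < \<rho>/2 \<longrightarrow>
            pt n m b = pt m n b \<and> \<bar>pt n m b\<bar> \<le> C0 / \<rho>0 ^ (n + m))
       \<and> (\<forall>a b z. \<bar>a\<bar> < \<rho>/2 \<and> \<bar>b\<bar> < \<rho>/2 \<longrightarrow>
            ((\<lambda>(n, m). complex_of_real (pt n m b * a ^ (n + m)) * cis ((real n - real m) * z))
               has_sum complex_of_real (wave a b z - Qb p b - a * cos z)) Iset)"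
  \<comment> \<open>The geometric rate \<rho> is strictly larger than the half-width \<rho>/2 chosen
    for a; adding 1 to the norms makes the constants positive in every case.\<close>
  proof (rule exI[of _ \<rho>], intro conjI, simp add: \<rho>,
      rule exI[of _ "\<rho> * norm (disp \<rho> h) + 1"], intro conjI,
      (rule add_nonneg_pos, use \<rho> in simp, simp),
      rule exI[of _ "norm wprof + 1"], intro conjI, (rule add_nonneg_pos, simp, simp),
      rule exI[of _ "\<lambda>n b. \<rho> * bser (disp \<rho> h) n n b"], rule exI[of _ "bser wprof"],
      intro conjI allI impI)
    fix n :: nat and b :: real assume b: "\<bar>b\<bar> < \<rho> / 2"
    have "\<rho> * \<bar>bser (disp \<rho> h) n n b\<bar> \<le> \<rho> * (norm (disp \<rho> h) / \<rho> ^ (n + n))"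
      using \<rho> by (intro mult_left_mono bser_has_sum half b) auto
    also have "\<dots> \<le> (\<rho> * norm (disp \<rho> h) + 1) / \<rho> ^ (2 * n)"
      using \<rho> by (simp add: mult_2 divide_right_mono)
    finally show "\<bar>\<rho> * bser (disp \<rho> h) n n b\<bar> \<le> (\<rho> * norm (disp \<rho> h) + 1) / \<rho> ^ (2 * n)"
      using \<rho> by (simp add: abs_mult)
  next
    fix a b :: real assume "\<bar>a\<bar> < \<rho> / 2 \<and> \<bar>b\<bar> < \<rho> / 2"
    thus "((\<lambda>n. \<rho> * bser (disp \<rho> h) n n b * a ^ (2 * n)) has_sum (wavenumber a b powr \<alpha> - kstar p b)) {1..}"
      by (intro kpow_expansion half) auto
  next
    fix n m b show "bser wprof n m b = bser wprof m n b" by (rule bser_wprof_swap)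
  next
    fix n m b assume "(n, m) \<in> Iset \<and> \<bar>b\<bar> < \<rho> / 2"
    hence "\<bar>bser wprof n m b\<bar> \<le> norm wprof / \<rho> ^ (n + m)" by (intro bser_has_sum half) auto
    also have "\<dots> \<le> (norm wprof + 1) / \<rho> ^ (n + m)" using \<rho> by (intro divide_right_mono) auto
    finally show "\<bar>bser wprof n m b\<bar> \<le> (norm wprof + 1) / \<rho> ^ (n + m)" .
  next
    fix a b z :: real assume "\<bar>a\<bar> < \<rho> / 2 \<and> \<bar>b\<bar> < \<rho> / 2"
    thus "((\<lambda>(n, m). complex_of_real (bser wprof n m b * a ^ (n + m)) * cis ((real n - real m) * z))
               has_sum complex_of_real (wave a b z - Qb p b - a * cos z)) Iset"
      by (intro wave_expansion half) auto
  qed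
  have fourier: "\<forall>a b n. \<bar>a\<bar> < \<rho>/2 \<and> \<bar>b\<bar> < \<rho>/2 \<longrightarrow>
         Im (fc (wave a b) n) = 0
       \<and> fc (wave (- a) b) n = (if even n then fc (wave a b) n else - fc (wave a b) n)"
    by (intro allI impI conjI fc_wave_Re fc_wave_parity half) auto
  have mean: "(\<lambda>a. Re (fc (wave a 0) 0) - 1) \<in> O[at 0](\<lambda>a. a ^ 2)"
    by (rule bigoI[of _ "norm wprof / \<rho>\<^sup>2"], rule eventually_mono[OF near])
       (use fc_wave_0_bound in auto)
  have decay: "(\<lambda>a. Re (fc (wave a 0) n)) \<in> O[at 0](\<lambda>a. \<bar>a\<bar> ^ nat \<bar>n\<bar>)" for n :: int
    by (rule bigoI[of _ "norm wprof / \<rho> ^ nat \<bar>n\<bar>"], rule eventually_mono[OF near])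
       (use fc_wave_bound[of _ n] in auto)
  show ?thesis
    by (rule exI[of _ "\<rho> / 2"], intro conjI, use \<rho> in simp,
        rule exI[of _ "\<rho> / 2"], intro conjI, use \<rho> in simp,
        rule exI[of _ wavenumber], rule exI[of _ wave],
        intro conjI sol wavenumber_analytic wave_analytic expansions fourier mean)
       (use wavenumber_even half decay in auto)
qed

end
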